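(* Consider the setting and assumptions described in the context, and suppose Assumptions A3, B1 and B2 hold. Then, as $T\to\infty$: (a) $R\sqrt T(\hat\beta-\beta)\to^d\mathcal RQ_{XX}^{-1}\Lambda_X\left(\frac1\lambda\int_0^\lambda dW_{m+\ell}(r)-\frac1{1-\lambda}\int_\lambda^1dW_{m+\ell}(r)\right)$. (b) Jointly over $j=1,\ldots,K$, \[ R\hat Q_{\tilde X\cdot Z}^{-1}\frac1{\sqrt T}\sum_{t=1}^T\phi_j\left(\frac tT\right)\tilde X_{z,t}'\hat u_t\to^d\mathcal RQ_{XX}^{-1}\Lambda_X\int_0^1\tilde\phi_j(r;\lambda)dW_{m+\ell}(r). \] (c) Under the null hypothesis $H_0:R\beta=0$, \[ F_T\to^d\left[\frac1\lambda\int_0^\lambda dW_p(r)-\frac1{1-\lambda}\int_\lambda^1dW_p(r)\right]'\left[\frac1K\sum_{j=1}^K\left\{\int_0^1\tilde\phi_j(r;\lambda)dW_p(r)\right\}^{\otimes2}\right]^{-1}\left[\frac1\lambda\int_0^\lambda dW_p(r)-\frac1{1-\lambda}\int_\lambda^1dW_p(r)\right], \] and, when $p=1$, \[ t_T\to^d\left[\frac1\lambda\int_0^\lambda dW_p(r)-\frac1{1-\lambda}\int_\lambda^1dW_p(r)\right]\left[\frac1K\sum_{j=1}^K\left\{\int_0^1\tilde\phi_j(r;\lambda)dW_p(r)\right\}^{\otimes2}\right]^{-1/2}, \] where $W_p$ is a $p\times1$ standard Brownian motion.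
   Context: Setting. For each $T$ we observe $\{X_t,Z_t,Y_t\}_{t=1}^T$ with row vectors $X_t\in\mathbb{R}^{1\times m}$, $Z_t\in\mathbb{R}^{1\times\ell}$, and $Y_t\in\mathbb{R}$. Let $\lambda\in(0,1)$ be known, $[\cdot]$ the integer part. Model: $Y_t=X_t1\{t\le[\lambda T]\}\beta_1+X_t1\{t\ge[\lambda T]+1\}\beta_2+Z_t\gamma+u_t$ with $\beta_1,\beta_2\in\mathbb{R}^m$, $\gamma\in\mathbb{R}^\ell$. Let $\tilde X_t=(X_t1\{t\le[\lambda T]\},X_t1\{t\ge[\lambda T]+1\})\in\mathbb{R}^{1\times2m}$, $\beta=(\beta_1',\beta_2')'$, $\tilde X=(\tilde X_1',\ldots,\tilde X_T')'$, $Z=(Z_1',\ldots,Z_T')'$, $Y=(Y_1,\ldots,Y_T)'$, $M_Z=I_T-Z(Z'Z)^{-1}Z'$. Define $\hat\beta=(\tilde X'M_Z\tilde X)^{-1}\tilde X'M_ZY$, $\hat u=(\hat u_1,\ldots,\hat u_T)'=M_ZY-M_Z\tilde X\hat\beta$, $\tilde X_z=(\tilde X_{z,1}',\ldots,\tilde X_{z,T}')'=M_Z\tilde X$, $\hat Q_{\tilde X\cdot Z}=\tilde X'M_Z\tilde X/T$, and for given real functions $\phi_1,\ldots,\phi_K$ on $[0,1]$ ($K$ fixed) $\hat\Omega=\frac1K\sum_{j=1}^K\big[\frac1{\sqrt T}\sum_{t=1}^T\phi_j(t/T)\tilde X_{z,t}'\hat u_t\big]^{\otimes2}$, $a^{\otimes2}=aa'$.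 For a $p\times m$ matrix $\mathcal R$ let $R=[\mathcal R,-\mathcal R]$; $F_T=T(R\hat\beta)'[R\hat Q_{\tilde X\cdot Z}^{-1}\hat\Omega\hat Q_{\tilde X\cdot Z}^{-1}R']^{-1}(R\hat\beta)$ and, when $p=1$, $t_T=\sqrt TR\hat\beta/[R\hat Q_{\tilde X\cdot Z}^{-1}\hat\Omega\hat Q_{\tilde X\cdot Z}^{-1}R']^{1/2}$. Transformed functions: $\bar\phi_{j,1}=\frac1\lambda\int_0^\lambda\phi_j(s)ds$, $\bar\phi_{j,2}=\frac1{1-\lambda}\int_\lambda^1\phi_j(s)ds$, $\tilde\phi_j(r;\lambda)=\frac1\lambda[\phi_j(r)-\bar\phi_{j,1}]1\{r\le\lambda\}-\frac1{1-\lambda}[\phi_j(r)-\bar\phi_{j,2}]1\{r>\lambda\}$. Assumption A3: each $\phi_j$ is piecewise monotonic and piecewise continuously differentiable on $[0,1]$. Assumption B1: $T^{-1}\sum_{t=1}^{[Tr]}(X_t,Z_t)'(X_t,Z_t)\to^pQ\cdot r$ uniformly over $r\in[0,1]$ for an invertible $(m+\ell)\times(m+\ell)$ matrix $Q=\begin{pmatrix}Q_{XX}&Q_{XZ}\\Q_{ZX}&Q_{ZZ}\end{pmatrix}$, $Q_{XX}\in\mathbb{R}^{m\times m}$, $Q_{ZZ}\in\mathbb{R}^{\ell\times\ell}$. Assumption B2: $T^{-1/2}\sum_{t=1}^{[Tr]}(X_t,Z_t)'u_t\to^d\Lambda W_{m+\ell}(r)$ as processes on $[0,1]$, where $\Lambda\Lambda'$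 is the long run variance of $\{(X_t,Z_t)'u_t\}$, $W_{m+\ell}$ is an $(m+\ell)\times1$ standard Brownian motion, and $\Lambda=\begin{pmatrix}\Lambda_X\\\Lambda_Z\end{pmatrix}$ with $\Lambda_X\in\mathbb{R}^{m\times(m+\ell)}$, $\Lambda_Z\in\mathbb{R}^{\ell\times(m+\ell)}$. Non-degeneracy (for part (c)): the $p\times(m+\ell)$ matrix $\mathcal RQ_{XX}^{-1}\Lambda_X$ has rank $p$ and the random matrix $\frac1K\sum_{j=1}^K\{\int_0^1\tilde\phi_j(r;\lambda)dW_p(r)\}^{\otimes2}$ is almost surely invertible. *)

theory Defs
  imports "HOL-Analysis.Analysis" "HOL-Probability.Probability"
begin

definition outer :: "real^'n \<Rightarrow> real^'m \<Rightarrow> real^'m^'n" where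
  "outer a b = (\<chi> i j. a$i * b$j)"

definition join :: "real^'m \<Rightarrow> real^'l \<Rightarrow> real^('m::finite + 'l::finite)" where
  "join x z = (\<chi> k. case k of Inl i \<Rightarrow> x$i | Inr i \<Rightarrow> z$i)"

definition QXX :: "real^('m::finite + 'l::finite)^('m + 'l) \<Rightarrow> real^'m^'m" where
  "QXX Q = (\<chi> i j. Q $ Inl i $ Inl j)"

definition LamX :: "real^('m::finite + 'l::finite)^('m + 'l) \<Rightarrow> real^('m + 'l)^'m" where
  "LamX L = (\<chi> i. L $ Inl i)"

definition Rmat :: "real^'m::finite^'p \<Rightarrow> real^('m + 'm)^'p" where
  "Rmat Rc = (\<chi> i k. case k of Inl a \<Rightarrow> Rc$i$a | Inr a \<Rightarrow> - (Rc$i$a))"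

definition stack :: "real^'m::finite \<Rightarrow> real^'m \<Rightarrow> real^('m + 'm)" where
  "stack b1 b2 = (\<chi> k. case k of Inl i \<Rightarrow> b1$i | Inr i \<Rightarrow> b2$i)"

definition brk :: "real \<Rightarrow> nat \<Rightarrow> nat" where
  "brk lam T = nat \<lfloor>lam * real T\<rfloor>"

definition Xtil :: "real \<Rightarrow> nat \<Rightarrow> real^'m::finite \<Rightarrow> nat \<Rightarrow> real^('m + 'm)" where
  "Xtil lam T x t = (\<chi> k. case k of
      Inl i \<Rightarrow> (if t \<le> brk lam T then x$i else 0)
    | Inr i \<Rightarrow> (if t \<ge> brk lam T + 1 then x$i else 0))"

definition Ymod :: "real \<Rightarrow> nat \<Rightarrow> real^'m \<Rightarrow> real^'m \<Rightarrow> real^'l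
     \<Rightarrow> (nat \<Rightarrow> real^'m) \<Rightarrow> (nat \<Rightarrow> real^'l) \<Rightarrow> (nat \<Rightarrow> real) \<Rightarrow> nat \<Rightarrow> real" where
  "Ymod lam T b1 b2 g xs zs us t =
     (if t \<le> brk lam T then xs t \<bullet> b1 else 0) + (if t \<ge> brk lam T + 1 then xs t \<bullet> b2 else 0)
     + zs t \<bullet> g + us t"

definition Szz :: "nat \<Rightarrow> (nat \<Rightarrow> real^'l) \<Rightarrow> real^'l^'l" where
  "Szz T zs = (\<Sum>t\<in>{1..T}. outer (zs t) (zs t))"

text \<open>Row t of M_Z Xtil (transposed): Xtil_t' - (Xtil'Z)(Z'Z)^{-1} Z_t'\<close>
definition Xz :: "real \<Rightarrow> nat \<Rightarrow> (nat \<Rightarrow> real^'m) \<Rightarrow> (nat \<Rightarrow> real^'l) \<Rightarrow> nat \<Rightarrow> real^('m + 'm)" where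
  "Xz lam T xs zs t = Xtil lam T (xs t) t
     - ((\<Sum>s\<in>{1..T}. outer (Xtil lam T (xs s) s) (zs s)) ** matrix_inv (Szz T zs)) *v zs t"

definition Yz :: "nat \<Rightarrow> (nat \<Rightarrow> real^'l) \<Rightarrow> (nat \<Rightarrow> real) \<Rightarrow> nat \<Rightarrow> real" where
  "Yz T zs ys t = ys t - zs t \<bullet> (matrix_inv (Szz T zs) *v (\<Sum>s\<in>{1..T}. ys s *\<^sub>R zs s))"

definition SXX :: "real \<Rightarrow> nat \<Rightarrow> (nat \<Rightarrow> real^'m) \<Rightarrow> (nat \<Rightarrow> real^'l) \<Rightarrow> real^('m+'m)^('m+'m)" where
  "SXX lam T xs zs = (\<Sum>t\<in>{1..T}. outer (Xz lam T xs zs t) (Xz lam T xs zs t))"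

definition Qhat :: "real \<Rightarrow> nat \<Rightarrow> (nat \<Rightarrow> real^'m) \<Rightarrow> (nat \<Rightarrow> real^'l) \<Rightarrow> real^('m+'m)^('m+'m)" where
  "Qhat lam T xs zs = (1 / real T) *\<^sub>R SXX lam T xs zs"

definition bhat :: "real \<Rightarrow> nat \<Rightarrow> (nat \<Rightarrow> real^'m) \<Rightarrow> (nat \<Rightarrow> real^'l) \<Rightarrow> (nat \<Rightarrow> real) \<Rightarrow> real^('m+'m)" where
  "bhat lam T xs zs ys = matrix_inv (SXX lam T xs zs) *v (\<Sum>t\<in>{1..T}. ys t *\<^sub>R Xz lam T xs zs t)"

definition uhat :: "real \<Rightarrow> nat \<Rightarrow> (nat \<Rightarrow> real^'m) \<Rightarrow> (nat \<Rightarrow> real^'l) \<Rightarrow> (nat \<Rightarrow> real) \<Rightarrow> nat \<Rightarrow> real" where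
  "uhat lam T xs zs ys t = Yz T zs ys t - Xz lam T xs zs t \<bullet> bhat lam T xs zs ys"

definition vj :: "real \<Rightarrow> nat \<Rightarrow> (nat \<Rightarrow> real^'m) \<Rightarrow> (nat \<Rightarrow> real^'l) \<Rightarrow> (nat \<Rightarrow> real) \<Rightarrow> (real \<Rightarrow> real) \<Rightarrow> real^('m+'m)" where
  "vj lam T xs zs ys \<phi> = (1 / sqrt (real T)) *\<^sub>R
      (\<Sum>t\<in>{1..T}. (\<phi> (real t / real T) * uhat lam T xs zs ys t) *\<^sub>R Xz lam T xs zs t)"

definition Omega_hat :: "real \<Rightarrow> nat \<Rightarrow> (nat \<Rightarrow> real^'m) \<Rightarrow> (nat \<Rightarrow> real^'l) \<Rightarrow> (nat \<Rightarrow> real)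
    \<Rightarrow> ('k::finite \<Rightarrow> real \<Rightarrow> real) \<Rightarrow> real^('m+'m)^('m+'m)" where
  "Omega_hat lam T xs zs ys \<phi>s = (1 / real CARD('k)) *\<^sub>R
      (\<Sum>j\<in>UNIV. outer (vj lam T xs zs ys (\<phi>s j)) (vj lam T xs zs ys (\<phi>s j)))"

definition Vhat :: "real^'m^'p \<Rightarrow> real \<Rightarrow> nat \<Rightarrow> (nat \<Rightarrow> real^'m) \<Rightarrow> (nat \<Rightarrow> real^'l) \<Rightarrow> (nat \<Rightarrow> real)
    \<Rightarrow> ('k::finite \<Rightarrow> real \<Rightarrow> real) \<Rightarrow> real^'p^'p" where
  "Vhat Rc lam T xs zs ys \<phi>s = Rmat Rc ** matrix_inv (Qhat lam T xs zs) ** Omega_hat lam T xs zs ys \<phi>s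
      ** matrix_inv (Qhat lam T xs zs) ** transpose (Rmat Rc)"

definition Fstat :: "real^'m^'p \<Rightarrow> real \<Rightarrow> nat \<Rightarrow> (nat \<Rightarrow> real^'m) \<Rightarrow> (nat \<Rightarrow> real^'l) \<Rightarrow> (nat \<Rightarrow> real)
    \<Rightarrow> ('k::finite \<Rightarrow> real \<Rightarrow> real) \<Rightarrow> real" where
  "Fstat Rc lam T xs zs ys \<phi>s = real T * ((Rmat Rc *v bhat lam T xs zs ys)
      \<bullet> (matrix_inv (Vhat Rc lam T xs zs ys \<phi>s) *v (Rmat Rc *v bhat lam T xs zs ys)))"

text \<open>t statistic, meant for p = 1 (i is the unique index)\<close>
definition tstat :: "real^'m^'p \<Rightarrow> real \<Rightarrow> nat \<Rightarrow> (nat \<Rightarrow> real^'m) \<Rightarrow> (nat \<Rightarrow> real^'l) \<Rightarrow> (nat \<Rightarrow> real)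
    \<Rightarrow> ('k::finite \<Rightarrow> real \<Rightarrow> real) \<Rightarrow> 'p \<Rightarrow> real" where
  "tstat Rc lam T xs zs ys \<phi>s i = sqrt (real T) * (Rmat Rc *v bhat lam T xs zs ys) $ i
      / sqrt (Vhat Rc lam T xs zs ys \<phi>s $ i $ i)"

definition phitil :: "(real \<Rightarrow> real) \<Rightarrow> real \<Rightarrow> real \<Rightarrow> real" where
  "phitil \<phi> lam r =
     (if r \<le> lam then (1 / lam) * (\<phi> r - (1 / lam) * integral {0..lam} \<phi>)
      else - (1 / (1 - lam)) * (\<phi> r - (1 / (1 - lam)) * integral {lam..1} \<phi>))"

definition piecewise_mono_C1 :: "(real \<Rightarrow> real) \<Rightarrow> bool" where
  "piecewise_mono_C1 \<phi> \<longleftrightarrow> (\<exists>S. finite S \<and> {0,1} \<subseteq> S \<and> S \<subseteq> {0..1} \<and>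
     (\<forall>a\<in>S. \<forall>b\<in>S. a < b \<and> {a<..<b} \<inter> S = {} \<longrightarrow>
        (\<exists>\<psi>. \<psi> C1_differentiable_on {a..b} \<and>
              (monotone_on {a..b} (\<le>) (\<le>) \<psi> \<or> monotone_on {a..b} (\<le>) (\<ge>) \<psi>) \<and>
              (\<forall>x\<in>{a<..<b}. \<phi> x = \<psi> x))))"

definition std_BM :: "'a measure \<Rightarrow> (real \<Rightarrow> 'a \<Rightarrow> real^'n) \<Rightarrow> bool" where
  "std_BM M W \<longleftrightarrow> prob_space M \<and>
     (\<forall>t\<in>{0..1}. W t \<in> borel_measurable M) \<and>
     (AE \<omega> in M. W 0 \<omega> = 0) \<and>
     (AE \<omega> in M. continuous_on {0..1} (\<lambda>t. W t \<omega>)) \<and>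
     (\<forall>ts::real list. sorted ts \<and> distinct ts \<and> set ts \<subseteq> {0..1} \<longrightarrow>
        prob_space.indep_vars M (\<lambda>_. borel)
          (\<lambda>(i, k) \<omega>. (W (ts ! Suc k) \<omega> - W (ts ! k) \<omega>) $ i) (UNIV \<times> {..<length ts - 1})) \<and>
     (\<forall>s t i. 0 \<le> s \<and> s < t \<and> t \<le> 1 \<longrightarrow>
        distributed M lborel (\<lambda>\<omega>. (W t \<omega> - W s \<omega>) $ i) (normal_density 0 (sqrt (t - s))))"

definition wiener_int :: "'a measure \<Rightarrow> (real \<Rightarrow> 'a \<Rightarrow> real^'n) \<Rightarrow> (real \<Rightarrow> real) \<Rightarrow> ('a \<Rightarrow> real^'n) \<Rightarrow> bool" where
  "wiener_int M W f Y \<longleftrightarrow> Y \<in> borel_measurable M \<and>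
     (\<forall>e>0. (\<lambda>n. measure M {\<omega>\<in>space M.
        dist (\<Sum>k<n. f (real k / real n) *\<^sub>R (W (real (Suc k) / real n) \<omega> - W (real k / real n) \<omega>)) (Y \<omega>) > e})
      \<longlonglongrightarrow> 0)"

definition conv_distr :: "'a measure \<Rightarrow> (nat \<Rightarrow> 'a \<Rightarrow> 'e::euclidean_space) \<Rightarrow> 'b measure \<Rightarrow> ('b \<Rightarrow> 'e) \<Rightarrow> bool" where
  "conv_distr P Xs M X \<longleftrightarrow> (\<forall>g :: 'e \<Rightarrow> real. continuous_on UNIV g \<and> bounded (range g) \<longrightarrow>
     (\<lambda>T. \<integral>\<omega>. g (Xs T \<omega>) \<partial>P) \<longlonglongrightarrow> (\<integral>\<omega>. g (X \<omega>) \<partial>M))"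

text \<open>Functional convergence in distribution of processes on [0,1] to a limit with continuous
  paths: paths are elements of the product space (projection sigma-algebra); test functionals are
  bounded, measurable, and continuous for the uniform metric at every continuous path.\<close>
definition sup_cont_at :: "((real \<Rightarrow> real^'n) \<Rightarrow> real) \<Rightarrow> (real \<Rightarrow> real^'n) \<Rightarrow> bool" where
  "sup_cont_at g x \<longleftrightarrow> (\<forall>e>0. \<exists>d>0. \<forall>y\<in>extensional {0..1}.
      (\<forall>r\<in>{0..1}. dist (y r) (x r) < d) \<longrightarrow> \<bar>g y - g x\<bar> < e)"

definition fconv_distr :: "'a measure \<Rightarrow> (nat \<Rightarrow> 'a \<Rightarrow> real \<Rightarrow> real^'n) \<Rightarrow> 'b measure \<Rightarrow> ('b \<Rightarrow> real \<Rightarrow> real^'n) \<Rightarrow> bool" where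
  "fconv_distr P S M Y \<longleftrightarrow> (\<forall>g :: (real \<Rightarrow> real^'n) \<Rightarrow> real.
     g \<in> borel_measurable (PiM {0..1} (\<lambda>_. borel)) \<and> bounded (range g) \<and>
     (\<forall>x\<in>extensional {0..1}. continuous_on {0..1} x \<longrightarrow> sup_cont_at g x) \<longrightarrow>
     (\<lambda>T. \<integral>\<omega>. g (restrict (S T \<omega>) {0..1}) \<partial>P) \<longlonglongrightarrow> (\<integral>\<omega>. g (restrict (Y \<omega>) {0..1}) \<partial>M))"

end

theory Submission
  imports Defs
begin

text \<open>
  Every statistic is a fixed function of finitely many weighted moments
  \<open>T\<^sup>-\<^sup>1 \<Sum> f(t/T) \<xi>\<^sub>t \<xi>\<^sub>t'\<close> and weighted scores \<open>T\<^sup>-\<^sup>1\<^sup>/\<^sup>2 \<Sum> f(t/T) u\<^sub>t \<xi>\<^sub>t\<close> with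
  \<open>\<xi>\<^sub>t = (X\<^sub>t, Z\<^sub>t)'\<close>, where f runs through 1 and the \<open>\<phi>\<^sub>j\<close>, each restricted to one side of the break.
  These f have bounded variation, so summation by parts turns the uniform law of large numbers
  into convergence of the moments to \<open>(\<integral>f) Q\<close>, and the functional limit theorem into joint
  convergence of the scores: a weighted score differs from a Riemann sum of the partial sum path
  over a fixed grid by at most the variation of f times the modulus of continuity of the path,
  which is small because the limit path is continuous. At the limit moments all terms involving
  Z cancel, leaving the transformed functions \<open>\<phi>~\<^sub>j\<close>.

  For the F and t statistics put \<open>B = \<R> Q\<^sub>X\<^sub>X\<^sup>-\<^sup>1 \<Lambda>\<^sub>X\<close> and write \<open>B B' = D D'\<close> with D square and invertible.
  Finite-dimensional functionals of \<open>B W\<close> and of \<open>D W\<^sub>p\<close> have the same Gaussian characteristic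
  functions, hence the same law, and D cancels in the studentised limit.
\<close>

section \<open>Convergence in distribution\<close>

text \<open>Test functionals in \<open>fconv_distr\<close> act on arbitrary functions on [0,1] and
  must be bounded and measurable for the coordinate projections; the integral of a weight against
  such a function need not exist. Hence only two kinds of functionals are fed to the functional
  limit theorem: bounded continuous functions of Riemann sums over a fixed grid, and the truncated
  oscillation. The grid is refined afterwards, and the expected oscillation plays the part of
  tightness.

  The second obstacle is that \<open>wiener_int\<close> determines the stochastic integral only as a
  limit in probability. The pathwise limit of the Riemann sums is therefore never compared with
  \<open>IW\<close> pointwise: both are weak limits of the same sequence of Riemann sums, so they
  give the same means to bounded continuous functions. For the same reason the passage from
  \<open>W\<close> to \<open>Wp\<close>, which may live on different probability spaces, is made for
  the Riemann sums.

  Inverses are handled by restricting to the open set of moments whose relevant matrices are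
  invertible; the sample lies there with probability tending to one.\<close>

lemma prob_integrable_bounded:
  fixes f :: "'a \<Rightarrow> real"
  assumes "prob_space M" "f \<in> borel_measurable M" "\<And>x. \<bar>f x\<bar> \<le> C"
  shows "integrable M f"
proof -
  interpret prob_space M by fact
  show ?thesis by (rule integrable_const_bound[of _ C]) (use assms in auto)
qed

lemma abs_integral_le_integral:
  fixes f g :: "'a \<Rightarrow> real"
  assumes "integrable M f" "integrable M g" "\<And>x. x \<in> space M \<Longrightarrow> \<bar>f x\<bar> \<le> g x"
  shows "\<bar>\<integral>x. f x \<partial>M\<bar> \<le> (\<integral>x. g x \<partial>M)"
proof -
  have "\<bar>\<integral>x. f x \<partial>M\<bar> \<le> (\<integral>x. \<bar>f x\<bar> \<partial>M)" using integral_norm_bound[of M f] by simp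
  also have "\<dots> \<le> (\<integral>x. g x \<partial>M)" by (rule integral_mono) (use assms in auto)
  finally show ?thesis .
qed

lemma continuous_borel_measurable_comp:
  fixes g :: "'e::euclidean_space \<Rightarrow> 'f::euclidean_space"
  assumes "continuous_on UNIV g" "X \<in> borel_measurable M"
  shows "(\<lambda>\<omega>. g (X \<omega>)) \<in> borel_measurable M"
  using measurable_compose[OF assms(2) borel_measurable_continuous_onI[OF assms(1)]] .

text \<open>The loss from inserting the cutoff \<eta> k is at most C times one minus its mean. By
  \<open>lim1\<close> this quantity carries over to the limit law, where it vanishes as k grows. No
  separate tightness condition enters: the cutoffs themselves show that little mass escapes.\<close>

lemma tendsto_integral_localize:
  fixes h :: "'e::euclidean_space \<Rightarrow> real"
  assumes P: "prob_space P" and M: "prob_space M"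
    and Xs: "\<And>T. Xs T \<in> borel_measurable P" and X: "X \<in> borel_measurable M"
    and h: "h \<in> borel_measurable borel" "\<And>x. \<bar>h x\<bar> \<le> C"
    and \<eta>: "\<And>k::nat. \<eta> k \<in> borel_measurable borel" "\<And>k x. 0 \<le> \<eta> k x" "\<And>k x. \<eta> k x \<le> 1"
    and lim1: "\<And>k. (\<lambda>T. \<integral>\<omega>. \<eta> k (Xs T \<omega>) \<partial>P) \<longlonglongrightarrow> (\<integral>\<omega>. \<eta> k (X \<omega>) \<partial>M)"
    and limh: "\<And>k. (\<lambda>T. \<integral>\<omega>. \<eta> k (Xs T \<omega>) * h (Xs T \<omega>) \<partial>P) \<longlonglongrightarrow> (\<integral>\<omega>. \<eta> k (X \<omega>) * h (X \<omega>) \<partial>M)"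
    and ae: "AE \<omega> in M. (\<lambda>k. \<eta> k (X \<omega>)) \<longlonglongrightarrow> 1"
  shows "(\<lambda>T. \<integral>\<omega>. h (Xs T \<omega>) \<partial>P) \<longlonglongrightarrow> (\<integral>\<omega>. h (X \<omega>) \<partial>M)"
proof -
  note [measurable] = Xs X h(1) \<eta>(1)
  interpret P: prob_space P by fact
  interpret M: prob_space M by fact
  have C0: "0 \<le> C" using h(2)[of undefined] by linarith
  have absle: "\<bar>\<eta> k x * h x\<bar> \<le> C" for k x
    using mult_mono[of "\<bar>\<eta> k x\<bar>" 1 "\<bar>h x\<bar>" C] \<eta>(2,3)[of k x] h(2)[of x] by (auto simp: abs_mult)
  have i1: "integrable P (\<lambda>\<omega>. h (Xs T \<omega>))" "integrable P (\<lambda>\<omega>. \<eta> k (Xs T \<omega>))"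
      "integrable P (\<lambda>\<omega>. \<eta> k (Xs T \<omega>) * h (Xs T \<omega>))" for T k
    using h(2) \<eta>(2,3) absle
    by (auto intro: prob_integrable_bounded[OF P, where C=C] prob_integrable_bounded[OF P, where C=1 and f="\<lambda>\<omega>. \<eta> k (Xs T \<omega>)"])
  have l1: "(\<lambda>k. \<integral>\<omega>. \<eta> k (X \<omega>) \<partial>M) \<longlonglongrightarrow> (\<integral>\<omega>. 1 \<partial>M)"
    by (rule integral_dominated_convergence[where w="\<lambda>_. 1"]) (use ae \<eta>(2,3) in auto)
  have l2: "(\<lambda>k. \<integral>\<omega>. \<eta> k (X \<omega>) * h (X \<omega>) \<partial>M) \<longlonglongrightarrow> (\<integral>\<omega>. h (X \<omega>) \<partial>M)"
  proof (rule integral_dominated_convergence[where w="\<lambda>_. C"])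
    show "AE \<omega> in M. (\<lambda>k. \<eta> k (X \<omega>) * h (X \<omega>)) \<longlonglongrightarrow> h (X \<omega>)"
      using ae by eventually_elim (auto intro!: tendsto_eq_intros)
  qed (use absle in auto)
  have key: "\<bar>(\<integral>\<omega>. h (Xs T \<omega>) \<partial>P) - (\<integral>\<omega>. \<eta> k (Xs T \<omega>) * h (Xs T \<omega>) \<partial>P)\<bar>
      \<le> C * (1 - (\<integral>\<omega>. \<eta> k (Xs T \<omega>) \<partial>P))" for T k
  proof -
    have "(\<integral>\<omega>. h (Xs T \<omega>) \<partial>P) - (\<integral>\<omega>. \<eta> k (Xs T \<omega>) * h (Xs T \<omega>) \<partial>P)
       = (\<integral>\<omega>. (1 - \<eta> k (Xs T \<omega>)) * h (Xs T \<omega>) \<partial>P)"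
      using i1 by (simp add: algebra_simps)
    also have "\<bar>\<dots>\<bar> \<le> (\<integral>\<omega>. C * (1 - \<eta> k (Xs T \<omega>)) \<partial>P)"
    proof -
      have "\<bar>(1 - \<eta> k x) * h x\<bar> \<le> C * (1 - \<eta> k x)" for x
        using mult_left_mono[OF h(2)[of x], of "1 - \<eta> k x"] \<eta>(3)[of k x] by (auto simp: abs_mult mult.commute)
      moreover have "integrable P (\<lambda>\<omega>. (1 - \<eta> k (Xs T \<omega>)) * h (Xs T \<omega>))"
        using i1(1)[of T] i1(3)[of k T] by (simp add: algebra_simps)
      ultimately show ?thesis
        using i1(2) by (intro abs_integral_le_integral) auto
    qed
    also have "\<dots> = C * (1 - (\<integral>\<omega>. \<eta> k (Xs T \<omega>) \<partial>P))" using i1(2)[of k T] by (simp add: P.prob_space)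
    finally show ?thesis .
  qed
  show ?thesis
  proof (rule LIMSEQ_I)
    fix e :: real assume e: "0 < e"
    define e' where "e' = e / (4 * (C + 1))"
    have e': "e' > 0" "C * e' \<le> e/4" "e' \<le> e/4"
      using e C0 by (auto simp: e'_def field_simps)
    have "eventually (\<lambda>k. \<bar>(\<integral>\<omega>. \<eta> k (X \<omega>) \<partial>M) - 1\<bar> < e'/2 \<and>
       \<bar>(\<integral>\<omega>. \<eta> k (X \<omega>) * h (X \<omega>) \<partial>M) - (\<integral>\<omega>. h (X \<omega>) \<partial>M)\<bar> < e/4) sequentially"
      using tendstoD[OF l1, of "e'/2"] tendstoD[OF l2, of "e/4"] e e'
      by (auto simp: dist_real_def M.prob_space eventually_conj_iff)
    then obtain k where k: "\<bar>(\<integral>\<omega>. \<eta> k (X \<omega>) \<partial>M) - 1\<bar> < e'/2"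
       "\<bar>(\<integral>\<omega>. \<eta> k (X \<omega>) * h (X \<omega>) \<partial>M) - (\<integral>\<omega>. h (X \<omega>) \<partial>M)\<bar> < e/4"
      by (auto simp: eventually_sequentially)
    have "eventually (\<lambda>T. \<bar>(\<integral>\<omega>. \<eta> k (Xs T \<omega>) \<partial>P) - (\<integral>\<omega>. \<eta> k (X \<omega>) \<partial>M)\<bar> < e'/2 \<and>
       \<bar>(\<integral>\<omega>. \<eta> k (Xs T \<omega>) * h (Xs T \<omega>) \<partial>P) - (\<integral>\<omega>. \<eta> k (X \<omega>) * h (X \<omega>) \<partial>M)\<bar> < e/4) sequentially"
      using tendstoD[OF lim1[of k], of "e'/2"] tendstoD[OF limh[of k], of "e/4"] e e'
      by (auto simp: dist_real_def eventually_conj_iff)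
    then obtain N where N: "\<And>T. T \<ge> N \<Longrightarrow> \<bar>(\<integral>\<omega>. \<eta> k (Xs T \<omega>) \<partial>P) - (\<integral>\<omega>. \<eta> k (X \<omega>) \<partial>M)\<bar> < e'/2 \<and>
       \<bar>(\<integral>\<omega>. \<eta> k (Xs T \<omega>) * h (Xs T \<omega>) \<partial>P) - (\<integral>\<omega>. \<eta> k (X \<omega>) * h (X \<omega>) \<partial>M)\<bar> < e/4"
      by (auto simp: eventually_sequentially)
    show "\<exists>N. \<forall>T\<ge>N. norm ((\<integral>\<omega>. h (Xs T \<omega>) \<partial>P) - (\<integral>\<omega>. h (X \<omega>) \<partial>M)) < e"
    proof (intro exI allI impI)
      fix T assume T: "N \<le> T"
      have "1 - (\<integral>\<omega>. \<eta> k (Xs T \<omega>) \<partial>P) \<le> e'" using N[OF T] k by linarith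
      then have "C * (1 - (\<integral>\<omega>. \<eta> k (Xs T \<omega>) \<partial>P)) \<le> e/4"
        using mult_left_mono[OF _ C0] e'(2) by (meson order_trans)
      then show "norm ((\<integral>\<omega>. h (Xs T \<omega>) \<partial>P) - (\<integral>\<omega>. h (X \<omega>) \<partial>M)) < e"
        using key[of T k] N[OF T] k unfolding real_norm_def by linarith
    qed
  qed
qed

lemma conv_distrD:
  assumes "conv_distr P Xs M X" "continuous_on UNIV (g :: 'e::euclidean_space \<Rightarrow> real)" "\<And>x. \<bar>g x\<bar> \<le> C"
  shows "(\<lambda>T. \<integral>\<omega>. g (Xs T \<omega>) \<partial>P) \<longlonglongrightarrow> (\<integral>\<omega>. g (X \<omega>) \<partial>M)"
proof -
  have "bounded (range g)" using assms(3) by (auto simp: bounded_iff)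
  then show ?thesis using assms(1,2) unfolding conv_distr_def by blast
qed

text \<open>Cutoffs supported in U make the test function continuous on the whole space although h
  is arbitrary outside U; they increase to 1 on U, where the limit lives almost surely.\<close>

lemma conv_distr_continuous_on_open:
  fixes h :: "'e::euclidean_space \<Rightarrow> 'f::euclidean_space"
  assumes P: "prob_space P" and M: "prob_space M"
    and Xs: "\<And>T. Xs T \<in> borel_measurable P" and X: "X \<in> borel_measurable M"
    and conv: "conv_distr P Xs M X"
    and U: "open U" "AE \<omega> in M. X \<omega> \<in> U"
    and h: "continuous_on U h" "h \<in> borel_measurable borel"
  shows "conv_distr P (\<lambda>T \<omega>. h (Xs T \<omega>)) M (\<lambda>\<omega>. h (X \<omega>))"
  unfolding conv_distr_def
proof safe
  fix g :: "'f \<Rightarrow> real" assume g: "continuous_on UNIV g" and bg: "bounded (range g)"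
  obtain C where C: "\<And>x. \<bar>g x\<bar> \<le> C" using bg by (auto simp: bounded_iff)
  have C0: "0 \<le> C" using C[of undefined] by linarith
  \<comment> \<open>\<open>infdist\<close> to the empty set is 0, which would kill the cutoff when U
    is the whole space; hence the case distinction.\<close>
  define \<eta> :: "nat \<Rightarrow> 'e \<Rightarrow> real" where
    "\<eta> k x = (if U = UNIV then 1 else min 1 (real k * infdist x (-U)))" for k x
  have cont: "continuous_on UNIV (\<eta> k)" for k
    unfolding \<eta>_def by (cases "U = UNIV") (auto intro!: continuous_intros)
  have \<eta>01: "0 \<le> \<eta> k x" "\<eta> k x \<le> 1" for k x by (auto simp: \<eta>_def infdist_nonneg)
  have \<eta>0: "\<eta> k x = 0" if "x \<notin> U" for k x using that by (auto simp: \<eta>_def)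
  have abound: "\<bar>\<eta> k x * g (h x)\<bar> \<le> C" for k x
    using mult_mono[of "\<bar>\<eta> k x\<bar>" 1 "\<bar>g (h x)\<bar>" C] \<eta>01[of k x] C[of "h x"] by (auto simp: abs_mult)
  have contp: "continuous_on UNIV (\<lambda>x. \<eta> k x * g (h x))" for k
    unfolding continuous_on_eq_continuous_at[OF open_UNIV]
  proof safe
    fix x
    show "isCont (\<lambda>x. \<eta> k x * g (h x)) x"
    proof (cases "x \<in> U")
      case True
      have "continuous_on U (\<lambda>x. \<eta> k x * g (h x))"
        by (intro continuous_intros continuous_on_subset[OF cont] continuous_on_compose2[OF g h(1)]) auto
      then show ?thesis using True U(1) by (simp add: continuous_on_eq_continuous_at)
    next
      case False
      \<comment> \<open>Outside U nothing is known about h, but g is bounded by C, so the product is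
        squeezed by the cutoff, which tends to 0 here.\<close>
      have "((\<lambda>y. \<eta> k y * g (h y)) \<longlongrightarrow> 0) (at x)"
      proof (rule Lim_null_comparison)
        show "\<forall>\<^sub>F y in at x. norm (\<eta> k y * g (h y)) \<le> \<eta> k y * C"
          using \<eta>01 C by (auto simp: abs_mult intro!: always_eventually mult_left_mono)
        have "isCont (\<eta> k) x" using cont by (simp add: continuous_on_eq_continuous_at)
        then have "(\<eta> k \<longlongrightarrow> 0) (at x)" using \<eta>0[OF False] by (simp add: isCont_def)
        then show "((\<lambda>y. \<eta> k y * C) \<longlongrightarrow> 0) (at x)" by (rule tendsto_mult_left_zero)
      qed
      then show ?thesis using \<eta>0[OF False] by (simp add: isCont_def)
    qed
  qed
  have gm: "g \<in> borel_measurable borel" using g by (rule borel_measurable_continuous_onI)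
  show "(\<lambda>T. \<integral>\<omega>. g (h (Xs T \<omega>)) \<partial>P) \<longlonglongrightarrow> (\<integral>\<omega>. g (h (X \<omega>)) \<partial>M)"
  proof (rule tendsto_integral_localize[OF P M Xs X, where h="\<lambda>x. g (h x)" and \<eta>=\<eta> and C=C])
    show "(\<lambda>x. g (h x)) \<in> borel_measurable borel" using h(2) gm by measurable
    show "\<eta> k \<in> borel_measurable borel" for k using cont by (rule borel_measurable_continuous_onI)
    show "(\<lambda>T. \<integral>\<omega>. \<eta> k (Xs T \<omega>) \<partial>P) \<longlonglongrightarrow> (\<integral>\<omega>. \<eta> k (X \<omega>) \<partial>M)" for k
      by (rule conv_distrD[OF conv cont, where C=1]) (use \<eta>01 in auto)
    show "(\<lambda>T. \<integral>\<omega>. \<eta> k (Xs T \<omega>) * g (h (Xs T \<omega>)) \<partial>P) \<longlonglongrightarrow> (\<integral>\<omega>. \<eta> k (X \<omega>) * g (h (X \<omega>)) \<partial>M)" for k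
      by (rule conv_distrD[OF conv contp abound])
    show "AE \<omega> in M. (\<lambda>k. \<eta> k (X \<omega>)) \<longlonglongrightarrow> 1"
      using U(2)
    proof eventually_elim
      case (elim \<omega>)
      show ?case
      proof (cases "U = UNIV")
        case True then show ?thesis by (simp add: \<eta>_def)
      next
        case False
        then have "infdist (X \<omega>) (-U) > 0"
          using elim U(1) in_closed_iff_infdist_zero[of "-U" "X \<omega>"] infdist_nonneg[of "X \<omega>" "-U"] by (auto simp: closed_def less_le)
        then obtain n :: nat where n: "1 < real n * infdist (X \<omega>) (-U)" using reals_Archimedean3 by blast
        have "\<eta> k (X \<omega>) = 1" if "k \<ge> n" for k
        proof -
          have "real n * infdist (X \<omega>) (-U) \<le> real k * infdist (X \<omega>) (-U)"
            using that by (intro mult_right_mono) (auto simp: infdist_nonneg)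
          then show ?thesis using n False by (auto simp: \<eta>_def)
        qed
        then show ?thesis by (intro tendsto_eventually) (auto simp: eventually_sequentially)
      qed
    qed
  qed (use C \<eta>01 in auto)
qed

lemma conv_distr_continuous:
  fixes h :: "'e::euclidean_space \<Rightarrow> 'f::euclidean_space"
  assumes "conv_distr P Xs M X" "continuous_on UNIV h"
  shows "conv_distr P (\<lambda>T \<omega>. h (Xs T \<omega>)) M (\<lambda>\<omega>. h (X \<omega>))"
  unfolding conv_distr_def
proof safe
  fix g :: "'f \<Rightarrow> real" assume g: "continuous_on UNIV g" and bg: "bounded (range g)"
  have "continuous_on UNIV (\<lambda>x. g (h x))" using continuous_on_compose2[OF g assms(2)] by auto
  moreover have "bounded (range (\<lambda>x. g (h x)))" using bg by (rule bounded_subset) auto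
  ultimately show "(\<lambda>T. \<integral>\<omega>. g (h (Xs T \<omega>)) \<partial>P) \<longlonglongrightarrow> (\<integral>\<omega>. g (h (X \<omega>)) \<partial>M)"
    using assms(1) unfolding conv_distr_def by blast
qed

lemma uniformly_continuous_compact_support:
  fixes f :: "'e::euclidean_space \<Rightarrow> real"
  assumes f: "continuous_on UNIV f" and supp: "\<And>x. norm x \<ge> B \<Longrightarrow> f x = 0"
  shows "uniformly_continuous_on UNIV f"
proof -
  \<comment> \<open>The radius is enlarged by 1 so that of two points at distance below 1, if one
    leaves the ball, both lie where f vanishes.\<close>
  have u: "uniformly_continuous_on (cball 0 (B + 1)) f"
    by (rule compact_uniformly_continuous) (auto intro: continuous_on_subset[OF f])
  show ?thesis
    unfolding uniformly_continuous_on_def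
  proof safe
    fix e :: real assume "e > 0"
    with u obtain d where d: "d > 0" "\<And>x y. x \<in> cball 0 (B+1) \<Longrightarrow> y \<in> cball 0 (B+1) \<Longrightarrow> dist y x < d \<Longrightarrow> dist (f y) (f x) < e"
      unfolding uniformly_continuous_on_def by metis
    have "dist (f y) (f x) < e" if "dist y x < min d 1" for x y
    proof (cases "norm x \<le> B + 1 \<and> norm y \<le> B + 1")
      case True then show ?thesis using d(2)[of x y] that by auto
    next
      case False
      have "\<bar>norm x - norm y\<bar> < 1" using that norm_triangle_ineq3[of y x] by (auto simp: dist_norm)
      then have "norm x \<ge> B" "norm y \<ge> B" using False by linarith+
      then show ?thesis using supp \<open>e > 0\<close> by simp
    qed
    then show "\<exists>d>0. \<forall>x\<in>UNIV. \<forall>x'\<in>UNIV. dist x' x < d \<longrightarrow> dist (f x') (f x) < e"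
      using d(1) by (intro exI[of _ "min d 1"]) auto
  qed
qed

text \<open>Test functions are cut off at radius k + 1; the products have compact support and are
  therefore uniformly continuous.\<close>

lemma conv_distr_uniformly_continuousI:
  fixes X :: "'b \<Rightarrow> 'e::euclidean_space"
  assumes P: "prob_space P" and M: "prob_space M"
    and Xs: "\<And>T. Xs T \<in> borel_measurable P" and X: "X \<in> borel_measurable M"
    and uc: "\<And>(g :: 'e \<Rightarrow> real) C. uniformly_continuous_on UNIV g \<Longrightarrow> (\<And>x. \<bar>g x\<bar> \<le> C) \<Longrightarrow>
       (\<lambda>T. \<integral>\<omega>. g (Xs T \<omega>) \<partial>P) \<longlonglongrightarrow> (\<integral>\<omega>. g (X \<omega>) \<partial>M)"
  shows "conv_distr P Xs M X"
  unfolding conv_distr_def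
proof safe
  fix g :: "'e \<Rightarrow> real" assume g: "continuous_on UNIV g" and bg: "bounded (range g)"
  obtain C where C: "\<And>x. \<bar>g x\<bar> \<le> C" using bg by (auto simp: bounded_iff)
  define \<eta> :: "nat \<Rightarrow> 'e \<Rightarrow> real" where "\<eta> k x = max 0 (min 1 (real k + 1 - norm x))" for k x
  have cont: "continuous_on UNIV (\<eta> k)" for k unfolding \<eta>_def by (intro continuous_intros)
  have \<eta>01: "0 \<le> \<eta> k x" "\<eta> k x \<le> 1" for k x by (auto simp: \<eta>_def)
  have abound: "\<bar>\<eta> k x * g x\<bar> \<le> C" for k x
    using mult_mono[of "\<bar>\<eta> k x\<bar>" 1 "\<bar>g x\<bar>" C] \<eta>01[of k x] C[of x] by (auto simp: abs_mult)
  show "(\<lambda>T. \<integral>\<omega>. g (Xs T \<omega>) \<partial>P) \<longlonglongrightarrow> (\<integral>\<omega>. g (X \<omega>) \<partial>M)"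
  proof (rule tendsto_integral_localize[OF P M Xs X, where h=g and \<eta>=\<eta> and C=C])
    show "g \<in> borel_measurable borel" using g by (rule borel_measurable_continuous_onI)
    show "\<eta> k \<in> borel_measurable borel" for k using cont by (rule borel_measurable_continuous_onI)
    show "(\<lambda>T. \<integral>\<omega>. \<eta> k (Xs T \<omega>) \<partial>P) \<longlonglongrightarrow> (\<integral>\<omega>. \<eta> k (X \<omega>) \<partial>M)" for k
      by (rule uc[where C=1], rule uniformly_continuous_compact_support[OF cont, of "real k + 1"])
        (use \<eta>01 in \<open>auto simp: \<eta>_def\<close>)
    show "(\<lambda>T. \<integral>\<omega>. \<eta> k (Xs T \<omega>) * g (Xs T \<omega>) \<partial>P) \<longlonglongrightarrow> (\<integral>\<omega>. \<eta> k (X \<omega>) * g (X \<omega>) \<partial>M)" for k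
      by (rule uc[OF _ abound], rule uniformly_continuous_compact_support[of _ "real k + 1"])
        (auto simp: \<eta>_def intro!: continuous_intros g)
    have "(\<lambda>k. \<eta> k x) \<longlonglongrightarrow> 1" for x
    proof -
      obtain n :: nat where "norm x < real n" using reals_Archimedean2 by blast
      then have "\<eta> k x = 1" if "k \<ge> n" for k using that by (auto simp: \<eta>_def)
      then show ?thesis by (intro tendsto_eventually) (auto simp: eventually_sequentially)
    qed
    then show "AE \<omega> in M. (\<lambda>k. \<eta> k (X \<omega>)) \<longlonglongrightarrow> 1" by simp
  qed (use C \<eta>01 in auto)
qed

text \<open>Uniform continuity in a form that can be integrated: close pairs cost e, and pairs at
  distance at least d are paid for by the factor 2C / min 1 d in front of the truncated
  distance.\<close>

lemma uniformly_continuous_dist_bound: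
  fixes g :: "'e::metric_space \<Rightarrow> real"
  assumes "uniformly_continuous_on UNIV g" "\<And>x. \<bar>g x\<bar> \<le> C" "e > 0"
  obtains K where "K \<ge> 0" "\<And>x y. \<bar>g x - g y\<bar> \<le> e + K * min 1 (dist x y)"
proof -
  obtain d where d: "d > 0" "\<And>x y. dist x y < d \<Longrightarrow> dist (g x) (g y) < e"
    using assms(1,3) unfolding uniformly_continuous_on_def by (metis UNIV_I)
  have C0: "C \<ge> 0" using assms(2)[of undefined] by linarith
  define K where "K = 2 * C / min 1 d"
  have "\<bar>g x - g y\<bar> \<le> e + K * min 1 (dist x y)" for x y
  proof (cases "dist x y < d")
    case True
    then show ?thesis using d C0 by (auto simp: K_def dist_real_def intro!: less_imp_le[OF less_le_trans[OF d(2)[OF True, unfolded dist_real_def]]])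
  next
    case False
    then have "min 1 d \<le> min 1 (dist x y)" by auto
    then have "K * min 1 d \<le> K * min 1 (dist x y)"
      using C0 d(1) by (intro mult_left_mono) (auto simp: K_def)
    moreover have "K * min 1 d = 2 * C" using d(1) by (auto simp: K_def)
    ultimately show ?thesis using assms(2)[of x] assms(2)[of y] assms(3) by linarith
  qed
  moreover have "K \<ge> 0" using C0 d(1) by (auto simp: K_def)
  ultimately show ?thesis using that by blast
qed

text \<open>The approximation scheme of Billingsley's Theorem 3.2, with the distance in probability
  measured by the expectation of the truncated distance.\<close>
lemma conv_distr_approx:
  fixes X :: "'b \<Rightarrow> 'e::euclidean_space"
  assumes P: "prob_space P" and M: "prob_space M"
    and Xs: "\<And>T. Xs T \<in> borel_measurable P" and X: "X \<in> borel_measurable M"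
    and Xn: "\<And>n T. Xn n T \<in> borel_measurable P"
    and conv: "\<And>n. n > 0 \<Longrightarrow> conv_distr P (Xn n) M (Y n)"
    and convY: "conv_distr M Y M X"
    and close: "\<And>e. e > 0 \<Longrightarrow> \<forall>\<^sub>F n in sequentially. \<forall>\<^sub>F T in sequentially.
       (\<integral>\<omega>. min 1 (dist (Xn n T \<omega>) (Xs T \<omega>)) \<partial>P) \<le> e"
  shows "conv_distr P Xs M X"
proof (rule conv_distr_uniformly_continuousI[OF P M Xs X])
  note [measurable] = Xs X Xn
  interpret P: prob_space P by fact
  fix g :: "'e \<Rightarrow> real" and C assume g: "uniformly_continuous_on UNIV g" and C: "\<And>x. \<bar>g x\<bar> \<le> C"
  have gc: "continuous_on UNIV g" using g by (rule uniformly_continuous_imp_continuous)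
  have gm[measurable]: "g \<in> borel_measurable borel" using gc by (rule borel_measurable_continuous_onI)
  show "(\<lambda>T. \<integral>\<omega>. g (Xs T \<omega>) \<partial>P) \<longlonglongrightarrow> (\<integral>\<omega>. g (X \<omega>) \<partial>M)"
  proof (rule LIMSEQ_I)
    fix e :: real assume e: "0 < e"
    obtain K where K: "K \<ge> 0" "\<And>x y. \<bar>g x - g y\<bar> \<le> e/8 + K * min 1 (dist x y)"
      using uniformly_continuous_dist_bound[OF g C, of "e/8"] e by auto
    \<comment> \<open>The denominator makes the distance term of the bound at most e/8; K + 1 in
      place of K admits K = 0.\<close>
    have pos: "e / (8 * (K + 1)) > 0" using e K(1) by simp
    obtain n where n: "n > 0" "\<bar>(\<integral>\<omega>. g (Y n \<omega>) \<partial>M) - (\<integral>\<omega>. g (X \<omega>) \<partial>M)\<bar> < e/4"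
        "\<forall>\<^sub>F T in sequentially. (\<integral>\<omega>. min 1 (dist (Xn n T \<omega>) (Xs T \<omega>)) \<partial>P) \<le> e / (8 * (K + 1))"
    proof -
      have "\<forall>\<^sub>F n in sequentially. n > 0 \<and> dist (\<integral>\<omega>. g (Y n \<omega>) \<partial>M) (\<integral>\<omega>. g (X \<omega>) \<partial>M) < e/4
          \<and> (\<forall>\<^sub>F T in sequentially. (\<integral>\<omega>. min 1 (dist (Xn n T \<omega>) (Xs T \<omega>)) \<partial>P) \<le> e / (8 * (K + 1)))"
        using tendstoD[OF conv_distrD[OF convY gc C], of "e/4"] close[OF pos] e
        by (auto simp: eventually_conj_iff eventually_gt_at_top)
      then obtain n where "n > 0 \<and> dist (\<integral>\<omega>. g (Y n \<omega>) \<partial>M) (\<integral>\<omega>. g (X \<omega>) \<partial>M) < e/4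
          \<and> (\<forall>\<^sub>F T in sequentially. (\<integral>\<omega>. min 1 (dist (Xn n T \<omega>) (Xs T \<omega>)) \<partial>P) \<le> e / (8 * (K + 1)))"
        using eventually_happens'[OF sequentially_bot] by blast
      then show ?thesis using that[of n] unfolding dist_real_def by blast
    qed
    have "\<forall>\<^sub>F T in sequentially. dist (\<integral>\<omega>. g (Xn n T \<omega>) \<partial>P) (\<integral>\<omega>. g (Y n \<omega>) \<partial>M) < e/4"
      using tendstoD[OF conv_distrD[OF conv[OF n(1)] gc C], of "e/4"] e by auto
    with n(3) have "\<forall>\<^sub>F T in sequentially. norm ((\<integral>\<omega>. g (Xs T \<omega>) \<partial>P) - (\<integral>\<omega>. g (X \<omega>) \<partial>M)) < e"
    proof eventually_elim
      case (elim T)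
      have ig: "integrable P (\<lambda>\<omega>. g (Xs T \<omega>))" "integrable P (\<lambda>\<omega>. g (Xn n T \<omega>))"
        by (auto intro!: prob_integrable_bounded[OF P] C)
      have im: "integrable P (\<lambda>\<omega>. min 1 (dist (Xn n T \<omega>) (Xs T \<omega>)))"
        by (rule prob_integrable_bounded[OF P, where C=1]) auto
      have "\<bar>(\<integral>\<omega>. g (Xn n T \<omega>) \<partial>P) - (\<integral>\<omega>. g (Xs T \<omega>) \<partial>P)\<bar> = \<bar>\<integral>\<omega>. g (Xn n T \<omega>) - g (Xs T \<omega>) \<partial>P\<bar>"
        using ig by simp
      also have "\<dots> \<le> (\<integral>\<omega>. e/8 + K * min 1 (dist (Xn n T \<omega>) (Xs T \<omega>)) \<partial>P)"
        by (rule abs_integral_le_integral) (use ig im K(2) in auto)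
      also have "\<dots> = e/8 + K * (\<integral>\<omega>. min 1 (dist (Xn n T \<omega>) (Xs T \<omega>)) \<partial>P)"
        using im by (simp add: P.prob_space)
      also have "\<dots> \<le> e/8 + K * (e / (8 * (K + 1)))"
        using elim K(1) by (intro add_left_mono mult_left_mono) auto
      also have "\<dots> \<le> e/4" using e K(1) by (simp add: field_simps)
      finally show ?case using n(2) elim(2) e unfolding dist_real_def real_norm_def by linarith
    qed
    then show "\<exists>N. \<forall>T\<ge>N. norm ((\<integral>\<omega>. g (Xs T \<omega>) \<partial>P) - (\<integral>\<omega>. g (X \<omega>) \<partial>M)) < e"
      by (simp add: eventually_sequentially)
  qed
qed

text \<open>The approximation scheme with X itself as every approximant.\<close>

lemma conv_distr_in_prob:
  fixes X :: "'b \<Rightarrow> 'e::euclidean_space"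
  assumes M: "prob_space M"
    and Xs: "\<And>T. Xs T \<in> borel_measurable M" and X: "X \<in> borel_measurable M"
    and close: "(\<lambda>T. \<integral>\<omega>. min 1 (dist (X \<omega>) (Xs T \<omega>)) \<partial>M) \<longlonglongrightarrow> 0"
  shows "conv_distr M Xs M X"
proof (rule conv_distr_approx[OF M M Xs X, where Xn="\<lambda>_ _. X" and Y="\<lambda>_. X"])
  fix e :: real assume "e > 0"
  then show "\<forall>\<^sub>F n in sequentially. \<forall>\<^sub>F T in sequentially. (\<integral>\<omega>. min 1 (dist (X \<omega>) (Xs T \<omega>)) \<partial>M) \<le> e"
    using order_tendstoD(2)[OF close, of e] by (auto elim: eventually_mono)
qed (use X in \<open>auto simp: conv_distr_def\<close>)

lemma conv_distr_AE:
  fixes X :: "'b \<Rightarrow> 'e::euclidean_space"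
  assumes M: "prob_space M"
    and Xs: "\<And>T. Xs T \<in> borel_measurable M" and X: "X \<in> borel_measurable M"
    and ae: "AE \<omega> in M. (\<lambda>T. Xs T \<omega>) \<longlonglongrightarrow> X \<omega>"
  shows "conv_distr M Xs M X"
  unfolding conv_distr_def
proof safe
  note [measurable] = Xs X
  fix g :: "'e \<Rightarrow> real" assume g: "continuous_on UNIV g" and bg: "bounded (range g)"
  obtain C where C: "\<And>x. \<bar>g x\<bar> \<le> C" using bg by (auto simp: bounded_iff)
  interpret prob_space M by fact
  have gm[measurable]: "g \<in> borel_measurable borel" using g by (rule borel_measurable_continuous_onI)
  show "(\<lambda>T. \<integral>\<omega>. g (Xs T \<omega>) \<partial>M) \<longlonglongrightarrow> (\<integral>\<omega>. g (X \<omega>) \<partial>M)"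
  proof (rule integral_dominated_convergence[where w="\<lambda>_. C"])
    show "AE \<omega> in M. (\<lambda>T. g (Xs T \<omega>)) \<longlonglongrightarrow> g (X \<omega>)"
      using ae by eventually_elim (rule continuous_on_tendsto_compose[OF g], auto)
  qed (use C in auto)
qed

text \<open>A statistic built with matrix inverses is known to coincide with a given function of the
  moments only where the inverses exist; this replaces one by the other. The means of a test
  function differ by at most 2C times the probability of the complement.\<close>

lemma conv_distr_eventually_equal:
  fixes X :: "'b \<Rightarrow> 'e::euclidean_space"
  assumes P: "prob_space P"
    and Xs: "\<And>T. Xs T \<in> borel_measurable P" and Ys: "\<And>T. Ys T \<in> borel_measurable P"
    and conv: "conv_distr P Ys M X"
    and E: "\<And>T. E T \<in> sets P" "(\<lambda>T. measure P (E T)) \<longlonglongrightarrow> 1"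
    and eq: "\<And>T \<omega>. T > 0 \<Longrightarrow> \<omega> \<in> E T \<Longrightarrow> Xs T \<omega> = Ys T \<omega>"
  shows "conv_distr P Xs M X"
  unfolding conv_distr_def
proof safe
  note [measurable] = Xs Ys E(1)
  interpret prob_space P by fact
  fix g :: "'e \<Rightarrow> real" assume g: "continuous_on UNIV g" and bg: "bounded (range g)"
  obtain C where C: "\<And>x. \<bar>g x\<bar> \<le> C" using bg by (auto simp: bounded_iff)
  have C0: "0 \<le> C" using C[of undefined] by linarith
  have gm[measurable]: "g \<in> borel_measurable borel" using g by (rule borel_measurable_continuous_onI)
  have "(\<lambda>T. (\<integral>\<omega>. g (Xs T \<omega>) \<partial>P) - (\<integral>\<omega>. g (Ys T \<omega>) \<partial>P)) \<longlonglongrightarrow> 0"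
  proof (rule Lim_null_comparison)
    show "\<forall>\<^sub>F T in sequentially. norm ((\<integral>\<omega>. g (Xs T \<omega>) \<partial>P) - (\<integral>\<omega>. g (Ys T \<omega>) \<partial>P)) \<le> 2 * C * (1 - measure P (E T))"
      using eventually_gt_at_top[of 0]
    proof eventually_elim
      case (elim T)
      have ig: "integrable P (\<lambda>\<omega>. g (Xs T \<omega>))" "integrable P (\<lambda>\<omega>. g (Ys T \<omega>))"
        by (auto intro!: prob_integrable_bounded[OF P] C)
      have "norm ((\<integral>\<omega>. g (Xs T \<omega>) \<partial>P) - (\<integral>\<omega>. g (Ys T \<omega>) \<partial>P)) = \<bar>\<integral>\<omega>. g (Xs T \<omega>) - g (Ys T \<omega>) \<partial>P\<bar>"
        using ig by simp
      also have "\<dots> \<le> (\<integral>\<omega>. 2 * C * indicator (space P - E T) \<omega> \<partial>P)"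
      proof (rule abs_integral_le_integral)
        fix \<omega> assume "\<omega> \<in> space P"
        then show "\<bar>g (Xs T \<omega>) - g (Ys T \<omega>)\<bar> \<le> 2 * C * indicator (space P - E T) \<omega>"
          using eq[OF elim, of \<omega>] C[of "Xs T \<omega>"] C[of "Ys T \<omega>"] by (auto split: split_indicator)
      qed (use ig in \<open>auto intro!: integrable_mult_right simp: emeasure_eq_measure\<close>)
      also have "\<dots> = 2 * C * (1 - measure P (E T))"
        using E(1)[of T] by (simp add: prob_compl)
      finally show ?case .
    qed
    show "(\<lambda>T. 2 * C * (1 - measure P (E T))) \<longlonglongrightarrow> 0"
      using E(2) by (auto intro!: tendsto_eq_intros)
  qed
  moreover have "(\<lambda>T. \<integral>\<omega>. g (Ys T \<omega>) \<partial>P) \<longlonglongrightarrow> (\<integral>\<omega>. g (X \<omega>) \<partial>M)"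
    by (rule conv_distrD[OF conv g C])
  ultimately show "(\<lambda>T. \<integral>\<omega>. g (Xs T \<omega>) \<partial>P) \<longlonglongrightarrow> (\<integral>\<omega>. g (X \<omega>) \<partial>M)"
    using tendsto_add by fastforce
qed

lemma conv_distr_transfer:
  assumes "conv_distr P Xs M X" "\<And>g. continuous_on UNIV g \<Longrightarrow> bounded (range g) \<Longrightarrow>
     (\<integral>\<omega>. g (X \<omega>) \<partial>M) = (\<integral>\<omega>. g (Y \<omega>) \<partial>N :: real)"
  shows "conv_distr P Xs N Y"
  using assms unfolding conv_distr_def by metis

lemma conv_distr_limit_unique:
  fixes g :: "'e::euclidean_space \<Rightarrow> real"
  assumes "conv_distr P Xs M X" "conv_distr P Xs N Y" "continuous_on UNIV g" "bounded (range g)"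
  shows "(\<integral>\<omega>. g (X \<omega>) \<partial>M) = (\<integral>\<omega>. g (Y \<omega>) \<partial>N)"
  using assms unfolding conv_distr_def by (blast intro: LIMSEQ_unique)

text \<open>The truncated variable is at most e/2 plus the indicator of exceeding e/2.\<close>

lemma tendsto_prob_imp_truncated_mean:
  fixes D :: "nat \<Rightarrow> 'a \<Rightarrow> real"
  assumes P: "prob_space P" and D: "\<And>T. D T \<in> borel_measurable P" "\<And>T \<omega>. D T \<omega> \<ge> 0"
    and lim: "\<And>e. e > 0 \<Longrightarrow> (\<lambda>T. measure P {\<omega>\<in>space P. D T \<omega> > e}) \<longlonglongrightarrow> 0"
  shows "(\<lambda>T. \<integral>\<omega>. min 1 (D T \<omega>) \<partial>P) \<longlonglongrightarrow> 0"
proof (rule LIMSEQ_I)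
  note [measurable] = D(1)
  interpret prob_space P by fact
  fix e :: real assume e: "e > 0"
  have "\<forall>\<^sub>F T in sequentially. measure P {\<omega>\<in>space P. D T \<omega> > e/2} < e/2"
    using order_tendstoD(2)[OF lim, of "e/2" "e/2"] e by auto
  then have "\<forall>\<^sub>F T in sequentially. norm ((\<integral>\<omega>. min 1 (D T \<omega>) \<partial>P) - 0) < e"
  proof eventually_elim
    case (elim T)
    let ?S = "{\<omega>\<in>space P. D T \<omega> > e/2}"
    have "(\<integral>\<omega>. min 1 (D T \<omega>) \<partial>P) \<le> (\<integral>\<omega>. e/2 + indicator ?S \<omega> \<partial>P)"
    proof (rule integral_mono)
      show "integrable P (\<lambda>\<omega>. min 1 (D T \<omega>))"
        by (rule prob_integrable_bounded[OF P, where C=1]) (use D(2)[of T] in \<open>auto simp: abs_le_iff intro: order_trans[of _ 0]\<close>)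
      fix \<omega> assume "\<omega> \<in> space P"
      then show "min 1 (D T \<omega>) \<le> e/2 + indicator ?S \<omega>" using e by (auto split: split_indicator)
    qed (auto simp: emeasure_eq_measure)
    also have "\<dots> = e/2 + measure P ?S" by (subst Bochner_Integration.integral_add) (auto simp: emeasure_eq_measure prob_space)
    also have "\<dots> < e" using elim by simp
    finally have "(\<integral>\<omega>. min 1 (D T \<omega>) \<partial>P) < e" .
    moreover have "0 \<le> (\<integral>\<omega>. min 1 (D T \<omega>) \<partial>P)" using D(2) by (intro Bochner_Integration.integral_nonneg) auto
    ultimately show ?case by simp
  qed
  then show "\<exists>N. \<forall>T\<ge>N. norm ((\<integral>\<omega>. min 1 (D T \<omega>) \<partial>P) - 0) < e" by (simp add: eventually_sequentially)
qed

section \<open>Functions of bounded variation\<close>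

lemma borel_measurable_vecI:
  fixes f :: "'a \<Rightarrow> 'b::euclidean_space^'n"
  assumes "\<And>i. (\<lambda>x. f x $ i) \<in> borel_measurable M"
  shows "f \<in> borel_measurable M"
  unfolding borel_measurable_euclidean_space[of f]
  using assms by (auto simp: Basis_vec_def inner_axis intro!: borel_measurable_inner)

lemma borel_measurable_vec_lambda [measurable (raw)]:
  fixes f :: "'a \<Rightarrow> 'n::finite \<Rightarrow> 'b::euclidean_space"
  assumes "\<And>i. (\<lambda>x. f x i) \<in> borel_measurable M"
  shows "(\<lambda>x. \<chi> i. f x i) \<in> borel_measurable M"
  using assms by (intro borel_measurable_vecI) simp

lemma borel_measurable_vec_component [measurable (raw)]:
  fixes f :: "'a \<Rightarrow> 'b::euclidean_space^'n"
  assumes "f \<in> borel_measurable M"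
  shows "(\<lambda>x. f x $ i) \<in> borel_measurable M"
  by (rule continuous_borel_measurable_comp[OF _ assms]) (intro continuous_intros)

text \<open>Bounded variation is encoded by a function whose increments dominate those of f. Bounds
  over a partition then telescope to F 1 - F 0, and the variation itself never has to be
  defined.\<close>

definition bv01 :: "(real \<Rightarrow> real) \<Rightarrow> bool" where
  "bv01 f \<longleftrightarrow> (\<exists>F::real \<Rightarrow> real. \<forall>x y. 0 \<le> x \<longrightarrow> x \<le> y \<longrightarrow> y \<le> 1 \<longrightarrow> \<bar>f y - f x\<bar> \<le> F y - F x)"

lemma bv01E:
  assumes "bv01 f"
  obtains F :: "real \<Rightarrow> real" where "\<And>x y. 0 \<le> x \<Longrightarrow> x \<le> y \<Longrightarrow> y \<le> 1 \<Longrightarrow> \<bar>f y - f x\<bar> \<le> F y - F x"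
  using assms unfolding bv01_def by blast

lemma bv01I:
  assumes "\<And>x y. 0 \<le> x \<Longrightarrow> x < y \<Longrightarrow> y \<le> 1 \<Longrightarrow> \<bar>f y - f x\<bar> \<le> F y - (F x :: real)"
  shows "bv01 f"
  unfolding bv01_def
proof (intro exI allI impI)
  fix x y :: real assume "0 \<le> x" "x \<le> y" "y \<le> 1"
  then show "\<bar>f y - f x\<bar> \<le> F y - F x" using assms[of x y] by (cases "x = y") auto
qed

lemma bv01_step: "bv01 (\<lambda>r. if r \<le> l then a else b)"
  by (rule bv01I[where F="\<lambda>r. if r \<le> l then 0 else \<bar>b - a\<bar>"]) auto

lemma bv01_bounded:
  assumes "bv01 f"
  obtains B where "B \<ge> 0" "\<And>x. 0 \<le> x \<Longrightarrow> x \<le> 1 \<Longrightarrow> \<bar>f x\<bar> \<le> B"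
proof -
  obtain F where F: "\<And>x y. 0 \<le> x \<Longrightarrow> x \<le> y \<Longrightarrow> y \<le> 1 \<Longrightarrow> \<bar>f y - f x\<bar> \<le> F y - F x"
    using assms by (rule bv01E) blast
  have "\<bar>f x\<bar> \<le> \<bar>f 0\<bar> + (F 1 - F 0)" if "0 \<le> x" "x \<le> 1" for x
    using F[of 0 x] F[of x 1] that by auto
  moreover have "0 \<le> \<bar>f 0\<bar> + (F 1 - F 0)" using F[of 0 1] by auto
  ultimately show ?thesis using that by blast
qed

lemma bv01_mult:
  assumes f: "bv01 f" and g: "bv01 g"
  shows "bv01 (\<lambda>x. f x * g x)"
proof -
  obtain F where F: "\<And>x y. 0 \<le> x \<Longrightarrow> x \<le> y \<Longrightarrow> y \<le> 1 \<Longrightarrow> \<bar>f y - f x\<bar> \<le> F y - F x"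
    using f by (rule bv01E) blast
  obtain G where G: "\<And>x y. 0 \<le> x \<Longrightarrow> x \<le> y \<Longrightarrow> y \<le> 1 \<Longrightarrow> \<bar>g y - g x\<bar> \<le> G y - G x"
    using g by (rule bv01E) blast
  obtain A where A: "A \<ge> 0" "\<And>x. 0 \<le> x \<Longrightarrow> x \<le> 1 \<Longrightarrow> \<bar>f x\<bar> \<le> A" using f by (rule bv01_bounded) blast
  obtain B where B: "B \<ge> 0" "\<And>x. 0 \<le> x \<Longrightarrow> x \<le> 1 \<Longrightarrow> \<bar>g x\<bar> \<le> B" using g by (rule bv01_bounded) blast
  show ?thesis
  proof (rule bv01I[where F="\<lambda>x. A * G x + B * F x"])
    fix x y :: real assume xy: "0 \<le> x" "x < y" "y \<le> 1"
    have "f y * g y - f x * g x = f y * (g y - g x) + g x * (f y - f x)" by (simp add: algebra_simps)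
    then have "\<bar>f y * g y - f x * g x\<bar> \<le> \<bar>f y\<bar> * \<bar>g y - g x\<bar> + \<bar>g x\<bar> * \<bar>f y - f x\<bar>"
      by (metis abs_mult abs_triangle_ineq)
    also have "\<dots> \<le> A * (G y - G x) + B * (F y - F x)"
      using xy F[of x y] G[of x y] A B by (intro add_mono mult_mono) auto
    finally show "\<bar>f y * g y - f x * g x\<bar> \<le> A * G y + B * F y - (A * G x + B * F x)"
      by (simp add: algebra_simps)
  qed
qed

text \<open>The dominating function adds up, over the pieces, the variation of the monotone
  representative to the left of x, together with a count of breakpoints weighted by 2B. At a
  breakpoint \<phi> may take any value, but it is bounded by B, so the count pays for every
  jump.\<close>

lemma bv01_piecewise_mono_C1:
  assumes "piecewise_mono_C1 \<phi>"
  shows "bv01 \<phi>"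
proof -
  obtain S where S: "finite S" "{0,1} \<subseteq> S" "S \<subseteq> {0..1}"
    and S': "\<forall>a\<in>S. \<forall>b\<in>S. a < b \<and> {a<..<b} \<inter> S = {} \<longrightarrow> (\<exists>\<psi>. \<psi> C1_differentiable_on {a..b} \<and>
        (monotone_on {a..b} (\<le>) (\<le>) \<psi> \<or> monotone_on {a..b} (\<le>) (\<ge>) \<psi>) \<and> (\<forall>x\<in>{a<..<b}. \<phi> x = \<psi> x))"
    using assms unfolding piecewise_mono_C1_def by (elim exE conjE) blast
  define A where "A = {(a,b). a \<in> S \<and> b \<in> S \<and> a < b \<and> {a<..<b} \<inter> S = {}}"
  have finA: "finite A" by (rule finite_subset[of _ "S \<times> S"]) (auto simp: A_def S)
  have "\<forall>p\<in>A. \<exists>\<psi>. (monotone_on {fst p..snd p} (\<le>) (\<le>) \<psi> \<or> monotone_on {fst p..snd p} (\<le>) (\<ge>) \<psi>)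
      \<and> (\<forall>x\<in>{fst p<..<snd p}. \<phi> x = \<psi> x)"
    using S' unfolding A_def by fastforce
  then obtain \<psi> where \<psi>: "\<And>p. p \<in> A \<Longrightarrow> (monotone_on {fst p..snd p} (\<le>) (\<le>) (\<psi> p) \<or> monotone_on {fst p..snd p} (\<le>) (\<ge>) (\<psi> p))"
      "\<And>p x. p \<in> A \<Longrightarrow> x \<in> {fst p<..<snd p} \<Longrightarrow> \<phi> x = \<psi> p x"
    by metis
  \<comment> \<open>Clamping to the piece makes its contribution constant on either side of
    it.\<close>
  define c where "c p x = max (fst p) (min (snd p) x)" for p :: "real \<times> real" and x
  define G where "G p x = \<bar>\<psi> p (c p x) - \<psi> p (fst p)\<bar>" for p x
  have G: "\<bar>\<psi> p (c p y) - \<psi> p (c p x)\<bar> = G p y - G p x" if p: "p \<in> A" "x \<le> y" for p x y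
  proof -
    have ab: "fst p < snd p" using p(1) by (auto simp: A_def)
    have c: "fst p \<le> c p x" "c p x \<le> c p y" "c p y \<le> snd p" using p(2) ab by (auto simp: c_def)
    from \<psi>(1)[OF p(1)] show ?thesis
    proof
      assume "monotone_on {fst p..snd p} (\<le>) (\<le>) (\<psi> p)"
      then have "\<psi> p (fst p) \<le> \<psi> p (c p x)" "\<psi> p (c p x) \<le> \<psi> p (c p y)"
        using c ab by (auto elim!: monotone_onD)
      then show ?thesis by (simp add: G_def)
    next
      assume "monotone_on {fst p..snd p} (\<le>) (\<ge>) (\<psi> p)"
      then have "\<psi> p (fst p) \<ge> \<psi> p (c p x)" "\<psi> p (c p x) \<ge> \<psi> p (c p y)"
        using c ab by (auto elim!: monotone_onD)
      then show ?thesis by (simp add: G_def)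
    qed
  qed
  \<comment> \<open>The piece is cut out by the nearest breakpoints on both sides; they exist
    because 0 and 1 belong to S.\<close>
  have piece: "\<exists>p\<in>A. fst p < x \<and> y < snd p" if "0 < x" "x \<le> y" "y < 1" "{x..y} \<inter> S = {}" for x y
  proof -
    define a where "a = Max {s\<in>S. s < x}"
    define b where "b = Min {s\<in>S. s > y}"
    have a: "a \<in> S" "a < x" "\<And>s. s \<in> S \<Longrightarrow> s < x \<Longrightarrow> s \<le> a"
    proof -
      have "{s\<in>S. s < x} \<noteq> {}" using S that by auto
      then have "a \<in> {s\<in>S. s < x}" unfolding a_def using S(1) by (intro Max_in) auto
      then show "a \<in> S" "a < x" by auto
      show "s \<le> a" if "s \<in> S" "s < x" for s using that S(1) by (auto simp: a_def intro!: Max_ge)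
    qed
    have b: "b \<in> S" "b > y" "\<And>s. s \<in> S \<Longrightarrow> s > y \<Longrightarrow> s \<ge> b"
    proof -
      have "{s\<in>S. s > y} \<noteq> {}" using S that by auto
      then have "b \<in> {s\<in>S. s > y}" unfolding b_def using S(1) by (intro Min_in) auto
      then show "b \<in> S" "b > y" by auto
      show "s \<ge> b" if "s \<in> S" "s > y" for s using that S(1) by (auto simp: b_def intro!: Min_le)
    qed
    have "{a<..<b} \<inter> S = {}"
    proof -
      have False if "s \<in> S" "a < s" "s < b" for s
      proof -
        have "s \<notin> {x..y}" using that(1) \<open>{x..y} \<inter> S = {}\<close> by blast
        then show False using a(3)[OF that(1)] b(3)[OF that(1)] that by auto
      qed
      then show ?thesis by auto
    qed
    then have "(a,b) \<in> A" using a b that by (auto simp: A_def)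
    then show ?thesis using a b by force
  qed
  obtain B where B: "\<And>x. 0 \<le> x \<Longrightarrow> x \<le> 1 \<Longrightarrow> \<bar>\<phi> x\<bar> \<le> B"
  proof -
    define B where "B = (\<Sum>p\<in>A. \<bar>\<psi> p (fst p)\<bar> + G p 1) + (\<Sum>s\<in>S. \<bar>\<phi> s\<bar>)"
    have G0: "G p x \<ge> 0" for p x by (simp add: G_def)
    have "\<bar>\<phi> x\<bar> \<le> B" if x: "0 \<le> x" "x \<le> 1" for x
    proof (cases "x \<in> S")
      case True
      then have "\<bar>\<phi> x\<bar> \<le> (\<Sum>s\<in>S. \<bar>\<phi> s\<bar>)" using S(1) by (intro member_le_sum) auto
      moreover have "0 \<le> (\<Sum>p\<in>A. \<bar>\<psi> p (fst p)\<bar> + G p 1)" using G0 by (intro sum_nonneg) auto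
      ultimately show ?thesis by (simp add: B_def)
    next
      case False
      then have "0 < x" "x < 1" using x S(2) by (auto simp: less_le)
      then obtain p where p: "p \<in> A" "fst p < x" "x < snd p" using piece[of x x] False by auto
      then have "c p x = x" by (auto simp: c_def)
      then have "\<bar>\<phi> x\<bar> \<le> \<bar>\<psi> p (fst p)\<bar> + G p x" using \<psi>(2)[of p x] p by (auto simp: G_def)
      also have "G p x \<le> G p 1" using G[OF p(1), of x 1] x by auto
      also have "\<bar>\<psi> p (fst p)\<bar> + G p 1 \<le> (\<Sum>p\<in>A. \<bar>\<psi> p (fst p)\<bar> + G p 1)"
        using finA p(1) G0 by (intro member_le_sum[of p A "\<lambda>p. \<bar>\<psi> p (fst p)\<bar> + G p 1"]) auto
      also have "\<dots> \<le> B" unfolding B_def by (simp add: sum_nonneg)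
      finally show ?thesis by simp
    qed
    then show ?thesis using that by blast
  qed
  have B0: "B \<ge> 0" using B[of 0] by auto
  \<comment> \<open>Two counts are needed: a breakpoint s with x \<le> s < y is seen by the strict
    count \<open>L\<close>, while a breakpoint equal to y is seen only by \<open>L'\<close>.\<close>
  define L where "L x = card {s\<in>S. s < x}" for x :: real
  define L' where "L' x = card {s\<in>S. s \<le> x}" for x :: real
  show ?thesis
  proof (rule bv01I[where F="\<lambda>x. (\<Sum>p\<in>A. G p x) + 2 * B * (real (L x) + real (L' x))"])
    fix x y :: real assume xy: "0 \<le> x" "x < y" "y \<le> 1"
    have Gm: "G p x \<le> G p y" if "p \<in> A" for p using G[OF that, of x y] xy by auto
    have Lm: "L x \<le> L y" "L' x \<le> L' y" unfolding L_def L'_def using S(1) xy by (auto intro!: card_mono)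
    show "\<bar>\<phi> y - \<phi> x\<bar> \<le> (\<Sum>p\<in>A. G p y) + 2 * B * (real (L y) + real (L' y)) - ((\<Sum>p\<in>A. G p x) + 2 * B * (real (L x) + real (L' x)))"
    proof (cases "{x..y} \<inter> S = {}")
      case True
      then have "0 < x" "y < 1" using xy S(2) by (auto simp: less_le)
      then obtain p where p: "p \<in> A" "fst p < x" "y < snd p" using piece[of x y] True xy by auto
      have "c p x = x" "c p y = y" using p xy by (auto simp: c_def)
      then have "\<bar>\<phi> y - \<phi> x\<bar> = G p y - G p x" using G[OF p(1), of x y] \<psi>(2)[OF p(1)] p xy by auto
      also have "\<dots> \<le> (\<Sum>p\<in>A. G p y - G p x)"
        using finA p(1) Gm by (intro member_le_sum[of p A "\<lambda>p. G p y - G p x"]) auto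
      also have "\<dots> = (\<Sum>p\<in>A. G p y) - (\<Sum>p\<in>A. G p x)" by (simp add: sum_subtractf)
      finally have 1: "\<bar>\<phi> y - \<phi> x\<bar> \<le> (\<Sum>p\<in>A. G p y) - (\<Sum>p\<in>A. G p x)" .
      have "2 * B * (real (L x) + real (L' x)) \<le> 2 * B * (real (L y) + real (L' y))"
        using Lm B0 by (intro mult_left_mono) auto
      then show ?thesis using 1 by linarith
    next
      case False
      then obtain s where s: "s \<in> S" "x \<le> s" "s \<le> y" by auto
      have "L x + L' x < L y + L' y"
      proof (cases "s < y")
        case True
        have "L x < L y" unfolding L_def
        proof (rule psubset_card_mono)
          have "s \<in> {s \<in> S. s < y}" "s \<notin> {s \<in> S. s < x}" using s True by auto
          moreover have "{s \<in> S. s < x} \<subseteq> {s \<in> S. s < y}" using xy by auto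
          ultimately show "{s \<in> S. s < x} \<subset> {s \<in> S. s < y}" by blast
        qed (use S(1) in simp)
        then show ?thesis using Lm by simp
      next
        case False
        have "L' x < L' y" unfolding L'_def
        proof (rule psubset_card_mono)
          have "y \<in> {s \<in> S. s \<le> y}" "y \<notin> {s \<in> S. s \<le> x}" using s False xy by auto
          moreover have "{s \<in> S. s \<le> x} \<subseteq> {s \<in> S. s \<le> y}" using xy by auto
          ultimately show "{s \<in> S. s \<le> x} \<subset> {s \<in> S. s \<le> y}" by blast
        qed (use S(1) in simp)
        then show ?thesis using Lm by simp
      qed
      then have "2 * B * (real (L x) + real (L' x) + 1) \<le> 2 * B * (real (L y) + real (L' y))"
        using B0 by (intro mult_left_mono) auto
      moreover have "(\<Sum>p\<in>A. G p x) \<le> (\<Sum>p\<in>A. G p y)" using Gm by (rule sum_mono)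
      moreover have "\<bar>\<phi> y - \<phi> x\<bar> \<le> 2 * B" using B[of x] B[of y] xy by auto
      ultimately show ?thesis by (simp add: algebra_simps)
    qed
  qed
qed

text \<open>f is the difference of the monotone functions F and F - f.\<close>

lemma bv01_integrable:
  assumes "bv01 f" "0 \<le> a" "b \<le> 1"
  shows "f integrable_on {a..b}"
proof -
  obtain F where F: "\<And>x y. 0 \<le> x \<Longrightarrow> x \<le> y \<Longrightarrow> y \<le> 1 \<Longrightarrow> \<bar>f y - f x\<bar> \<le> F y - F x"
    using assms(1) by (rule bv01E) blast
  have "mono_on {a..b} F" "mono_on {a..b} (\<lambda>x. F x - f x)"
    using F assms(2,3) by (auto intro!: mono_onI dest!: order_trans[OF abs_ge_self] simp: abs_le_iff) (smt (verit) F)+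
  then have "F integrable_on {a..b}" "(\<lambda>x. F x - f x) integrable_on {a..b}"
    by (auto intro: integrable_on_mono_on)
  from integrable_diff[OF this] show ?thesis by simp
qed

text \<open>On a cell of length 1/T the error is at most the variation of f there divided by T, and
  the variations telescope.\<close>

lemma bv01_riemann_sum:
  assumes f: "bv01 f"
  shows "(\<lambda>T::nat. (\<Sum>t=1..T. f (real t / real T)) / real T) \<longlonglongrightarrow> integral {0..1} f"
proof -
  obtain F where F: "\<And>x y. 0 \<le> x \<Longrightarrow> x \<le> y \<Longrightarrow> y \<le> 1 \<Longrightarrow> \<bar>f y - f x\<bar> \<le> F y - F x"
    using f by (rule bv01E) blast
  have bound: "\<bar>(\<Sum>t=1..T. f (real t / real T)) / real T - integral {0..1} f\<bar> \<le> (F 1 - F 0) / real T" if T: "T > 0" for T :: nat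
  proof -
    have split: "integral {0..real n / real T} f = (\<Sum>t=1..n. integral {real (t-1) / real T .. real t / real T} f)" if "n \<le> T" for n
      using that
    proof (induction n)
      case (Suc n)
      have "integral {0..real n / real T} f + integral {real n / real T..real (Suc n) / real T} f = integral {0..real (Suc n) / real T} f"
        using Suc.prems T by (intro Henstock_Kurzweil_Integration.integral_combine bv01_integrable[OF f]) (auto simp: field_simps)
      then show ?case using Suc by simp
    qed simp
    have piece: "\<bar>f (real t / real T) / real T - integral {real (t-1) / real T .. real t / real T} f\<bar>
        \<le> (F (real t / real T) - F (real (t-1) / real T)) / real T" if "t \<in> {1..T}" for t
    proof -
      let ?a = "real (t-1) / real T" and ?b = "real t / real T"
      have ab: "0 \<le> ?a" "?a \<le> ?b" "?b \<le> 1" "?b - ?a = 1 / real T"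
        using that T by (auto simp: field_simps of_nat_diff)
      have int: "f integrable_on {?a..?b}" using ab by (intro bv01_integrable[OF f]) auto
      have "f ?b / real T - integral {?a..?b} f = integral {?a..?b} (\<lambda>x. f ?b - f x)"
        using int ab by (subst Henstock_Kurzweil_Integration.integral_diff) (auto simp: content_real)
      also have "\<bar>\<dots>\<bar> \<le> integral {?a..?b} (\<lambda>x. F ?b - F ?a)"
      proof -
        have "norm (integral {?a..?b} (\<lambda>x. f ?b - f x)) \<le> integral {?a..?b} (\<lambda>x. F ?b - F ?a)"
        proof (rule integral_norm_bound_integral)
          fix x assume x: "x \<in> {?a..?b}"
          have "0 \<le> x" using x ab(1) by (meson atLeastAtMost_iff order_trans)
          then have "\<bar>f ?b - f x\<bar> \<le> F ?b - F x" "0 \<le> F x - F ?a"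
            using x ab F[of x ?b] F[of ?a x] by auto
          then show "norm (f ?b - f x) \<le> F ?b - F ?a" by auto
        qed (rule integrable_diff[OF integrable_const_ivl int], rule integrable_const_ivl)
        then show ?thesis by simp
      qed
      also have "\<dots> = (F ?b - F ?a) / real T" using ab by (simp add: content_real)
      finally show ?thesis .
    qed
    have "\<bar>(\<Sum>t=1..T. f (real t / real T)) / real T - integral {0..1} f\<bar>
       = \<bar>\<Sum>t=1..T. f (real t / real T) / real T - integral {real (t-1) / real T .. real t / real T} f\<bar>"
      using split[of T] T by (simp add: sum_subtractf sum_divide_distrib)
    also have "\<dots> \<le> (\<Sum>t=1..T. \<bar>f (real t / real T) / real T - integral {real (t-1) / real T .. real t / real T} f\<bar>)"
      by (rule sum_abs)
    also have "\<dots> \<le> (\<Sum>t=1..T. (F (real t / real T) - F (real (t-1) / real T)) / real T)"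
      by (rule sum_mono) (rule piece)
    also have "\<dots> = (\<Sum>t=1..T. (F (real t / real T) - F (real (t-1) / real T))) / real T"
      by (simp add: sum_divide_distrib)
    also have "(\<Sum>t=1..T. (F (real t / real T) - F (real (t-1) / real T))) = F 1 - F 0"
    proof -
      have "(\<Sum>t=1..n. (F (real t / real T) - F (real (t-1) / real T))) = F (real n / real T) - F 0" for n
        by (induction n) auto
      then show ?thesis using T by simp
    qed
    finally show ?thesis .
  qed
  have "(\<lambda>T. (\<Sum>t=1..T. f (real t / real T)) / real T - integral {0..1} f) \<longlonglongrightarrow> 0"
  proof (rule Lim_null_comparison)
    show "\<forall>\<^sub>F T in sequentially. norm ((\<Sum>t=1..T. f (real t / real T)) / real T - integral {0..1} f) \<le> (F 1 - F 0) / real T"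
      using eventually_gt_at_top[of 0] by eventually_elim (use bound in auto)
    show "(\<lambda>T. (F 1 - F 0) / real T) \<longlonglongrightarrow> 0" by (rule lim_const_over_n)
  qed
  then show ?thesis by (simp add: LIM_zero_iff)
qed

section \<open>Riemann sums along a path\<close>

text \<open>Left-endpoint sums for the integral of f against x, the same as in
  \<open>wiener_int\<close>. The sample scores instead weight an increment by f at its right
  endpoint; \<open>step_path_rsum\<close> bridges the two.\<close>

definition rsum :: "nat \<Rightarrow> (real \<Rightarrow> real) \<Rightarrow> (real \<Rightarrow> 'v::real_normed_vector) \<Rightarrow> 'v" where
  "rsum n f x = (\<Sum>k<n. f (real k / real n) *\<^sub>R (x (real (Suc k) / real n) - x (real k / real n)))"

text \<open>Only rational times enter, so that the truncated modulus of continuity is measurable for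
  the product sigma-algebra.\<close>
definition osc :: "nat \<Rightarrow> (real \<Rightarrow> 'v::real_normed_vector) \<Rightarrow> real" where
  "osc n x = (SUP p\<in>{p. fst p \<in> \<rat> \<inter> {0..1} \<and> snd p \<in> \<rat> \<inter> {0..1} \<and> \<bar>fst p - snd p\<bar> \<le> 1 / real n}.
     min 1 (dist (x (fst p)) (x (snd p))))"

abbreviation osc_pairs :: "nat \<Rightarrow> (real \<times> real) set" where
  "osc_pairs n \<equiv> {p. fst p \<in> \<rat> \<inter> {0..1} \<and> snd p \<in> \<rat> \<inter> {0..1} \<and> \<bar>fst p - snd p\<bar> \<le> 1 / real n}"

lemma osc_pairs_nonempty: "osc_pairs n \<noteq> {}"
proof -
  have "(0,0) \<in> osc_pairs n" by auto
  then show ?thesis by blast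
qed

lemma osc_bdd: "bdd_above ((\<lambda>p. min 1 (dist (x (fst p)) (x (snd p)))) ` osc_pairs n)"
  by (rule bdd_aboveI2[of _ _ 1]) auto

lemma osc_le_1: "osc n x \<le> 1"
  unfolding osc_def by (rule cSUP_least[OF osc_pairs_nonempty]) auto

lemma osc_upper: "p \<in> osc_pairs n \<Longrightarrow> min 1 (dist (x (fst p)) (x (snd p))) \<le> osc n x"
  unfolding osc_def by (rule cSUP_upper[OF _ osc_bdd])

lemma osc_nonneg: "0 \<le> osc n x"
  using osc_upper[of "(0,0)" n x] by auto

lemma dist_le_osc:
  assumes "osc n x < 1" "r \<in> \<rat>" "s \<in> \<rat>" "0 \<le> r" "r \<le> 1" "0 \<le> s" "s \<le> 1" "\<bar>r - s\<bar> \<le> 1 / real n"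
  shows "dist (x r) (x s) \<le> osc n x"
  using osc_upper[of "(r,s)" n x] assms by auto

text \<open>Together with the truncation this makes \<open>osc n\<close> an admissible test
  functional for \<open>fconv_distr\<close>.\<close>

lemma osc_lipschitz:
  assumes "\<And>r. r \<in> {0..1} \<Longrightarrow> dist (y r) (x r) \<le> d"
  shows "osc n y \<le> osc n x + 2 * d"
  unfolding osc_def[of n y]
proof (rule cSUP_least[OF osc_pairs_nonempty])
  fix p assume p: "p \<in> osc_pairs n"
  have "dist (y (fst p)) (y (snd p)) \<le> dist (x (fst p)) (x (snd p)) + (dist (y (fst p)) (x (fst p)) + dist (y (snd p)) (x (snd p)))"
    by metric
  also have "\<dots> \<le> dist (x (fst p)) (x (snd p)) + 2 * d" using assms[of "fst p"] assms[of "snd p"] p by auto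
  finally have "dist (y (fst p)) (y (snd p)) \<le> dist (x (fst p)) (x (snd p)) + 2 * d" .
  moreover have "d \<ge> 0" using assms[of 0] zero_le_dist order_trans by (metis atLeastAtMost_iff order_refl zero_le_one)
  ultimately have "min 1 (dist (y (fst p)) (y (snd p))) \<le> min 1 (dist (x (fst p)) (x (snd p))) + 2 * d" by linarith
  then show "min 1 (dist (y (fst p)) (y (snd p))) \<le> osc n x + 2 * d" using osc_upper[OF p, of x] by linarith
qed

lemma osc_tendsto_0:
  assumes "continuous_on {0..1} x"
  shows "(\<lambda>n. osc n x) \<longlonglongrightarrow> 0"
proof (rule LIMSEQ_I)
  fix e :: real assume e: "e > 0"
  have "uniformly_continuous_on {0..1} x" using assms by (intro compact_uniformly_continuous) auto
  then obtain d where d: "d > 0" "\<And>r s. r \<in> {0..1} \<Longrightarrow> s \<in> {0..1} \<Longrightarrow> dist r s < d \<Longrightarrow> dist (x r) (x s) < e/2"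
    using e unfolding uniformly_continuous_on_def by (metis half_gt_zero dist_commute)
  obtain N :: nat where N: "N > 0" "1 / real N < d"
    by (metis d(1) nat_approx_posE of_nat_0_less_iff zero_less_Suc)
  show "\<exists>N. \<forall>n\<ge>N. norm (osc n x - 0) < e"
  proof (intro exI allI impI)
    fix n assume n: "n \<ge> N"
    have "1 / real n \<le> 1 / real N" using N n by (intro divide_left_mono) auto
    then have "dist (x (fst p)) (x (snd p)) < e/2" if "p \<in> osc_pairs n" for p
      using that N by (intro d(2)) (auto simp: dist_real_def)
    then have "osc n x \<le> e/2" unfolding osc_def
      by (intro cSUP_least[OF osc_pairs_nonempty] min.coboundedI2 less_imp_le) blast
    then show "norm (osc n x - 0) < e" using osc_nonneg[of n x] e by auto
  qed
qed

lemma borel_measurable_osc: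
  fixes x :: "'a \<Rightarrow> real \<Rightarrow> 'v::{real_normed_vector, second_countable_topology}"
  assumes "\<And>r. r \<in> {0..1} \<Longrightarrow> (\<lambda>\<omega>. x \<omega> r) \<in> borel_measurable M"
  shows "(\<lambda>\<omega>. osc n (x \<omega>)) \<in> borel_measurable M"
  unfolding osc_def
proof (rule borel_measurable_cSUP)
  have "osc_pairs n \<subseteq> \<rat> \<times> \<rat>" by auto
  then show "countable (osc_pairs n)" by (rule countable_subset) (auto simp: countable_rat)
next
  fix p assume "p \<in> osc_pairs n"
  then have "(\<lambda>\<omega>. x \<omega> (fst p)) \<in> borel_measurable M" "(\<lambda>\<omega>. x \<omega> (snd p)) \<in> borel_measurable M"
    using assms by auto
  then show "(\<lambda>\<omega>. min 1 (dist (x \<omega> (fst p)) (x \<omega> (snd p)))) \<in> borel_measurable M" by measurable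
qed (rule osc_bdd)

lemma borel_measurable_rsum:
  fixes x :: "'a \<Rightarrow> real \<Rightarrow> 'v::{real_normed_vector, second_countable_topology}"
  assumes "\<And>r. r \<in> {0..1} \<Longrightarrow> (\<lambda>\<omega>. x \<omega> r) \<in> borel_measurable M"
  shows "(\<lambda>\<omega>. rsum n f (x \<omega>)) \<in> borel_measurable M"
  unfolding rsum_def
  by (intro borel_measurable_sum borel_measurable_scaleR borel_measurable_diff assms) (auto simp: field_simps)

lemma rsum_lipschitz:
  assumes "\<And>r. r \<in> {0..1} \<Longrightarrow> dist (y r) (x r) \<le> d"
  shows "dist (rsum n f y) (rsum n f x) \<le> (\<Sum>k<n. 2 * \<bar>f (real k / real n)\<bar>) * d"
proof -
  have "rsum n f y - rsum n f x = (\<Sum>k<n. f (real k / real n) *\<^sub>R ((y (real (Suc k) / real n) - x (real (Suc k) / real n)) - (y (real k / real n) - x (real k / real n))))"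
    unfolding rsum_def sum_subtractf[symmetric] by (rule sum.cong) (auto simp: algebra_simps)
  also have "norm \<dots> \<le> (\<Sum>k<n. 2 * \<bar>f (real k / real n)\<bar> * d)"
  proof (rule sum_norm_le)
    fix k assume k: "k \<in> {..<n}"
    have "norm (y (real (Suc k) / real n) - x (real (Suc k) / real n)) \<le> d" "norm (y (real k / real n) - x (real k / real n)) \<le> d"
      using assms[of "real (Suc k) / real n"] assms[of "real k / real n"] k by (auto simp: dist_norm field_simps)
    then have "norm ((y (real (Suc k) / real n) - x (real (Suc k) / real n)) - (y (real k / real n) - x (real k / real n))) \<le> 2 * d"
      using norm_triangle_ineq4 by (smt (verit))
    then have "\<bar>f (real k / real n)\<bar> * norm ((y (real (Suc k) / real n) - x (real (Suc k) / real n)) - (y (real k / real n) - x (real k / real n))) \<le> \<bar>f (real k / real n)\<bar> * (2 * d)"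
      by (rule mult_left_mono) simp
    then show "norm (f (real k / real n) *\<^sub>R ((y (real (Suc k) / real n) - x (real (Suc k) / real n)) - (y (real k / real n) - x (real k / real n)))) \<le> 2 * \<bar>f (real k / real n)\<bar> * d"
      by (simp add: mult_ac)
  qed
  finally show ?thesis by (simp add: dist_norm sum_distrib_right)
qed

lemma rsum_linear_path:
  assumes "linear L"
  shows "rsum n f (\<lambda>r. L (x r)) = L (rsum n f x)"
  unfolding rsum_def by (simp add: linear_sum[OF assms] linear_scale[OF assms] linear_diff[OF assms])

text \<open>Differences are taken back from the final value y m. Inside a grid cell each remaining
  factor is then a difference over part of that cell, bounded by the oscillation, and the leading
  term is the coarse Riemann summand.\<close>

lemma summation_by_parts:
  fixes g :: "nat \<Rightarrow> real" and y :: "nat \<Rightarrow> 'v::real_vector"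
  shows "(\<Sum>l<m. g l *\<^sub>R (y (Suc l) - y l)) = g 0 *\<^sub>R (y m - y 0) + (\<Sum>l<m. (g (Suc l) - g l) *\<^sub>R (y m - y (Suc l)))"
proof (induction m)
  case (Suc m)
  have "(\<Sum>l<Suc m. (g (Suc l) - g l) *\<^sub>R (y (Suc m) - y (Suc l)))
     = (\<Sum>l<m. (g (Suc l) - g l) *\<^sub>R (y m - y (Suc l))) + (\<Sum>l<m. (g (Suc l) - g l) *\<^sub>R (y (Suc m) - y m))"
    by (simp add: sum.distrib[symmetric] scaleR_add_right[symmetric])
  also have "(\<Sum>l<m. (g (Suc l) - g l) *\<^sub>R (y (Suc m) - y m)) = (g m - g 0) *\<^sub>R (y (Suc m) - y m)"
    by (simp add: scaleR_sum_left[symmetric] sum_lessThan_telescope)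
  finally show ?case using Suc by (simp add: algebra_simps)
qed simp

text \<open>Within each coarse cell, summation by parts leaves the coarse summand plus products of
  an increment of f with an increment of x over at most 1/n. The bound is free of m, which gives
  both the Cauchy property and the comparison with the sample grid.\<close>

lemma rsum_refine:
  fixes x :: "real \<Rightarrow> 'v::real_normed_vector"
  assumes F: "\<And>x y. 0 \<le> x \<Longrightarrow> x \<le> y \<Longrightarrow> y \<le> 1 \<Longrightarrow> \<bar>f y - f x\<bar> \<le> F y - (F x :: real)"
    and osc: "osc n x < 1" and n: "n > 0" and m: "m > 0"
  shows "norm (rsum (n * m) f x - rsum n f x) \<le> (F 1 - F 0) * osc n x"
proof -
  define p where "p k l = real (k * m + l) / real (n * m)" for k l
  have p0: "p k 0 = real k / real n" and pm: "p k m = real (Suc k) / real n" for k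
    using n m by (auto simp: p_def field_simps)
  have pp: "0 \<le> p k l" "p k l \<le> p k (Suc l)" "p k l \<in> \<rat>" for k l
    using n m by (auto simp: p_def divide_right_mono intro!: Rats_divide)
  have p1: "p k l \<le> 1" if "k < n" "l \<le> m" for k l
  proof -
    have "k * m + l \<le> (k + 1) * m" using that by simp
    also have "\<dots> \<le> n * m" using that by (intro mult_le_mono1) simp
    finally have "real (k * m + l) \<le> real (n * m)" by (simp only: of_nat_le_iff)
    then show ?thesis using n m unfolding p_def by (subst divide_le_eq_1_pos) simp_all
  qed
  have pd: "\<bar>p k m - p k l\<bar> \<le> 1 / real n" if "l \<le> m" for k l
  proof -
    have "p k m - p k l = (real m - real l) / (real n * real m)" using n m by (simp add: p_def field_simps)
    then have "\<bar>p k m - p k l\<bar> = (real m - real l) / (real n * real m)" using that by simp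
    also have "\<dots> \<le> real m / (real n * real m)" by (rule divide_right_mono) auto
    finally show ?thesis using m by simp
  qed
  have "rsum (n * m) f x = (\<Sum>k<n. \<Sum>j\<in>{k*m..<k*m+m}. f (real j / real (n*m)) *\<^sub>R (x (real (Suc j) / real (n*m)) - x (real j / real (n*m))))"
    unfolding rsum_def by (rule sum.nat_group[symmetric])
  also have "\<dots> = (\<Sum>k<n. \<Sum>l<m. f (p k l) *\<^sub>R (x (p k (Suc l)) - x (p k l)))"
  proof (rule sum.cong[OF refl])
    fix k
    show "(\<Sum>j\<in>{k*m..<k*m+m}. f (real j / real (n*m)) *\<^sub>R (x (real (Suc j) / real (n*m)) - x (real j / real (n*m))))
      = (\<Sum>l<m. f (p k l) *\<^sub>R (x (p k (Suc l)) - x (p k l)))"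
      by (rule sum.reindex_bij_witness[of _ "\<lambda>l. k*m+l" "\<lambda>j. j - k*m"]) (auto simp: p_def)
  qed
  also have "\<dots> = (\<Sum>k<n. f (p k 0) *\<^sub>R (x (p k m) - x (p k 0)) + (\<Sum>l<m. (f (p k (Suc l)) - f (p k l)) *\<^sub>R (x (p k m) - x (p k (Suc l)))))"
    by (subst summation_by_parts[where g="\<lambda>l. f (p _ l)" and y="\<lambda>l. x (p _ l)"]) simp
  finally have "rsum (n*m) f x - rsum n f x = (\<Sum>k<n. \<Sum>l<m. (f (p k (Suc l)) - f (p k l)) *\<^sub>R (x (p k m) - x (p k (Suc l))))"
    by (simp add: sum.distrib p0 pm rsum_def)
  also have "norm \<dots> \<le> (\<Sum>k<n. \<Sum>l<m. (F (p k (Suc l)) - F (p k l)) * osc n x)"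
  proof (intro sum_norm_le)
    fix k l assume kl: "k \<in> {..<n}" "l \<in> {..<m}"
    have "\<bar>f (p k (Suc l)) - f (p k l)\<bar> \<le> F (p k (Suc l)) - F (p k l)"
      using kl by (intro F pp p1) auto
    moreover have "norm (x (p k m) - x (p k (Suc l))) \<le> osc n x"
      unfolding dist_norm[symmetric] using kl by (intro dist_le_osc osc pp p1 pd) auto
    ultimately show "norm ((f (p k (Suc l)) - f (p k l)) *\<^sub>R (x (p k m) - x (p k (Suc l)))) \<le> (F (p k (Suc l)) - F (p k l)) * osc n x"
      by (auto intro!: mult_mono)
  qed
  also have "\<dots> = (\<Sum>k<n. F (p k m) - F (p k 0)) * osc n x"
    by (simp add: sum_distrib_right[symmetric] sum_lessThan_telescope[of "\<lambda>l. F (p _ l)"])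
  also have "(\<Sum>k<n. F (p k m) - F (p k 0)) = F 1 - F 0"
    unfolding p0 pm using n by (subst sum_lessThan_telescope) simp
  finally show ?thesis .
qed

text \<open>Grids n and m are compared through their common refinement n * m.\<close>

lemma rsum_convergent:
  fixes x :: "real \<Rightarrow> 'v::banach"
  assumes "bv01 f" "continuous_on {0..1} x"
  shows "convergent (\<lambda>n. rsum n f x)"
proof -
  obtain F where F: "\<And>x y. 0 \<le> x \<Longrightarrow> x \<le> y \<Longrightarrow> y \<le> 1 \<Longrightarrow> \<bar>f y - f x\<bar> \<le> F y - F x"
    using assms(1) by (rule bv01E) blast
  define V where "V = F 1 - F 0"
  have V: "V \<ge> 0" using F[of 0 1] by (auto simp: V_def)
  have "Cauchy (\<lambda>n. rsum n f x)"
  proof (rule CauchyI)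
    fix e :: real assume e: "e > 0"
    define d where "d = min 1 (e / (2 * (V + 1)))"
    have d: "d > 0" "d \<le> 1" "V * d < e / 2"
    proof -
      show "d > 0" "d \<le> 1" using e V by (auto simp: d_def)
      have "V * d \<le> V * (e / (2 * (V + 1)))" using V by (intro mult_left_mono) (auto simp: d_def)
      also have "\<dots> < e / 2" using e V by (simp add: field_simps)
      finally show "V * d < e / 2" .
    qed
    have "\<forall>\<^sub>F n in sequentially. osc n x < d"
      using order_tendstoD(2)[OF osc_tendsto_0[OF assms(2)] d(1)] .
    then obtain N where N: "\<And>n. n \<ge> N \<Longrightarrow> osc n x < d" by (auto simp: eventually_sequentially)
    have *: "norm (rsum (n * m) f x - rsum n f x) < e / 2" if "n \<ge> Suc N" "m > 0" for n m
    proof -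
      have "norm (rsum (n * m) f x - rsum n f x) \<le> V * osc n x"
        unfolding V_def using N[of n] that d by (intro rsum_refine F) auto
      also have "\<dots> \<le> V * d" using N[of n] that V by (intro mult_left_mono) auto
      finally show ?thesis using d by simp
    qed
    show "\<exists>M. \<forall>m\<ge>M. \<forall>n\<ge>M. norm (rsum m f x - rsum n f x) < e"
    proof (intro exI allI impI)
      fix m n assume "m \<ge> Suc N" "n \<ge> Suc N"
      then have "norm (rsum (n * m) f x - rsum n f x) < e/2" "norm (rsum (n * m) f x - rsum m f x) < e/2"
        using *[of n m] *[of m n] by (auto simp: mult.commute)
      then show "norm (rsum m f x - rsum n f x) < e"
        using norm_triangle_ineq4[of "rsum (n * m) f x - rsum n f x" "rsum (n * m) f x - rsum m f x"] by simp
    qed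
  qed
  then show ?thesis by (simp add: Cauchy_convergent_iff)
qed

text \<open>The grid is refined by the factor T. On the finer grid the step path moves only in the
  last of the n cells between k/T and (k + 1)/T, so its Riemann sum is the weighted sum with f
  evaluated one fine cell too early. Correcting the evaluation point and undoing the refinement each
  cost at most (F 1 - F 0) times the oscillation. The additional 1 covers an oscillation equal to 1,
  where truncation makes the claim trivial.\<close>

lemma step_path_rsum:
  fixes y :: "nat \<Rightarrow> 'v::real_normed_vector"
  assumes F: "\<And>x y. 0 \<le> x \<Longrightarrow> x \<le> y \<Longrightarrow> y \<le> 1 \<Longrightarrow> \<bar>f y - f x\<bar> \<le> F y - (F x :: real)"
    and x: "\<And>r. r \<in> {0..1} \<Longrightarrow> x r = y (nat \<lfloor>real T * r\<rfloor>)"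
    and n: "n > 0" and T: "T > 0"
  shows "min 1 (dist (rsum n f x) (\<Sum>t\<in>{1..T}. f (real t / real T) *\<^sub>R (y t - y (t - 1)))) \<le> (2 * (F 1 - F 0) + 1) * osc n x"
proof (cases "osc n x < 1")
  case False
  then have "osc n x = 1" using osc_le_1[of n x] by simp
  then show ?thesis using F[of 0 1] by auto
next
  case True
  have V: "F 1 - F 0 \<ge> 0" using F[of 0 1] by auto
  \<comment> \<open>Left end of the fine cell whose right end is (k + 1) / T.\<close>
  define q where "q k = real (k * n + (n - 1)) / real (T * n)" for k
  have fl: "nat \<lfloor>real T * (real (k * n + l) / real (T * n))\<rfloor> = k" if "l < n" for k l
  proof -
    have "real T * (real (k * n + l) / real (T * n)) = real k + real l / real n"
      using n T by (simp add: field_simps)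
    moreover have "0 \<le> real l / real n" "real l / real n < 1" using that by auto
    ultimately have "\<lfloor>real T * (real (k * n + l) / real (T * n))\<rfloor> = int k" by (intro floor_unique) auto
    then show ?thesis by simp
  qed
  have q: "0 \<le> q k" "q k \<in> \<rat>" "real k / real T \<le> q k" "q k \<le> real (Suc k) / real T" "\<bar>real (Suc k) / real T - q k\<bar> \<le> 1 / real n" for k
  proof -
    show "0 \<le> q k" "q k \<in> \<rat>" by (auto simp: q_def intro!: Rats_divide)
    have e1: "real (Suc k) / real T - q k = 1 / (real T * real n)"
      using n T by (simp add: q_def field_simps of_nat_diff)
    have e2: "q k - real k / real T = real (n - 1) / (real T * real n)"
      using n T by (simp add: q_def field_simps)
    show "q k \<le> real (Suc k) / real T" using e1 by (smt (verit) divide_nonneg_nonneg mult_nonneg_nonneg of_nat_0_le_iff zero_le_one)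
    show "real k / real T \<le> q k" using e2 by (smt (verit) divide_nonneg_nonneg mult_nonneg_nonneg of_nat_0_le_iff)
    have "1 / (real T * real n) \<le> 1 / real n" using n T by (intro divide_left_mono) auto
    then show "\<bar>real (Suc k) / real T - q k\<bar> \<le> 1 / real n" unfolding e1 using n T by simp
  qed
  have le1: "real (Suc k) / real T \<le> 1" if "k < T" for k using that by simp
  have xq: "x (q k) = y k" "x (real (Suc k) / real T) = y (Suc k)" if "k < T" for k
  proof -
    have "q k \<in> {0..1}" using q(1,4)[of k] le1[OF that] by auto
    then show "x (q k) = y k" using x[of "q k"] fl[of "n-1" k] n by (simp add: q_def)
    have "real T * (real (Suc k) / real T) = real (Suc k)" using T by simp
    then show "x (real (Suc k) / real T) = y (Suc k)"
      using x[of "real (Suc k) / real T"] le1[OF that] by (simp del: of_nat_Suc)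
  qed
  have "rsum (T * n) f x = (\<Sum>k<T. \<Sum>j\<in>{k*n..<k*n+n}. f (real j / real (T*n)) *\<^sub>R (x (real (Suc j) / real (T*n)) - x (real j / real (T*n))))"
    unfolding rsum_def by (rule sum.nat_group[symmetric])
  also have "\<dots> = (\<Sum>k<T. f (q k) *\<^sub>R (y (Suc k) - y k))"
  proof (rule sum.cong[OF refl])
    fix k assume k: "k \<in> {..<T}"
    have in01: "real (k * n + l) / real (T * n) \<in> {0..1}" if "l \<le> n" for l
    proof -
      have "k * n + l \<le> (k + 1) * n" using that by simp
      also have "\<dots> \<le> T * n" using k by (intro mult_le_mono1) simp
      finally have "real (k * n + l) \<le> real (T * n)" by (simp only: of_nat_le_iff)
      then show ?thesis using n T by (simp del: of_nat_mult of_nat_add)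
    qed
    have "(\<Sum>j\<in>{k*n..<k*n+n}. f (real j / real (T*n)) *\<^sub>R (x (real (Suc j) / real (T*n)) - x (real j / real (T*n))))
      = (\<Sum>l<n. f (real (k*n+l) / real (T*n)) *\<^sub>R (x (real (k*n+Suc l) / real (T*n)) - x (real (k*n+l) / real (T*n))))"
      by (rule sum.reindex_bij_witness[of _ "\<lambda>l. k*n+l" "\<lambda>j. j - k*n"]) auto
    also have "\<dots> = (\<Sum>l<n. if l = n - 1 then f (q k) *\<^sub>R (y (Suc k) - y k) else 0)"
    proof (rule sum.cong[OF refl])
      fix l assume l: "l \<in> {..<n}"
      have xl: "x (real (k*n+l) / real (T*n)) = y k" using x[OF in01[of l]] fl[of l k] l by simp
      show "f (real (k*n+l) / real (T*n)) *\<^sub>R (x (real (k*n+Suc l) / real (T*n)) - x (real (k*n+l) / real (T*n)))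
         = (if l = n - 1 then f (q k) *\<^sub>R (y (Suc k) - y k) else 0)"
      proof (cases "l = n - 1")
        case True
        have "real (k*n+Suc l) / real (T*n) = real (Suc k) / real T" using True n T by (simp add: field_simps of_nat_diff)
        then show ?thesis using True xl xq(2)[of k] k by (simp add: q_def)
      next
        case False
        then have "x (real (k*n+Suc l) / real (T*n)) = y k" using x[OF in01[of "Suc l"]] fl[of "Suc l" k] l by simp
        then show ?thesis using False xl by simp
      qed
    qed
    also have "\<dots> = f (q k) *\<^sub>R (y (Suc k) - y k)" using n by simp
    finally show "(\<Sum>j\<in>{k*n..<k*n+n}. f (real j / real (T*n)) *\<^sub>R (x (real (Suc j) / real (T*n)) - x (real j / real (T*n)))) = f (q k) *\<^sub>R (y (Suc k) - y k)" .
  qed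
  finally have r1: "rsum (T * n) f x = (\<Sum>k<T. f (q k) *\<^sub>R (y (Suc k) - y k))" .
  have r2: "(\<Sum>t\<in>{1..T}. f (real t / real T) *\<^sub>R (y t - y (t - 1))) = (\<Sum>k<T. f (real (Suc k) / real T) *\<^sub>R (y (Suc k) - y k))"
    by (rule sum.reindex_bij_witness[of _ Suc "\<lambda>t. t - 1"]) auto
  have "norm ((\<Sum>t\<in>{1..T}. f (real t / real T) *\<^sub>R (y t - y (t - 1))) - rsum (T * n) f x)
     = norm (\<Sum>k<T. (f (real (Suc k) / real T) - f (q k)) *\<^sub>R (y (Suc k) - y k))"
    unfolding r1 r2 by (simp add: sum_subtractf[symmetric] scaleR_diff_left[symmetric])
  also have "\<dots> \<le> (\<Sum>k<T. (F (real (Suc k) / real T) - F (real k / real T)) * osc n x)"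
  proof (rule sum_norm_le)
    fix k assume k: "k \<in> {..<T}"
    have q1: "q k \<le> 1" using q(4)[of k] le1[of k] k by (meson lessThan_iff order_trans)
    have "\<bar>f (real (Suc k) / real T) - f (q k)\<bar> \<le> F (real (Suc k) / real T) - F (q k)"
      using k by (intro F q le1) auto
    \<comment> \<open>Enlarges the interval so that it starts at k / T; the bounds then telescope
      over k.\<close>
    moreover have "0 \<le> F (q k) - F (real k / real T)"
      using F[of "real k / real T" "q k"] q(3)[of k] q1 by auto
    moreover have "norm (y (Suc k) - y k) \<le> osc n x"
    proof -
      have "dist (x (real (Suc k) / real T)) (x (q k)) \<le> osc n x"
        using k q[of k] le1[of k] q1 by (intro dist_le_osc True) (auto intro!: Rats_divide)
      then show ?thesis using xq[of k] k by (simp add: dist_norm)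
    qed
    ultimately show "norm ((f (real (Suc k) / real T) - f (q k)) *\<^sub>R (y (Suc k) - y k)) \<le> (F (real (Suc k) / real T) - F (real k / real T)) * osc n x"
      by (auto intro!: mult_mono)
  qed
  also have "\<dots> = (F 1 - F 0) * osc n x"
    unfolding sum_distrib_right[symmetric] using T by (subst sum_lessThan_telescope) simp
  finally have b1: "norm ((\<Sum>t\<in>{1..T}. f (real t / real T) *\<^sub>R (y t - y (t - 1))) - rsum (T * n) f x) \<le> (F 1 - F 0) * osc n x" .
  have b2: "norm (rsum (T * n) f x - rsum n f x) \<le> (F 1 - F 0) * osc n x"
    using rsum_refine[OF F True n T] by (simp add: mult.commute)
  have "dist (rsum n f x) (\<Sum>t\<in>{1..T}. f (real t / real T) *\<^sub>R (y t - y (t - 1))) \<le> (F 1 - F 0) * osc n x + (F 1 - F 0) * osc n x"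
    using norm_triangle_mono[OF b1 b2] by (simp add: dist_norm norm_minus_commute)
  also have "\<dots> \<le> (2 * (F 1 - F 0) + 1) * osc n x" using osc_nonneg[of n x] by (simp add: algebra_simps)
  finally show ?thesis by simp
qed

section \<open>Joint convergence of weighted sums\<close>

lemma min_1_dist_Pair_le:
  "min 1 (dist (a, b) (c, d)) \<le> min 1 (dist a c) + min 1 (dist b d)"
proof -
  have "dist (a, b) (c, d) \<le> dist a c + dist b d"
    unfolding dist_Pair_Pair by (rule sqrt_sum_squares_le_sum) auto
  then show ?thesis by (smt (verit) zero_le_dist)
qed

lemma min_1_sum_le:
  fixes f :: "'i \<Rightarrow> real"
  assumes "finite I" "\<And>i. i \<in> I \<Longrightarrow> f i \<ge> 0"
  shows "min 1 (\<Sum>i\<in>I. f i) \<le> (\<Sum>i\<in>I. min 1 (f i))"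
  using assms
proof (induction I)
  case (insert i I)
  have "0 \<le> (\<Sum>i\<in>I. f i)" "0 \<le> f i" using insert by (auto intro: sum_nonneg)
  then have "min 1 (f i + (\<Sum>i\<in>I. f i)) \<le> min 1 (f i) + min 1 (\<Sum>i\<in>I. f i)" by linarith
  also have "min 1 (\<Sum>i\<in>I. f i) \<le> (\<Sum>i\<in>I. min 1 (f i))" using insert by simp
  finally show ?case using insert by simp
qed simp

lemma min_1_dist_vec_le:
  fixes a b :: "'v::real_normed_vector^'i"
  shows "min 1 (dist a b) \<le> (\<Sum>i\<in>UNIV. min 1 (dist (a $ i) (b $ i)))"
proof -
  have "dist a b \<le> (\<Sum>i\<in>UNIV. dist (a $ i) (b $ i))"
    unfolding dist_vec_def by (rule L2_set_le_sum) simp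
  then have "min 1 (dist a b) \<le> min 1 (\<Sum>i\<in>UNIV. dist (a $ i) (b $ i))" by simp
  also have "\<dots> \<le> (\<Sum>i\<in>UNIV. min 1 (dist (a $ i) (b $ i)))" by (rule min_1_sum_le) auto
  finally show ?thesis .
qed

text \<open>The constant limit a of A is already paired with the Riemann sums in the approximants,
  so the joint convergence of moments and scores comes out of a single approximation argument. The
  second limit component is the pathwise integral, which exists for almost every limit path.\<close>

lemma conv_distr_weighted_sums:
  fixes S :: "nat \<Rightarrow> 'a \<Rightarrow> real \<Rightarrow> real^'n" and Y :: "'b \<Rightarrow> real \<Rightarrow> real^'n"
    and f :: "'i::finite \<Rightarrow> real \<Rightarrow> real" and A :: "nat \<Rightarrow> 'a \<Rightarrow> 'c::euclidean_space"
  assumes P: "prob_space P" and M: "prob_space M"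
    and Y: "\<And>r. r \<in> {0..1} \<Longrightarrow> (\<lambda>\<omega>. Y \<omega> r) \<in> borel_measurable M"
      "AE \<omega> in M. continuous_on {0..1} (Y \<omega>)"
    and y: "\<And>T t. (\<lambda>\<omega>. y T \<omega> t) \<in> borel_measurable P"
    and S: "\<And>T \<omega> r. S T \<omega> r = y T \<omega> (nat \<lfloor>real T * r\<rfloor>)"
    and fclt: "fconv_distr P S M Y"
    and f: "\<And>i. bv01 (f i)"
    and A: "\<And>T. A T \<in> borel_measurable P"
      "(\<lambda>T. \<integral>\<omega>. min 1 (dist a (A T \<omega>)) \<partial>P) \<longlonglongrightarrow> 0"
  shows "conv_distr P
      (\<lambda>T \<omega>. (A T \<omega>, \<chi> i. \<Sum>t\<in>{1..T}. f i (real t / real T) *\<^sub>R (y T \<omega> t - y T \<omega> (t - 1))))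
      M (\<lambda>\<omega>. (a, \<chi> i. lim (\<lambda>n. rsum n (f i) (Y \<omega>))))"
proof -
  note [measurable] = y A(1)
  interpret P: prob_space P by fact
  interpret M: prob_space M by fact
  have Sm: "(\<lambda>\<omega>. S T \<omega> r) \<in> borel_measurable P" for T r unfolding S by (rule y)
  define H where "H n x = (\<chi> i. rsum n (f i) x)" for n and x :: "real \<Rightarrow> real^'n"
  have Hm: "(\<lambda>x. H n x) \<in> borel_measurable (PiM {0..1} (\<lambda>_. borel))" for n
    unfolding H_def by (intro borel_measurable_vec_lambda borel_measurable_rsum measurable_component_singleton) auto
  have HmP: "(\<lambda>\<omega>. H n (S T \<omega>)) \<in> borel_measurable P" for n T
    unfolding H_def using Sm by (intro borel_measurable_vec_lambda borel_measurable_rsum) auto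
  have HmM: "(\<lambda>\<omega>. H n (Y \<omega>)) \<in> borel_measurable M" for n
    unfolding H_def using Y by (intro borel_measurable_vec_lambda borel_measurable_rsum) auto
  \<comment> \<open>\<open>fconv_distr\<close> speaks of paths restricted to [0,1]; the grid points
    lie there, so \<open>H\<close> does not notice the restriction.\<close>
  have Hres: "H n (restrict x {0..1}) = H n x" if "n > 0" for n x
    unfolding H_def rsum_def using that by (intro arg_cong[where f=vec_lambda] ext sum.cong refl) (auto simp: field_simps)
  have ores: "osc n (restrict x {0..1}) = osc n x" for n and x :: "real \<Rightarrow> real^'n"
    unfolding osc_def by (intro arg_cong[where f=Sup] image_cong refl) auto
  have cont: "sup_cont_at (\<lambda>x. g (a, H n x)) x" if g: "continuous_on UNIV g" for g :: "'c \<times> ((real^'n)^'i) \<Rightarrow> real" and n x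
    unfolding sup_cont_at_def
  proof safe
    fix e :: real assume e: "e > 0"
    have "continuous_on UNIV (\<lambda>h. g (a, h))" using g by (intro continuous_on_compose2[OF g] continuous_intros) auto
    then obtain d where d: "d > 0" "\<And>h. dist h (H n x) < d \<Longrightarrow> dist (g (a, h)) (g (a, H n x)) < e"
      using e unfolding continuous_on_iff by (metis UNIV_I)
    define C where "C = (\<Sum>i\<in>UNIV. \<Sum>k<n. 2 * \<bar>f i (real k / real n)\<bar>)"
    have C: "C \<ge> 0" unfolding C_def by (intro sum_nonneg) auto
    show "\<exists>d>0. \<forall>y\<in>extensional {0..1}. (\<forall>r\<in>{0..1}. dist (y r) (x r) < d) \<longrightarrow> \<bar>g (a, H n y) - g (a, H n x)\<bar> < e"
    proof (intro exI[of _ "d / (C + 1)"] conjI ballI impI)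
      show "d / (C + 1) > 0" using d C by simp
      fix y assume y: "\<forall>r\<in>{0..1}. dist (y r) (x r) < d / (C + 1)"
      have "dist (H n y) (H n x) \<le> (\<Sum>i\<in>UNIV. dist (rsum n (f i) y) (rsum n (f i) x))"
        unfolding H_def dist_vec_def by (rule order_trans[OF L2_set_le_sum]) auto
      also have "\<dots> \<le> (\<Sum>i\<in>UNIV. (\<Sum>k<n. 2 * \<bar>f i (real k / real n)\<bar>) * (d / (C + 1)))"
        by (intro sum_mono rsum_lipschitz less_imp_le) (use y in auto)
      also have "\<dots> = C * (d / (C + 1))" unfolding C_def by (rule sum_distrib_right[symmetric])
      also have "\<dots> < d" using d C by (simp add: field_simps)
      finally show "\<bar>g (a, H n y) - g (a, H n x)\<bar> < e" using d(2) by (simp add: dist_real_def)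
    qed
  qed
  let ?X = "\<lambda>T \<omega>. (A T \<omega>, \<chi> i. \<Sum>t\<in>{1..T}. f i (real t / real T) *\<^sub>R (y T \<omega> t - y T \<omega> (t - 1)))"
  have Xm: "?X T \<in> borel_measurable P" for T by measurable
  have Jm: "(\<lambda>\<omega>. (a, \<chi> i. lim (\<lambda>n. rsum n (f i) (Y \<omega>)))) \<in> borel_measurable M"
    using Y by (intro borel_measurable_Pair borel_measurable_const borel_measurable_vec_lambda borel_measurable_lim_metric borel_measurable_rsum) auto
  have "\<forall>i. \<exists>F::real \<Rightarrow> real. \<forall>x y. 0 \<le> x \<longrightarrow> x \<le> y \<longrightarrow> y \<le> 1 \<longrightarrow> \<bar>f i y - f i x\<bar> \<le> F y - F x"
    using f unfolding bv01_def by blast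
  then obtain F :: "'i \<Rightarrow> real \<Rightarrow> real" where
    F: "\<And>i x y. 0 \<le> x \<Longrightarrow> x \<le> y \<Longrightarrow> y \<le> 1 \<Longrightarrow> \<bar>f i y - f i x\<bar> \<le> F i y - F i x"
    by metis
  define V where "V = (\<Sum>i\<in>UNIV. 2 * (F i 1 - F i 0) + 1)"
  have Hclose: "min 1 (dist (H n (S T \<omega>)) (snd (?X T \<omega>))) \<le> V * osc n (S T \<omega>)" if "n > 0" "T > 0" for n T \<omega>
  proof -
    have "min 1 (dist (H n (S T \<omega>)) (snd (?X T \<omega>))) \<le> (\<Sum>i\<in>UNIV. min 1 (dist (rsum n (f i) (S T \<omega>)) (\<Sum>t\<in>{1..T}. f i (real t / real T) *\<^sub>R (y T \<omega> t - y T \<omega> (t - 1)))))"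
      by (rule order_trans[OF min_1_dist_vec_le]) (simp add: H_def)
    also have "\<dots> \<le> V * osc n (S T \<omega>)"
      unfolding V_def sum_distrib_right by (intro sum_mono step_path_rsum that S F)
    finally show ?thesis .
  qed
  have V0: "V \<ge> 0"
    unfolding V_def
  proof (rule sum_nonneg)
    show "0 \<le> 2 * (F i 1 - F i 0) + 1" for i using F[of 0 1 i] by simp
  qed
  have om: "(\<lambda>\<omega>. osc n (S T \<omega>)) \<in> borel_measurable P" for n T using Sm by (rule borel_measurable_osc)
  \<comment> \<open>Using \<open>osc n\<close> itself as a test functional controls the oscillation
    of the sample paths by that of the continuous limit path.\<close>
  have oscT: "(\<lambda>T. \<integral>\<omega>. osc n (S T \<omega>) \<partial>P) \<longlonglongrightarrow> (\<integral>\<omega>. osc n (Y \<omega>) \<partial>M)" for n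
  proof -
    have "(\<lambda>T. \<integral>\<omega>. osc n (restrict (S T \<omega>) {0..1}) \<partial>P) \<longlonglongrightarrow> (\<integral>\<omega>. osc n (restrict (Y \<omega>) {0..1}) \<partial>M)"
    proof (rule fclt[unfolded fconv_distr_def, rule_format], intro conjI ballI impI)
      show "(osc n :: (real \<Rightarrow> real^'n) \<Rightarrow> real) \<in> borel_measurable (PiM {0..1} (\<lambda>_. borel))"
        by (rule borel_measurable_osc[where x="\<lambda>x. x"], rule measurable_component_singleton)
      show "bounded (range (osc n :: (real \<Rightarrow> real^'n) \<Rightarrow> real))"
        unfolding bounded_iff by (intro exI[of _ 1]) (auto simp: osc_nonneg osc_le_1)
      fix x :: "real \<Rightarrow> real^'n"
      show "sup_cont_at (osc n) x"
        unfolding sup_cont_at_def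
      proof safe
        fix e :: real assume e: "e > 0"
        show "\<exists>d>0. \<forall>y\<in>extensional {0..1}. (\<forall>r\<in>{0..1}. dist (y r) (x r) < d) \<longrightarrow> \<bar>osc n y - osc n x\<bar> < e"
        proof (intro exI[of _ "e/3"] conjI ballI impI)
          fix y assume y: "\<forall>r\<in>{0..1}. dist (y r) (x r) < e/3"
          have "osc n y \<le> osc n x + 2 * (e/3)"
            by (rule osc_lipschitz) (use y in \<open>auto intro: less_imp_le\<close>)
          moreover have "osc n x \<le> osc n y + 2 * (e/3)"
            by (rule osc_lipschitz) (use y in \<open>auto simp: dist_commute intro: less_imp_le\<close>)
          ultimately show "\<bar>osc n y - osc n x\<bar> < e" using e by linarith
        qed (use e in auto)
      qed
    qed
    then show ?thesis by (simp add: ores)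
  qed
  have oscM: "(\<lambda>n. \<integral>\<omega>. osc n (Y \<omega>) \<partial>M) \<longlonglongrightarrow> 0"
  proof -
    have "(\<lambda>n. \<integral>\<omega>. osc n (Y \<omega>) \<partial>M) \<longlonglongrightarrow> (\<integral>\<omega>. 0 \<partial>M)"
    proof (rule integral_dominated_convergence[where w="\<lambda>_. 1"])
      show "(\<lambda>\<omega>. osc n (Y \<omega>)) \<in> borel_measurable M" for n using Y(1) by (rule borel_measurable_osc)
      show "AE \<omega> in M. (\<lambda>n. osc n (Y \<omega>)) \<longlonglongrightarrow> 0"
        using Y(2) by eventually_elim (rule osc_tendsto_0)
    qed (auto simp: osc_nonneg osc_le_1)
    then show ?thesis by simp
  qed
  show ?thesis
  proof (rule conv_distr_approx[OF P M Xm Jm, where Xn="\<lambda>n T \<omega>. (a, H n (S T \<omega>))" and Y="\<lambda>n \<omega>. (a, H n (Y \<omega>))"])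
    show "(\<lambda>\<omega>. (a, H n (S T \<omega>))) \<in> borel_measurable P" for n T using HmP by measurable
    show "conv_distr P (\<lambda>T \<omega>. (a, H n (S T \<omega>))) M (\<lambda>\<omega>. (a, H n (Y \<omega>)))" if n: "n > 0" for n
      unfolding conv_distr_def
    proof safe
      fix g :: "'c \<times> ((real^'n)^'i) \<Rightarrow> real" assume g: "continuous_on UNIV g" and bg: "bounded (range g)"
      have "(\<lambda>T. \<integral>\<omega>. g (a, H n (restrict (S T \<omega>) {0..1})) \<partial>P) \<longlonglongrightarrow> (\<integral>\<omega>. g (a, H n (restrict (Y \<omega>) {0..1})) \<partial>M)"
      proof (rule fclt[unfolded fconv_distr_def, rule_format], intro conjI ballI impI)
        show "(\<lambda>x. g (a, H n x)) \<in> borel_measurable (PiM {0..1} (\<lambda>_. borel))"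
          using borel_measurable_continuous_onI[OF g] Hm by measurable
        show "bounded (range (\<lambda>x. g (a, H n x)))" using bg by (rule bounded_subset) auto
      qed (rule cont[OF g])
      then show "(\<lambda>T. \<integral>\<omega>. g (a, H n (S T \<omega>)) \<partial>P) \<longlonglongrightarrow> (\<integral>\<omega>. g (a, H n (Y \<omega>)) \<partial>M)"
        by (simp only: Hres[OF n])
    qed
    show "conv_distr M (\<lambda>n \<omega>. (a, H n (Y \<omega>))) M (\<lambda>\<omega>. (a, \<chi> i. lim (\<lambda>n. rsum n (f i) (Y \<omega>))))"
    proof (rule conv_distr_AE[OF M _ Jm])
      show "(\<lambda>\<omega>. (a, H n (Y \<omega>))) \<in> borel_measurable M" for n using HmM by measurable
      show "AE \<omega> in M. (\<lambda>n. (a, H n (Y \<omega>))) \<longlonglongrightarrow> (a, \<chi> i. lim (\<lambda>n. rsum n (f i) (Y \<omega>)))"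
        using Y(2)
      proof eventually_elim
        case (elim \<omega>)
        show ?case unfolding H_def
          using rsum_convergent[OF f elim] by (intro tendsto_intros tendsto_vec_lambda) (simp add: convergent_LIMSEQ_iff)
      qed
    qed
    fix e :: real assume e: "e > 0"
    have e': "e / (2 * (V + 1)) > 0" using e V0 by simp
    have Ve: "V * (e / (2 * (V + 1))) \<le> e / 2" using e V0 by (simp add: field_simps)
    have "\<forall>\<^sub>F n in sequentially. (\<integral>\<omega>. osc n (Y \<omega>) \<partial>M) < e / (2 * (V + 1))"
      using order_tendstoD(2)[OF oscM e'] .
    then show "\<forall>\<^sub>F n in sequentially. \<forall>\<^sub>F T in sequentially. (\<integral>\<omega>. min 1 (dist (a, H n (S T \<omega>)) (?X T \<omega>)) \<partial>P) \<le> e"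
      using eventually_gt_at_top[of 0]
    proof eventually_elim
      case (elim n)
      have "\<forall>\<^sub>F T in sequentially. (\<integral>\<omega>. osc n (S T \<omega>) \<partial>P) < e / (2 * (V + 1))"
        using order_tendstoD(2)[OF oscT elim(1)] .
      moreover have "\<forall>\<^sub>F T in sequentially. (\<integral>\<omega>. min 1 (dist a (A T \<omega>)) \<partial>P) < e/2"
        using order_tendstoD(2)[OF A(2), of "e/2"] e by simp
      ultimately show ?case using eventually_gt_at_top[of 0]
      proof eventually_elim
        case (elim T)
        have i1: "integrable P (\<lambda>\<omega>. min 1 (dist (a, H n (S T \<omega>)) (?X T \<omega>)))"
          using HmP Xm by (intro prob_integrable_bounded[OF P, where C=1]) auto
        have i2: "integrable P (\<lambda>\<omega>. min 1 (dist a (A T \<omega>)))"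
          by (intro prob_integrable_bounded[OF P, where C=1]) auto
        have i3: "integrable P (\<lambda>\<omega>. osc n (S T \<omega>))"
          using om by (intro prob_integrable_bounded[OF P, where C=1]) (auto simp: osc_nonneg osc_le_1)
        have "(\<integral>\<omega>. min 1 (dist (a, H n (S T \<omega>)) (?X T \<omega>)) \<partial>P) \<le> (\<integral>\<omega>. min 1 (dist a (A T \<omega>)) + V * osc n (S T \<omega>) \<partial>P)"
        proof (rule integral_mono)
          fix \<omega>
          show "min 1 (dist (a, H n (S T \<omega>)) (?X T \<omega>)) \<le> min 1 (dist a (A T \<omega>)) + V * osc n (S T \<omega>)"
            using min_1_dist_Pair_le[of a "H n (S T \<omega>)" "A T \<omega>" "snd (?X T \<omega>)"] Hclose[of n T \<omega>] \<open>n > 0\<close> elim(3)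
            unfolding snd_conv by linarith
        qed (use i1 i2 i3 in auto)
        also have "\<dots> = (\<integral>\<omega>. min 1 (dist a (A T \<omega>)) \<partial>P) + V * (\<integral>\<omega>. osc n (S T \<omega>) \<partial>P)"
          using i2 i3 by simp
        also have "\<dots> \<le> e/2 + V * (e / (2 * (V + 1)))"
          using elim V0 by (intro add_mono mult_left_mono) auto
        finally show ?case using Ve by linarith
      qed
    qed
  qed
qed


section \<open>Weighted laws of large numbers\<close>

lemma uniform_lln_event:
  fixes \<zeta> :: "nat \<Rightarrow> 'a \<Rightarrow> 'v::euclidean_space"
  assumes \<zeta>: "\<And>t. \<zeta> t \<in> borel_measurable P"
  shows "{\<omega>\<in>space P. \<exists>r\<in>{0..1}. norm ((1 / real T) *\<^sub>R (\<Sum>t\<in>{1..nat \<lfloor>real T * r\<rfloor>}. \<zeta> t \<omega>) - r *\<^sub>R Q) > e} \<in> sets P"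
proof -
  note [measurable] = \<zeta>
  \<comment> \<open>The event quantifies over uncountably many r, but the partial sum depends on r
    only through an index k. For each k the admissible values form a union of open sets, which is
    open whatever its size.\<close>
  define U where "U k = (\<Union>r\<in>{r\<in>{0..1}. nat \<lfloor>real T * r\<rfloor> = k}. {v::'v. norm ((1 / real T) *\<^sub>R v - r *\<^sub>R Q) > e})" for k
  have "open {v::'v. norm ((1 / real T) *\<^sub>R v - r *\<^sub>R Q) > e}" for r
    by (intro open_Collect_less continuous_intros)
  then have [measurable]: "U k \<in> sets borel" for k unfolding U_def by (intro borel_open open_UN) auto
  have "{\<omega>\<in>space P. \<exists>r\<in>{0..1}. norm ((1 / real T) *\<^sub>R (\<Sum>t\<in>{1..nat \<lfloor>real T * r\<rfloor>}. \<zeta> t \<omega>) - r *\<^sub>R Q) > e}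
     = {\<omega>\<in>space P. \<exists>k. (\<Sum>t\<in>{1..k}. \<zeta> t \<omega>) \<in> U k}"
    by (auto simp: U_def)
  also have "\<dots> \<in> sets P" by measurable
  finally show ?thesis .
qed

text \<open>Summation by parts for the deviation y of the partial sums from their linear drift along
  Q. It is at most e at every grid point, and the weights contribute their bound B and twice their
  variation.\<close>

lemma weighted_sum_bound:
  fixes z :: "nat \<Rightarrow> 'v::real_normed_vector"
  assumes F: "\<And>x y. 0 \<le> x \<Longrightarrow> x \<le> y \<Longrightarrow> y \<le> 1 \<Longrightarrow> \<bar>f y - f x\<bar> \<le> F y - (F x :: real)"
    and B: "\<And>x. 0 \<le> x \<Longrightarrow> x \<le> 1 \<Longrightarrow> \<bar>f x\<bar> \<le> B" and T: "T > 0" and e: "e \<ge> 0"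
    and z: "\<And>r. r \<in> {0..1} \<Longrightarrow> norm ((1 / real T) *\<^sub>R (\<Sum>t\<in>{1..nat \<lfloor>real T * r\<rfloor>}. z t) - r *\<^sub>R Q) \<le> e"
  shows "norm ((1 / real T) *\<^sub>R (\<Sum>t\<in>{1..T}. f (real t / real T) *\<^sub>R z t) - ((\<Sum>t=1..T. f (real t / real T)) / real T) *\<^sub>R Q)
    \<le> (B + 2 * (F 1 - F 0)) * e"
proof -
  define y where "y k = (1 / real T) *\<^sub>R (\<Sum>t\<in>{1..k}. z t) - (real k / real T) *\<^sub>R Q" for k
  have y: "norm (y k) \<le> e" if "k \<le> T" for k
  proof -
    have "real T * (real k / real T) = real k" using T by simp
    then show ?thesis using z[of "real k / real T"] that T by (simp add: y_def)
  qed
  have y0: "y 0 = 0" by (simp add: y_def)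
  have ys: "y (Suc k) - y k = (1 / real T) *\<^sub>R (z (Suc k) - Q)" for k
    by (simp add: y_def algebra_simps add_divide_distrib)
  \<comment> \<open>The cap keeps the argument inside [0,1] at l = T, an index that summation by
    parts reaches.\<close>
  define g where "g l = f (min 1 (real (Suc l) / real T))" for l
  have gf: "g l = f (real (Suc l) / real T)" if "l < T" for l using that by (simp add: g_def min_absorb2)
  have "(1 / real T) *\<^sub>R (\<Sum>t\<in>{1..T}. f (real t / real T) *\<^sub>R z t) - ((\<Sum>t=1..T. f (real t / real T)) / real T) *\<^sub>R Q
     = (\<Sum>t\<in>{1..T}. f (real t / real T) *\<^sub>R ((1 / real T) *\<^sub>R (z t - Q)))"
    by (simp add: scaleR_sum_right scaleR_sum_left sum_divide_distrib sum_subtractf[symmetric] scaleR_diff_right)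
  also have "\<dots> = (\<Sum>l<T. f (real (Suc l) / real T) *\<^sub>R ((1 / real T) *\<^sub>R (z (Suc l) - Q)))"
    by (rule sum.reindex_bij_witness[of _ Suc "\<lambda>t. t - 1"]) auto
  also have "\<dots> = (\<Sum>l<T. g l *\<^sub>R (y (Suc l) - y l))"
    by (rule sum.cong[OF refl]) (simp add: gf ys del: of_nat_Suc)
  also have "\<dots> = g 0 *\<^sub>R y T + (\<Sum>l<T. (g (Suc l) - g l) *\<^sub>R (y T - y (Suc l)))"
    by (subst summation_by_parts) (simp add: y0)
  also have "norm \<dots> \<le> B * e + (\<Sum>l<T. (F (min 1 (real (Suc (Suc l)) / real T)) - F (min 1 (real (Suc l) / real T))) * (2 * e))"
  proof (intro norm_triangle_mono sum_norm_le)
    have "\<bar>g 0\<bar> \<le> B" unfolding g_def by (rule B) auto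
    then have "\<bar>g 0\<bar> * norm (y T) \<le> B * e" using y[of T] e by (intro mult_mono) auto
    then show "norm (g 0 *\<^sub>R y T) \<le> B * e" by simp
    fix l assume l: "l \<in> {..<T}"
    have "real (Suc l) / real T \<le> real (Suc (Suc l)) / real T" by (rule divide_right_mono) auto
    then have "\<bar>g (Suc l) - g l\<bar> \<le> F (min 1 (real (Suc (Suc l)) / real T)) - F (min 1 (real (Suc l) / real T))"
      unfolding g_def by (intro F) auto
    moreover have "norm (y T - y (Suc l)) \<le> 2 * e"
      using norm_triangle_ineq4[of "y T" "y (Suc l)"] y[of T] y[of "Suc l"] l by simp
    ultimately show "norm ((g (Suc l) - g l) *\<^sub>R (y T - y (Suc l))) \<le> (F (min 1 (real (Suc (Suc l)) / real T)) - F (min 1 (real (Suc l) / real T))) * (2 * e)"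
      by (auto intro!: mult_mono)
  qed
  also have "\<dots> = B * e + (F (min 1 (real (Suc T) / real T)) - F (min 1 (real (Suc 0) / real T))) * (2 * e)"
    unfolding sum_distrib_right[symmetric] by (subst sum_lessThan_telescope[of "\<lambda>l. F (min 1 (real (Suc l) / real T))"]) simp
  also have "\<dots> \<le> B * e + (F 1 - F 0) * (2 * e)"
  proof -
    have "F (min 1 (real (Suc T) / real T)) = F 1" using T by (simp add: min_absorb1)
    moreover have "F (min 1 (real (Suc 0) / real T)) \<ge> F 0" using F[of 0 "min 1 (real (Suc 0) / real T)"] by auto
    ultimately show ?thesis using e by (intro add_left_mono mult_right_mono) auto
  qed
  finally show ?thesis by (simp add: algebra_simps)
qed

lemma weighted_lln:
  fixes \<zeta> :: "nat \<Rightarrow> 'a \<Rightarrow> 'v::euclidean_space"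
  assumes P: "prob_space P" and \<zeta>: "\<And>t. \<zeta> t \<in> borel_measurable P"
    and lln: "\<And>e. e > 0 \<Longrightarrow> (\<lambda>T. measure P {\<omega>\<in>space P. \<exists>r\<in>{0..1}.
       norm ((1 / real T) *\<^sub>R (\<Sum>t\<in>{1..nat \<lfloor>real T * r\<rfloor>}. \<zeta> t \<omega>) - r *\<^sub>R Q) > e}) \<longlonglongrightarrow> 0"
    and f: "bv01 f"
  shows "(\<lambda>T. \<integral>\<omega>. min 1 (dist (integral {0..1} f *\<^sub>R Q) ((1 / real T) *\<^sub>R (\<Sum>t\<in>{1..T}. f (real t / real T) *\<^sub>R \<zeta> t \<omega>))) \<partial>P) \<longlonglongrightarrow> 0"
proof (rule tendsto_prob_imp_truncated_mean[OF P])
  note [measurable] = \<zeta>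
  interpret prob_space P by fact
  show "(\<lambda>\<omega>. dist (integral {0..1} f *\<^sub>R Q) ((1 / real T) *\<^sub>R (\<Sum>t\<in>{1..T}. f (real t / real T) *\<^sub>R \<zeta> t \<omega>))) \<in> borel_measurable P" for T
    by measurable
  obtain F where F: "\<And>x y. 0 \<le> x \<Longrightarrow> x \<le> y \<Longrightarrow> y \<le> 1 \<Longrightarrow> \<bar>f y - f x\<bar> \<le> F y - F x"
    using f by (rule bv01E) blast
  obtain B where B: "B \<ge> 0" "\<And>x. 0 \<le> x \<Longrightarrow> x \<le> 1 \<Longrightarrow> \<bar>f x\<bar> \<le> B" using f by (rule bv01_bounded) blast
  fix e :: real assume e: "e > 0"
  define C where "C = B + 2 * (F 1 - F 0)"
  have C: "C \<ge> 0" using B F[of 0 1] by (auto simp: C_def)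
  \<comment> \<open>Half of e is left for the convergence of the Riemann sums of f to its
    integral.\<close>
  define e' where "e' = e / (2 * (C + 1))"
  have e': "e' > 0" "C * e' \<le> e / 2" using e C by (auto simp: e'_def field_simps)
  let ?c = "\<lambda>T. (\<Sum>t=1..T. f (real t / real T)) / real T"
  let ?D = "\<lambda>T \<omega>. dist (integral {0..1} f *\<^sub>R Q) ((1 / real T) *\<^sub>R (\<Sum>t\<in>{1..T}. f (real t / real T) *\<^sub>R \<zeta> t \<omega>))"
  let ?E = "\<lambda>T. {\<omega>\<in>space P. \<exists>r\<in>{0..1}. norm ((1 / real T) *\<^sub>R (\<Sum>t\<in>{1..nat \<lfloor>real T * r\<rfloor>}. \<zeta> t \<omega>) - r *\<^sub>R Q) > e'}"
  have "(\<lambda>T. dist (integral {0..1} f *\<^sub>R Q) (?c T *\<^sub>R Q)) \<longlonglongrightarrow> dist (integral {0..1} f *\<^sub>R Q) (integral {0..1} f *\<^sub>R Q)"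
    by (intro tendsto_intros bv01_riemann_sum f)
  then have ev: "\<forall>\<^sub>F T in sequentially. dist (integral {0..1} f *\<^sub>R Q) (?c T *\<^sub>R Q) < e / 2"
    using e order_tendstoD(2)[of _ "dist (integral {0..1} f *\<^sub>R Q) (integral {0..1} f *\<^sub>R Q)" sequentially "e/2"] by (simp only: dist_self)
  show "(\<lambda>T. measure P {\<omega>\<in>space P. ?D T \<omega> > e}) \<longlonglongrightarrow> 0"
  proof (rule Lim_null_comparison[OF _ lln[OF e'(1)]])
    show "\<forall>\<^sub>F T in sequentially. norm (measure P {\<omega>\<in>space P. ?D T \<omega> > e}) \<le> measure P (?E T)"
      using ev eventually_gt_at_top[of 0]
    proof eventually_elim
      case (elim T)
      have "{\<omega>\<in>space P. ?D T \<omega> > e} \<subseteq> ?E T"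
      proof safe
        fix \<omega> assume w: "\<omega> \<in> space P" "?D T \<omega> > e"
        show "\<exists>r\<in>{0..1}. norm ((1 / real T) *\<^sub>R (\<Sum>t\<in>{1..nat \<lfloor>real T * r\<rfloor>}. \<zeta> t \<omega>) - r *\<^sub>R Q) > e'"
        proof (rule ccontr)
          assume "\<not> ?thesis"
          then have "norm ((1 / real T) *\<^sub>R (\<Sum>t\<in>{1..T}. f (real t / real T) *\<^sub>R \<zeta> t \<omega>) - ?c T *\<^sub>R Q) \<le> C * e'"
            unfolding C_def using e'(1) elim(2) by (intro weighted_sum_bound F B) (auto simp: not_less)
          then have "dist (?c T *\<^sub>R Q) ((1 / real T) *\<^sub>R (\<Sum>t\<in>{1..T}. f (real t / real T) *\<^sub>R \<zeta> t \<omega>)) \<le> e / 2"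
            using e'(2) by (simp add: dist_norm norm_minus_commute)
          then show False using w(2) elim(1) dist_triangle[of "integral {0..1} f *\<^sub>R Q" "(1 / real T) *\<^sub>R (\<Sum>t\<in>{1..T}. f (real t / real T) *\<^sub>R \<zeta> t \<omega>)" "?c T *\<^sub>R Q"] by linarith
        qed
      qed
      then have "measure P {\<omega>\<in>space P. ?D T \<omega> > e} \<le> measure P (?E T)"
        by (intro finite_measure_mono uniform_lln_event \<zeta>)
      then show ?case by simp
    qed
  qed
qed auto

text \<open>A single realisation close to Q is enough to pass closed deterministic properties, such
  as symmetry and positive semidefiniteness of Gram matrices, on to Q.\<close>

lemma lln_approximable:
  fixes \<zeta> :: "nat \<Rightarrow> 'a \<Rightarrow> 'v::euclidean_space"
  assumes P: "prob_space P" and \<zeta>: "\<And>t. \<zeta> t \<in> borel_measurable P"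
    and lln: "\<And>e. e > 0 \<Longrightarrow> (\<lambda>T. measure P {\<omega>\<in>space P. \<exists>r\<in>{0..1}.
       norm ((1 / real T) *\<^sub>R (\<Sum>t\<in>{1..nat \<lfloor>real T * r\<rfloor>}. \<zeta> t \<omega>) - r *\<^sub>R Q) > e}) \<longlonglongrightarrow> 0"
    and e: "e > 0"
  obtains T \<omega> where "norm ((1 / real T) *\<^sub>R (\<Sum>t\<in>{1..T}. \<zeta> t \<omega>) - Q) \<le> e"
proof -
  interpret prob_space P by fact
  let ?E = "\<lambda>T. {\<omega>\<in>space P. \<exists>r\<in>{0..1}. norm ((1 / real T) *\<^sub>R (\<Sum>t\<in>{1..nat \<lfloor>real T * r\<rfloor>}. \<zeta> t \<omega>) - r *\<^sub>R Q) > e}"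
  have "\<forall>\<^sub>F T in sequentially. measure P (?E T) < 1" using order_tendstoD(2)[OF lln[OF e], of 1] by simp
  then obtain T where "measure P (?E T) < 1" using eventually_happens'[OF sequentially_bot] by blast
  then have "?E T \<noteq> space P" using prob_space by fastforce
  then obtain \<omega> where "\<omega> \<in> space P" "\<omega> \<notin> ?E T" by blast
  then have "norm ((1 / real T) *\<^sub>R (\<Sum>t\<in>{1..nat \<lfloor>real T * 1\<rfloor>}. \<zeta> t \<omega>) - 1 *\<^sub>R Q) \<le> e"
    by (metis (mono_tags, lifting) atLeastAtMost_iff mem_Collect_eq not_less order_refl zero_le_one)
  then show ?thesis using that by simp
qed

section \<open>Matrices\<close>

text \<open>The simplifier would otherwise rewrite \<open>transpose A *v x\<close> to a
  vector-matrix product; the computations below keep the transpose as a matrix factor.\<close>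

declare transpose_matrix_vector [simp del]

lemma continuous_on_det [continuous_intros]:
  fixes f :: "'a::topological_space \<Rightarrow> real^'n^'n"
  assumes "continuous_on S f"
  shows "continuous_on S (\<lambda>x. det (f x))"
  unfolding det_def using assms by (intro continuous_intros) auto

lemma invertible_matrix_inv:
  fixes A :: "real^'n^'n"
  assumes "invertible A"
  shows "A ** matrix_inv A = mat 1" "matrix_inv A ** A = mat 1"
proof -
  have "\<exists>A'. A ** A' = mat 1 \<and> A' ** A = mat 1" using assms by (simp add: invertible_def)
  from someI_ex[OF this] show "A ** matrix_inv A = mat 1" "matrix_inv A ** A = mat 1"
    by (auto simp: matrix_inv_def)
qed

lemma matrix_inv_uniqueI:
  fixes A B :: "real^'n^'n"
  assumes "A ** B = mat 1"
  shows "matrix_inv A = B"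
proof -
  have "invertible A" using assms by (auto simp: invertible_right_inverse)
  then have "matrix_inv A ** (A ** B) = B" by (simp add: matrix_mul_assoc invertible_matrix_inv)
  then show ?thesis using assms by simp
qed

lemma matrix_inv_scaleR:
  fixes A :: "real^'n^'n"
  assumes "invertible A" "c \<noteq> 0"
  shows "matrix_inv (c *\<^sub>R A) = (1 / c) *\<^sub>R matrix_inv A"
  by (rule matrix_inv_uniqueI)
    (use assms in \<open>simp add: scalar_matrix_assoc[symmetric] matrix_scalar_ac invertible_matrix_inv\<close>)

lemma transpose_matrix_inv_symmetric:
  fixes A :: "real^'n^'n"
  assumes "invertible A" "transpose A = A"
  shows "transpose (matrix_inv A) = matrix_inv A"
proof -
  have "transpose (matrix_inv A ** A) = mat 1" using assms(1) by (simp add: invertible_matrix_inv transpose_mat)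
  then have "A ** transpose (matrix_inv A) = mat 1" by (simp add: matrix_transpose_mul assms(2))
  then show ?thesis using matrix_inv_uniqueI by metis
qed

text \<open>On singular matrices the defining choice is over the empty predicate, hence the junk value
  is the same for all of them.\<close>
lemma matrix_inv_singular:
  fixes A :: "real^'n^'n"
  assumes "\<not> invertible A"
  shows "matrix_inv A = (SOME A'. False)"
  using assms unfolding matrix_inv_def invertible_def by (metis (mono_tags, lifting))

text \<open>Cramer's rule: the entries are quotients of determinants, from which the continuity of
  inversion is read off.\<close>

lemma matrix_inv_component:
  fixes A :: "real^'n^'n"
  assumes "invertible A"
  shows "matrix_inv A $ i $ j = det (\<chi> r c. if c = i then axis j 1 $ r else A $ r $ c) / det A"
proof -
  have "A *v (matrix_inv A *v axis j 1) = axis j 1"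
    using assms by (simp add: matrix_vector_mul_assoc invertible_matrix_inv)
  then have "matrix_inv A *v axis j 1 = (\<chi> k. det (\<chi> r c. if c = k then axis j 1 $ r else A $ r $ c) / det A)"
    using cramer[of A "matrix_inv A *v axis j 1" "axis j 1"] assms invertible_det_nz by blast
  then have "(matrix_inv A *v axis j 1) $ i = det (\<chi> r c. if c = i then axis j 1 $ r else A $ r $ c) / det A"
    by simp
  then show ?thesis by (simp add: matrix_vector_mult_basis column_def)
qed

lemma continuous_on_matrix_inv [continuous_intros]:
  fixes f :: "'a::topological_space \<Rightarrow> real^'n^'n"
  assumes f: "continuous_on S f" and inv: "\<And>x. x \<in> S \<Longrightarrow> invertible (f x)"
  shows "continuous_on S (\<lambda>x. matrix_inv (f x))"
proof -
  have "continuous_on S (\<lambda>x. \<chi> i j. det (\<chi> r c. if c = i then axis j 1 $ r else f x $ r $ c) / det (f x))"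
  proof (intro continuous_on_vec_lambda continuous_on_divide continuous_on_det f)
    show "continuous_on S (\<lambda>x. if c = i then axis j 1 $ r else f x $ r $ c)" for i j r c
      using f by (cases "c = i") (auto intro!: continuous_intros)
    show "\<forall>x\<in>S. det (f x) \<noteq> 0" using inv by (simp add: invertible_det_nz)
  qed
  then show ?thesis
    by (rule continuous_on_eq) (simp add: vec_eq_iff matrix_inv_component inv)
qed

lemma continuous_on_matrix_mult [continuous_intros]:
  fixes f :: "'a::topological_space \<Rightarrow> real^'n^'m" and g :: "'a \<Rightarrow> real^'k^'n"
  assumes "continuous_on S f" "continuous_on S g"
  shows "continuous_on S (\<lambda>x. f x ** g x)"
  unfolding matrix_matrix_mult_def using assms by (intro continuous_intros continuous_on_vec_lambda)

lemma continuous_on_matrix_vector_mult [continuous_intros]: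
  fixes f :: "'a::topological_space \<Rightarrow> real^'n^'m" and g :: "'a \<Rightarrow> real^'n"
  assumes "continuous_on S f" "continuous_on S g"
  shows "continuous_on S (\<lambda>x. f x *v g x)"
  unfolding matrix_vector_mult_def using assms by (intro continuous_intros continuous_on_vec_lambda)

lemma continuous_on_transpose [continuous_intros]:
  fixes f :: "'a::topological_space \<Rightarrow> real^'n^'m"
  assumes "continuous_on S f"
  shows "continuous_on S (\<lambda>x. transpose (f x))"
  unfolding transpose_def using assms by (intro continuous_intros continuous_on_vec_lambda)

lemma continuous_on_outer [continuous_intros]:
  fixes f :: "'a::topological_space \<Rightarrow> real^'n" and g :: "'a \<Rightarrow> real^'m"
  assumes "continuous_on S f" "continuous_on S g"
  shows "continuous_on S (\<lambda>x. outer (f x) (g x))"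
  unfolding outer_def using assms by (intro continuous_intros continuous_on_vec_lambda)

lemma open_invertible: "open {A :: real^'n^'n. invertible A}"
  unfolding invertible_det_nz by (intro open_Collect_neq continuous_intros)

text \<open>Inversion is continuous on the open set of invertible matrices and constant off
  it.\<close>

lemma borel_measurable_matrix_inv [measurable (raw)]:
  fixes f :: "'a \<Rightarrow> real^'n^'n"
  assumes "f \<in> borel_measurable M"
  shows "(\<lambda>x. matrix_inv (f x)) \<in> borel_measurable M"
proof -
  have "(\<lambda>A::real^'n^'n. if A \<in> {A. invertible A} then matrix_inv A else (SOME A'. False)) \<in> borel_measurable borel"
    by (rule borel_measurable_continuous_on_if)
      (auto intro!: continuous_intros borel_open open_invertible)
  also have "(\<lambda>A::real^'n^'n. if A \<in> {A. invertible A} then matrix_inv A else (SOME A'. False)) = matrix_inv"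
    by (auto simp: matrix_inv_singular)
  finally show ?thesis using assms by measurable
qed

lemma borel_measurable_matrix_mult [measurable (raw)]:
  fixes f :: "'a \<Rightarrow> real^'n^'m" and g :: "'a \<Rightarrow> real^'k^'n"
  assumes [measurable]: "f \<in> borel_measurable M" "g \<in> borel_measurable M"
  shows "(\<lambda>x. f x ** g x) \<in> borel_measurable M"
  unfolding matrix_matrix_mult_def by measurable

lemma borel_measurable_matrix_vector_mult [measurable (raw)]:
  fixes f :: "'a \<Rightarrow> real^'n^'m" and g :: "'a \<Rightarrow> real^'n"
  assumes [measurable]: "f \<in> borel_measurable M" "g \<in> borel_measurable M"
  shows "(\<lambda>x. f x *v g x) \<in> borel_measurable M"
  unfolding matrix_vector_mult_def by measurable

lemma borel_measurable_outer [measurable (raw)]: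
  fixes f :: "'a \<Rightarrow> real^'n" and g :: "'a \<Rightarrow> real^'m"
  assumes [measurable]: "f \<in> borel_measurable M" "g \<in> borel_measurable M"
  shows "(\<lambda>x. outer (f x) (g x)) \<in> borel_measurable M"
  unfolding outer_def by measurable

lemma outer_matrix_left: "outer (A *v x) y = A ** outer x y"
  by (simp add: vec_eq_iff outer_def matrix_matrix_mult_def matrix_vector_mult_def sum_distrib_right mult.assoc)

lemma outer_matrix_right: "outer x (A *v y) = outer x y ** transpose A"
  by (simp add: vec_eq_iff outer_def matrix_matrix_mult_def matrix_vector_mult_def transpose_def sum_distrib_left mult_ac)

lemma outer_diff_left: "outer (x - x') y = outer x y - outer x' y"
  and outer_diff_right: "outer x (y - y') = outer x y - outer x y'"
  by (simp_all add: vec_eq_iff outer_def algebra_simps)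

lemma outer_mult_vec: "outer x y *v v = (y \<bullet> v) *\<^sub>R x"
  by (simp add: vec_eq_iff outer_def matrix_vector_mult_def inner_vec_def sum_distrib_right sum_distrib_left mult_ac)

lemma transpose_outer: "transpose (outer x y) = outer y x"
  by (simp add: vec_eq_iff outer_def transpose_def mult.commute)

lemma transpose_sum: "transpose (\<Sum>i\<in>I. f i) = (\<Sum>i\<in>I. transpose (f i))"
  by (simp add: vec_eq_iff transpose_def)

lemma transpose_scaleR_matrix: "transpose (c *\<^sub>R A) = c *\<^sub>R transpose (A :: real^'n^'m)"
  by (simp add: vec_eq_iff transpose_def)

lemma matrix_mult_sum_right: "(A :: real^'n^'m) ** (\<Sum>i\<in>I. f i) = (\<Sum>i\<in>I. A ** (f i :: real^'k^'n))"
proof (cases "finite I")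
  case True then show ?thesis by (induction I) (simp_all add: matrix_add_ldistrib)
qed simp

lemma matrix_mult_sum_left: "(\<Sum>i\<in>I. f i) ** (A :: real^'k^'n) = (\<Sum>i\<in>I. (f i :: real^'n^'m) ** A)"
proof (cases "finite I")
  case True then show ?thesis
    by (induction I) (simp_all add: vec_eq_iff matrix_matrix_mult_def sum.distrib distrib_right)
qed simp

lemma matrix_vector_mult_sum_left: "(\<Sum>i\<in>I. f i) *v v = (\<Sum>i\<in>I. (f i :: real^'n^'m) *v v)"
proof (cases "finite I")
  case True then show ?thesis by (induction I) (simp_all add: matrix_vector_mult_add_rdistrib)
qed simp

lemma matrix_vector_mult_sum_right: "(A :: real^'n^'m) *v (\<Sum>i\<in>I. f i) = (\<Sum>i\<in>I. A *v f i)"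
  by (rule linear_sum[OF matrix_vector_mul_linear])

lemma matrix_mult_scaleR_left: "(c *\<^sub>R (A :: real^'n^'m)) ** (B :: real^'k^'n) = c *\<^sub>R (A ** B)"
  by (simp add: vec_eq_iff matrix_matrix_mult_def sum_distrib_left mult_ac)

lemma matrix_mult_scaleR_right: "(A :: real^'n^'m) ** (c *\<^sub>R (B :: real^'k^'n)) = c *\<^sub>R (A ** B)"
  by (simp add: vec_eq_iff matrix_matrix_mult_def sum_distrib_left mult_ac)

lemma matrix_scaleR_vector: "(c *\<^sub>R (A :: real^'n^'m)) *v v = c *\<^sub>R (A *v v)"
  by (simp add: vec_eq_iff matrix_vector_mult_def sum_distrib_left mult_ac)

lemma matrix_vector_scaleR: "(A :: real^'n^'m) *v (c *\<^sub>R v) = c *\<^sub>R (A *v v)"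
  by (simp add: vec_eq_iff matrix_vector_mult_def sum_distrib_left mult_ac)

lemma matrix_mult_diff_left: "((A :: real^'n^'m) - B) ** (C :: real^'k^'n) = A ** C - B ** C"
  by (simp add: vec_eq_iff matrix_matrix_mult_def left_diff_distrib sum_subtractf)

lemma matrix_mult_diff_right: "(A :: real^'n^'m) ** ((B :: real^'k^'n) - C) = A ** B - A ** C"
  by (simp add: vec_eq_iff matrix_matrix_mult_def right_diff_distrib sum_subtractf)

section \<open>Finite-sample algebra\<close>

definition mZZ :: "real^('m::finite + 'l::finite)^('m + 'l) \<Rightarrow> real^'l^'l" where
  "mZZ Q = (\<chi> i j. Q $ Inr i $ Inr j)"

definition mXZ :: "real^('m::finite + 'l::finite)^('m + 'l) \<Rightarrow> real^'l^'m" where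
  "mXZ Q = (\<chi> i j. Q $ Inl i $ Inr j)"

definition pX :: "real^('m::finite + 'l::finite) \<Rightarrow> real^'m" where
  "pX v = (\<chi> i. v $ Inl i)"

definition pZ :: "real^('m::finite + 'l::finite) \<Rightarrow> real^'l" where
  "pZ v = (\<chi> i. v $ Inr i)"

definition wgt :: "('k \<Rightarrow> real \<Rightarrow> real) \<Rightarrow> 'k option \<Rightarrow> real \<Rightarrow> real" where
  "wgt \<phi> k r = (case k of None \<Rightarrow> 1 | Some j \<Rightarrow> \<phi> j r)"

text \<open>The Boolean index selects the regime before (True) or after (False) the break.\<close>
definition rwgt :: "('k \<Rightarrow> real \<Rightarrow> real) \<Rightarrow> real \<Rightarrow> 'k option \<times> bool \<Rightarrow> real \<Rightarrow> real" where
  "rwgt \<phi> lam i r = wgt \<phi> (fst i) r * (if r \<le> lam then (if snd i then 1 else 0) else (if snd i then 0 else 1))"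

text \<open>The prefix s marks sample blocks of the weighted moments and scores, the prefix c the same
  blocks after Z has been partialled out; at the sample values cq is \<open>\<surd>T (\<beta>^ - \<beta>)\<close> and cv the
  summand of the long run variance estimator.\<close>

type_synonym ('n, 'k) moments = "((real^'n)^'n)^('k option \<times> bool)"
type_synonym ('n, 'k) scores = "(real^'n)^('k option \<times> bool)"

definition sZZ :: "('m::finite + 'l::finite, 'k::finite) moments \<Rightarrow> 'k option \<Rightarrow> real^'l^'l" where
  "sZZ A k = mZZ (A $ (k, True)) + mZZ (A $ (k, False))"

definition sXZ :: "('m::finite + 'l::finite, 'k::finite) moments \<Rightarrow> 'k option \<Rightarrow> real^'l^('m + 'm)" where
  "sXZ A k = (\<chi> r. case r of Inl i \<Rightarrow> mXZ (A $ (k, True)) $ i | Inr i \<Rightarrow> mXZ (A $ (k, False)) $ i)"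

text \<open>The off-diagonal blocks vanish because no period belongs to both regimes.\<close>

definition sXX :: "('m::finite + 'l::finite, 'k::finite) moments \<Rightarrow> 'k option \<Rightarrow> real^('m + 'm)^('m + 'm)" where
  "sXX A k = (\<chi> r c. case r of
      Inl i \<Rightarrow> (case c of Inl j \<Rightarrow> QXX (A $ (k, True)) $ i $ j | Inr j \<Rightarrow> 0)
    | Inr i \<Rightarrow> (case c of Inl j \<Rightarrow> 0 | Inr j \<Rightarrow> QXX (A $ (k, False)) $ i $ j))"

definition sXu :: "('m::finite + 'l::finite, 'k::finite) scores \<Rightarrow> 'k option \<Rightarrow> real^('m + 'm)" where
  "sXu s k = stack (pX (s $ (k, True))) (pX (s $ (k, False)))"

definition sZu :: "('m::finite + 'l::finite, 'k::finite) scores \<Rightarrow> 'k option \<Rightarrow> real^'l" where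
  "sZu s k = pZ (s $ (k, True)) + pZ (s $ (k, False))"

text \<open>Coefficient matrix of the projection of the regime regressors on Z; the factors 1/T of
  the two moments cancel.\<close>

definition cD :: "('m::finite + 'l::finite, 'k::finite) moments \<Rightarrow> real^'l^('m + 'm)" where
  "cD A = sXZ A None ** matrix_inv (sZZ A None)"

definition cXZ :: "('m::finite + 'l::finite, 'k::finite) moments \<Rightarrow> 'k option \<Rightarrow> real^'l^('m + 'm)" where
  "cXZ A k = sXZ A k - cD A ** sZZ A k"

text \<open>Expansion of the k-weighted moment of x - D z. The projection D is always the unweighted
  one, so for k = \<open>Some j\<close> the mixed terms do not collapse to a Schur
  complement.\<close>

definition cXX :: "('m::finite + 'l::finite, 'k::finite) moments \<Rightarrow> 'k option \<Rightarrow> real^('m + 'm)^('m + 'm)" where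
  "cXX A k = sXX A k - sXZ A k ** transpose (cD A) - cD A ** transpose (sXZ A k)
     + cD A ** sZZ A k ** transpose (cD A)"

definition cXu :: "('m::finite + 'l::finite, 'k::finite) moments \<Rightarrow> ('m + 'l, 'k) scores \<Rightarrow> 'k option \<Rightarrow> real^('m + 'm)" where
  "cXu A s k = sXu s k - cD A *v sZu s k"

definition cq :: "('m::finite + 'l::finite, 'k::finite) moments \<Rightarrow> ('m + 'l, 'k) scores \<Rightarrow> real^('m + 'm)" where
  "cq A s = matrix_inv (cXX A None) *v cXu A s None"

definition cv :: "('m::finite + 'l::finite, 'k::finite) moments \<Rightarrow> ('m + 'l, 'k) scores \<Rightarrow> 'k \<Rightarrow> real^('m + 'm)" where
  "cv A s j = cXu A s (Some j) - cXZ A (Some j) *v (matrix_inv (sZZ A None) *v sZu s None)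
     - cXX A (Some j) *v cq A s"

lemma sum_UNIV_sum: "(\<Sum>k\<in>UNIV. f k) = (\<Sum>i\<in>UNIV. f (Inl i)) + (\<Sum>i\<in>UNIV. f (Inr i))"
  for f :: "'a::finite + 'b::finite \<Rightarrow> 'c::comm_monoid_add"
  by (simp add: UNIV_Plus_UNIV[symmetric] sum.Plus del: UNIV_Plus_UNIV)

text \<open>Since t is an integer, t/T \<le> lam means the same as t \<le> [lam T]: at the sample
  points the limiting regime weights reproduce the break exactly, without a rounding error.\<close>

lemma rwgt_grid:
  assumes "T > 0" "0 < lam"
  shows "rwgt \<phi> lam (k, b) (real t / real T) = wgt \<phi> k (real t / real T) * (if (t \<le> brk lam T) = b then 1 else 0)"
proof -
  have "real t / real T \<le> lam \<longleftrightarrow> real t \<le> lam * real T" using assms by (simp add: field_simps)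
  also have "\<dots> \<longleftrightarrow> t \<le> brk lam T" using assms unfolding brk_def by (simp add: le_nat_floor le_floor_iff nat_le_iff le_nat_iff)
  finally show ?thesis by (auto simp: rwgt_def)
qed

lemma wgt_simps [simp]: "wgt \<phi> None r = 1" "wgt \<phi> (Some j) r = \<phi> j r"
  by (auto simp: wgt_def)

text \<open>One realisation and one sample size are frozen, so that the finite-sample identities are
  pure algebra; A and s are the weighted moments and scores of this sample.\<close>

locale sample =
  fixes lam :: real and T :: nat
    and xs :: "nat \<Rightarrow> real^'m" and zs :: "nat \<Rightarrow> real^'l" and us :: "nat \<Rightarrow> real"
    and b1 b2 :: "real^'m" and g :: "real^'l"
    and \<phi> :: "'k::finite \<Rightarrow> real \<Rightarrow> real"
    and A :: "('m + 'l, 'k) moments" and s :: "('m + 'l, 'k) scores"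
  assumes T: "T > 0" and lam: "0 < lam"
    and A: "\<And>i. A $ i = (1 / real T) *\<^sub>R (\<Sum>t\<in>{1..T}. rwgt \<phi> lam i (real t / real T) *\<^sub>R outer (join (xs t) (zs t)) (join (xs t) (zs t)))"
    and s: "\<And>i. s $ i = (1 / sqrt (real T)) *\<^sub>R (\<Sum>t\<in>{1..T}. (rwgt \<phi> lam i (real t / real T) * us t) *\<^sub>R join (xs t) (zs t))"
begin

abbreviation w where "w k t \<equiv> wgt \<phi> k (real t / real T)"
abbreviation xt where "xt t \<equiv> Xtil lam T (xs t) t"
abbreviation xz where "xz t \<equiv> Xz lam T xs zs t"
abbreviation ys where "ys \<equiv> Ymod lam T b1 b2 g xs zs us"
abbreviation \<beta> where "\<beta> \<equiv> stack b1 b2"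

lemma sZZ_sample: "sZZ A k = (1 / real T) *\<^sub>R (\<Sum>t\<in>{1..T}. w k t *\<^sub>R outer (zs t) (zs t))"
  by (simp add: vec_eq_iff sZZ_def mZZ_def A rwgt_grid[OF T lam] outer_def join_def
      sum_distrib_left sum.distrib[symmetric] if_distrib cong: if_cong) (auto intro!: sum.cong)

lemma sXZ_sample: "sXZ A k = (1 / real T) *\<^sub>R (\<Sum>t\<in>{1..T}. w k t *\<^sub>R outer (xt t) (zs t))"
  by (auto simp: vec_eq_iff sXZ_def mXZ_def A rwgt_grid[OF T lam] outer_def join_def Xtil_def
      split: sum.splits intro!: arg_cong[where f="\<lambda>x. x / real T"] sum.cong)

lemma sXX_sample: "sXX A k = (1 / real T) *\<^sub>R (\<Sum>t\<in>{1..T}. w k t *\<^sub>R outer (xt t) (xt t))"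
  by (auto simp: vec_eq_iff sXX_def QXX_def A rwgt_grid[OF T lam] outer_def join_def Xtil_def
      split: sum.splits intro!: arg_cong[where f="\<lambda>x. x / real T"] sum.cong sum.neutral)

lemma sXu_sample: "sXu s k = (1 / sqrt (real T)) *\<^sub>R (\<Sum>t\<in>{1..T}. (w k t * us t) *\<^sub>R xt t)"
  by (auto simp: vec_eq_iff sXu_def stack_def pX_def s rwgt_grid[OF T lam] join_def Xtil_def
      split: sum.splits intro!: arg_cong[where f="\<lambda>x. x / sqrt (real T)"] sum.cong)

lemma sZu_sample: "sZu s k = (1 / sqrt (real T)) *\<^sub>R (\<Sum>t\<in>{1..T}. (w k t * us t) *\<^sub>R zs t)"
  by (simp add: vec_eq_iff sZu_def pZ_def s rwgt_grid[OF T lam] join_def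
      add_divide_distrib[symmetric] sum.distrib[symmetric]) (auto intro!: arg_cong[where f="\<lambda>x. x / sqrt (real T)"] sum.cong)

lemma Szz_sample: "Szz T zs = real T *\<^sub>R sZZ A None"
  using T by (simp add: sZZ_sample Szz_def)

lemma Xz_sample:
  assumes "invertible (sZZ A None)"
  shows "xz t = xt t - cD A *v zs t"
proof -
  have "(\<Sum>t\<in>{1..T}. outer (xt t) (zs t)) = real T *\<^sub>R sXZ A None" using T by (simp add: sXZ_sample)
  then have "(\<Sum>t\<in>{1..T}. outer (xt t) (zs t)) ** matrix_inv (Szz T zs) = cD A"
    using T assms by (simp add: Szz_sample matrix_inv_scaleR cD_def matrix_mult_scaleR_left matrix_mult_scaleR_right)
  then show ?thesis by (simp add: Xz_def)
qed

lemma cXZ_sample: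
  assumes "invertible (sZZ A None)"
  shows "(\<Sum>t\<in>{1..T}. w k t *\<^sub>R outer (xz t) (zs t)) = real T *\<^sub>R cXZ A k"
  using T by (simp add: cXZ_def sXZ_sample sZZ_sample Xz_sample[OF assms] outer_diff_left outer_matrix_left
      scaleR_diff_right sum_subtractf matrix_mult_scaleR_right matrix_mult_sum_right)

lemma cXX_sample:
  assumes "invertible (sZZ A None)"
  shows "(\<Sum>t\<in>{1..T}. w k t *\<^sub>R outer (xz t) (xz t)) = real T *\<^sub>R cXX A k"
  using T by (simp add: cXX_def sXX_sample sXZ_sample sZZ_sample Xz_sample[OF assms] outer_diff_left outer_diff_right
      outer_matrix_left outer_matrix_right scaleR_diff_right scaleR_add_right sum_subtractf sum.distrib
      matrix_mult_diff_left matrix_mult_diff_right matrix_mult_scaleR_right matrix_mult_scaleR_left matrix_mult_sum_right matrix_mult_sum_left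
      transpose_sum transpose_scaleR_matrix transpose_outer matrix_mul_assoc)

lemma cXu_sample:
  assumes "invertible (sZZ A None)"
  shows "(\<Sum>t\<in>{1..T}. (w k t * us t) *\<^sub>R xz t) = sqrt (real T) *\<^sub>R cXu A s k"
  using T by (simp add: cXu_def sXu_sample sZu_sample Xz_sample[OF assms] scaleR_diff_right sum_subtractf
      matrix_vector_scaleR matrix_vector_mult_sum_right)

lemma SXX_sample:
  assumes "invertible (sZZ A None)"
  shows "SXX lam T xs zs = real T *\<^sub>R cXX A None" "Qhat lam T xs zs = cXX A None"
  using cXX_sample[OF assms, of None] T by (auto simp: SXX_def Qhat_def)

lemma Ymod_alt: "ys t = xt t \<bullet> \<beta> + zs t \<bullet> g + us t"
proof -
  have "xt t \<bullet> \<beta> = (\<Sum>i\<in>UNIV. xt t $ Inl i * b1 $ i) + (\<Sum>i\<in>UNIV. xt t $ Inr i * b2 $ i)"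
    by (simp add: inner_vec_def stack_def sum_UNIV_sum)
  also have "\<dots> = (if t \<le> brk lam T then xs t \<bullet> b1 else 0) + (if t \<ge> brk lam T + 1 then xs t \<bullet> b2 else 0)"
    by (auto simp: Xtil_def inner_vec_def)
  finally show ?thesis by (simp add: Ymod_def)
qed

lemma orthogonality:
  assumes "invertible (sZZ A None)"
  shows "(\<Sum>t\<in>{1..T}. outer (xz t) (zs t)) = 0"
proof -
  have "cXZ A None = 0"
    using assms by (simp add: cXZ_def cD_def matrix_mul_assoc[symmetric] invertible_matrix_inv)
  then show ?thesis using cXZ_sample[OF assms, of None] by simp
qed

text \<open>The partialled regressors are orthogonal to Z. Hence their cross moment with the raw
  regressors equals \<open>SXX\<close>, and the coefficient g drops out of the normal
  equations.\<close>

lemma bhat_sample: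
  assumes i1: "invertible (sZZ A None)" and i2: "invertible (cXX A None)"
  shows "sqrt (real T) *\<^sub>R (bhat lam T xs zs ys - \<beta>) = cq A s"
proof -
  have "(\<Sum>t\<in>{1..T}. outer (xz t) (xt t)) = SXX lam T xs zs + (\<Sum>t\<in>{1..T}. outer (xz t) (zs t)) ** transpose (cD A)"
  proof -
    have "outer (xz t) (xz t) = outer (xz t) (xt t) - outer (xz t) (cD A *v zs t)" for t
      by (subst (2) Xz_sample[OF i1]) (rule outer_diff_right)
    then have "outer (xz t) (xt t) = outer (xz t) (xz t) + outer (xz t) (zs t) ** transpose (cD A)" for t
      by (simp add: outer_matrix_right algebra_simps)
    then show ?thesis by (simp add: SXX_def sum.distrib matrix_mult_sum_left)
  qed
  then have o: "(\<Sum>t\<in>{1..T}. outer (xz t) (xt t)) = SXX lam T xs zs" using orthogonality[OF i1] by simp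
  have "(\<Sum>t\<in>{1..T}. ys t *\<^sub>R xz t) = (\<Sum>t\<in>{1..T}. outer (xz t) (xt t)) *v \<beta> + (\<Sum>t\<in>{1..T}. outer (xz t) (zs t)) *v g + (\<Sum>t\<in>{1..T}. us t *\<^sub>R xz t)"
    by (simp add: Ymod_alt matrix_vector_mult_sum_left outer_mult_vec scaleR_add_left sum.distrib)
  also have "\<dots> = SXX lam T xs zs *v \<beta> + sqrt (real T) *\<^sub>R cXu A s None"
    using o orthogonality[OF i1] cXu_sample[OF i1, of None] by simp
  finally have "bhat lam T xs zs ys = matrix_inv (SXX lam T xs zs) *v (SXX lam T xs zs *v \<beta> + sqrt (real T) *\<^sub>R cXu A s None)"
    by (simp add: bhat_def)
  also have "\<dots> = \<beta> + (sqrt (real T) / real T) *\<^sub>R cq A s"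
    using T i2 unfolding SXX_sample(1)[OF i1]
    by (simp add: matrix_inv_scaleR matrix_vector_right_distrib matrix_vector_scaleR matrix_scaleR_vector
        matrix_vector_mul_assoc matrix_mult_scaleR_left invertible_matrix_inv cq_def)
  finally show ?thesis using T by (simp add: real_div_sqrt)
qed

text \<open>Partialling out Z removes the term with g and turns the regressors into
  \<open>Xz\<close>; what is left is u minus its own projection on Z.\<close>

lemma Yz_sample:
  assumes i1: "invertible (sZZ A None)"
  shows "Yz T zs ys t = xz t \<bullet> \<beta> + us t - zs t \<bullet> ((1 / sqrt (real T)) *\<^sub>R (matrix_inv (sZZ A None) *v sZu s None))"
proof -
  let ?S = "Szz T zs"
  have iS: "invertible ?S"
    using i1 T matrix_inv_scaleR[OF i1, of "real T"]
    by (auto simp: Szz_sample invertible_def matrix_mult_scaleR_left matrix_mult_scaleR_right intro!: exI[of _ "(1 / real T) *\<^sub>R matrix_inv (sZZ A None)"] simp: invertible_matrix_inv[OF i1])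
  have sym: "transpose ?S = ?S" by (simp add: Szz_def transpose_sum transpose_outer)
  have D: "cD A = (\<Sum>t\<in>{1..T}. outer (xt t) (zs t)) ** matrix_inv ?S"
  proof -
    have "(\<Sum>t\<in>{1..T}. outer (xt t) (zs t)) = real T *\<^sub>R sXZ A None" using T by (simp add: sXZ_sample)
    then show ?thesis
      using T i1 by (simp add: Szz_sample matrix_inv_scaleR cD_def matrix_mult_scaleR_left matrix_mult_scaleR_right)
  qed
  have "(\<Sum>t\<in>{1..T}. ys t *\<^sub>R zs t) = (\<Sum>t\<in>{1..T}. outer (zs t) (xt t)) *v \<beta> + ?S *v g + (\<Sum>t\<in>{1..T}. us t *\<^sub>R zs t)"
    by (simp add: Ymod_alt Szz_def matrix_vector_mult_sum_left outer_mult_vec scaleR_add_left sum.distrib)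
  also have "(\<Sum>t\<in>{1..T}. us t *\<^sub>R zs t) = sqrt (real T) *\<^sub>R sZu s None" using T by (simp add: sZu_sample)
  finally have "matrix_inv ?S *v (\<Sum>t\<in>{1..T}. ys t *\<^sub>R zs t)
     = matrix_inv ?S *v ((\<Sum>t\<in>{1..T}. outer (zs t) (xt t)) *v \<beta>) + g + matrix_inv ?S *v (sqrt (real T) *\<^sub>R sZu s None)"
    by (simp add: matrix_vector_right_distrib matrix_vector_mul_assoc[of _ ?S] invertible_matrix_inv[OF iS])
  also have "matrix_inv ?S *v ((\<Sum>t\<in>{1..T}. outer (zs t) (xt t)) *v \<beta>) = transpose (cD A) *v \<beta>"
    by (simp add: D matrix_transpose_mul transpose_matrix_inv_symmetric[OF iS sym] transpose_sum transpose_outer matrix_vector_mul_assoc)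
  also have "matrix_inv ?S *v (sqrt (real T) *\<^sub>R sZu s None) = (sqrt (real T) / real T) *\<^sub>R (matrix_inv (sZZ A None) *v sZu s None)"
    using T i1 by (simp add: Szz_sample matrix_inv_scaleR matrix_scaleR_vector matrix_vector_scaleR)
  also have "sqrt (real T) / real T = 1 / sqrt (real T)" using T by (simp add: field_simps)
  finally have e: "matrix_inv ?S *v (\<Sum>t\<in>{1..T}. ys t *\<^sub>R zs t) = transpose (cD A) *v \<beta> + g + (1 / sqrt (real T)) *\<^sub>R (matrix_inv (sZZ A None) *v sZu s None)" .
  have "zs t \<bullet> (transpose (cD A) *v \<beta>) = (cD A *v zs t) \<bullet> \<beta>"
    by (metis dot_lmul_matrix inner_commute transpose_matrix_vector)
  then show ?thesis unfolding Yz_def e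
    unfolding Ymod_alt Xz_sample[OF i1] by (simp only: inner_add_right inner_diff_left)
qed

text \<open>The residual is u, minus its projection on Z, minus the effect of the estimation error
  of \<open>bhat\<close>; the three terms of \<open>cv\<close> are the weighted sums of these
  against \<open>Xz\<close>. The term with Z has to be kept, because the weights may destroy the
  orthogonality of \<open>Xz\<close> and Z.\<close>

lemma vj_sample:
  assumes i1: "invertible (sZZ A None)" and i2: "invertible (cXX A None)"
  shows "vj lam T xs zs ys (\<phi> j) = cv A s j"
proof -
  let ?h = "(1 / sqrt (real T)) *\<^sub>R (matrix_inv (sZZ A None) *v sZu s None)"
  let ?d = "bhat lam T xs zs ys - \<beta>"
  have u: "uhat lam T xs zs ys t = us t - zs t \<bullet> ?h - xz t \<bullet> ?d" for t
    by (simp add: uhat_def Yz_sample[OF i1] inner_diff_right)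
  have "(\<phi> j (real t / real T) * uhat lam T xs zs ys t) *\<^sub>R xz t
      = (w (Some j) t * us t) *\<^sub>R xz t - (w (Some j) t *\<^sub>R outer (xz t) (zs t)) *v ?h - (w (Some j) t *\<^sub>R outer (xz t) (xz t)) *v ?d" for t
    unfolding u matrix_scaleR_vector outer_mult_vec wgt_simps scaleR_scaleR by (simp only: scaleR_diff_left right_diff_distrib)
  then have "(\<Sum>t\<in>{1..T}. (\<phi> j (real t / real T) * uhat lam T xs zs ys t) *\<^sub>R xz t)
     = (\<Sum>t\<in>{1..T}. (w (Some j) t * us t) *\<^sub>R xz t) - (\<Sum>t\<in>{1..T}. w (Some j) t *\<^sub>R outer (xz t) (zs t)) *v ?h
       - (\<Sum>t\<in>{1..T}. w (Some j) t *\<^sub>R outer (xz t) (xz t)) *v ?d"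
    by (simp only: sum_subtractf matrix_vector_mult_sum_left)
  also have "\<dots> = sqrt (real T) *\<^sub>R cXu A s (Some j) - real T *\<^sub>R (cXZ A (Some j) *v ?h) - real T *\<^sub>R (cXX A (Some j) *v ?d)"
    unfolding cXu_sample[OF i1] cXZ_sample[OF i1] cXX_sample[OF i1] matrix_scaleR_vector ..
  also have "?d = (1 / sqrt (real T)) *\<^sub>R cq A s" unfolding bhat_sample[OF i1 i2, symmetric] using T by simp
  finally have "(\<Sum>t\<in>{1..T}. (\<phi> j (real t / real T) * uhat lam T xs zs ys t) *\<^sub>R xz t)
     = sqrt (real T) *\<^sub>R cv A s j"
    using T by (simp add: cv_def matrix_vector_scaleR real_div_sqrt scaleR_diff_right)
  then show ?thesis using T by (simp add: vj_def)
qed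

end

section \<open>The limit of the statistics\<close>

lemma stack_arith:
  "stack a b + stack c d = stack (a + c) (b + d)"
  "stack a b - stack c d = stack (a - c) (b - d)"
  "x *\<^sub>R stack a b = stack (x *\<^sub>R a) (x *\<^sub>R b)"
  by (auto simp: vec_eq_iff stack_def split: sum.splits)

lemma stack_eq_iff: "stack a b = stack c d \<longleftrightarrow> a = c \<and> b = d"
proof
  assume h: "stack a b = stack c d"
  have "stack a b $ Inl i = stack c d $ Inl i" "stack a b $ Inr i = stack c d $ Inr i" for i using h by auto
  then show "a = c \<and> b = d" by (simp add: stack_def vec_eq_iff)
qed simp

lemma stack_cases:
  obtains a b where "v = stack a b"
proof -
  have "v = stack (\<chi> i. v $ Inl i) (\<chi> i. v $ Inr i)" by (auto simp: vec_eq_iff stack_def split: sum.splits)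
  then show ?thesis using that by blast
qed

lemma Rmat_stack: "Rmat Rc *v stack a b = Rc *v (a - b)"
  by (simp add: vec_eq_iff matrix_vector_mult_def Rmat_def stack_def sum_UNIV_sum right_diff_distrib sum_subtractf sum_negf)

lemma pX_linear: "pX (a + b) = pX a + pX b" "pX (a - b) = pX a - pX b" "pX (x *\<^sub>R a) = x *\<^sub>R pX a"
  by (auto simp: pX_def vec_eq_iff)

lemma pX_matrix_vector: "pX (L *v v) = LamX L *v v"
  by (simp add: pX_def LamX_def vec_eq_iff matrix_vector_mult_def)

lemma symmetric_component:
  fixes Q :: "real^'n^'n"
  assumes "transpose Q = Q"
  shows "Q $ a $ b = Q $ b $ a"
proof -
  have "Q $ a $ b = transpose Q $ b $ a" by (simp add: transpose_def)
  then show ?thesis using assms by simp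
qed

lemma join_quadratic_form:
  fixes Q :: "real^('m::finite + 'l::finite)^('m + 'l)"
  shows "(Q *v join x z) $ Inl i = (QXX Q *v x) $ i + (mXZ Q *v z) $ i"
    and "transpose Q = Q \<Longrightarrow> (Q *v join x z) $ Inr j = (transpose (mXZ Q) *v x) $ j + (mZZ Q *v z) $ j"
proof -
  show "(Q *v join x z) $ Inl i = (QXX Q *v x) $ i + (mXZ Q *v z) $ i"
    by (simp add: matrix_vector_mult_def join_def sum_UNIV_sum QXX_def mXZ_def)
  assume "transpose Q = Q"
  then have "Q $ Inr j $ Inl i = Q $ Inl i $ Inr j" for i by (rule symmetric_component)
  then show "(Q *v join x z) $ Inr j = (transpose (mXZ Q) *v x) $ j + (mZZ Q *v z) $ j"
    by (simp add: matrix_vector_mult_def join_def sum_UNIV_sum mZZ_def mXZ_def transpose_def)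
qed

lemma invertibleI_injective:
  fixes A :: "real^'n^'n"
  assumes "\<And>v. A *v v = 0 \<Longrightarrow> v = 0"
  shows "invertible A"
  using assms by (simp add: invertible_left_inverse matrix_left_invertible_ker)

lemma invertible_injectiveD:
  fixes A :: "real^'n^'n"
  assumes "invertible A" "A *v v = 0"
  shows "v = 0"
  using assms by (metis invertible_left_inverse matrix_left_invertible_ker)

text \<open>If w = Q v were nonzero, moving from v slightly against w would make the form negative,
  because the first-order term 2c (w . w) dominates.\<close>

lemma psd_quadratic_form_zero:
  fixes Q :: "real^'n^'n"
  assumes sym: "transpose Q = Q" and psd: "\<And>v. v \<bullet> (Q *v v) \<ge> 0" and v: "v \<bullet> (Q *v v) = 0"
  shows "Q *v v = 0"
proof -
  let ?w = "Q *v v"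
  have s: "v \<bullet> (Q *v ?w) = ?w \<bullet> ?w" by (metis dot_lmul_matrix sym transpose_matrix_vector)
  have q: "(v + c *\<^sub>R ?w) \<bullet> (Q *v (v + c *\<^sub>R ?w)) = 2 * c * (?w \<bullet> ?w) + c\<^sup>2 * (?w \<bullet> (Q *v ?w))" for c
    using s v by (simp add: matrix_vector_right_distrib matrix_vector_scaleR inner_add_left inner_add_right power2_eq_square inner_commute algebra_simps)
  show ?thesis
  proof (rule ccontr)
    assume "?w \<noteq> 0"
    then have p: "?w \<bullet> ?w > 0" by simp
    let ?q = "?w \<bullet> (Q *v ?w)"
    have q0: "?q \<ge> 0" by (rule psd)
    \<comment> \<open>The step is so small that the quadratic term cancels at most half of the
      linear one; the + 1 admits a vanishing \<open>?q\<close>.\<close>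
    define c where "c = - (?w \<bullet> ?w) / (?q + 1)"
    have c: "c < 0" "c * ?q \<ge> - (?w \<bullet> ?w)"
      using p q0 by (auto simp: c_def field_simps)
    have "0 \<le> 2 * c * (?w \<bullet> ?w) + c\<^sup>2 * ?q" using psd[of "v + c *\<^sub>R ?w"] unfolding q .
    also have "\<dots> = c * (2 * (?w \<bullet> ?w) + c * ?q)" by (simp add: power2_eq_square algebra_simps)
    also have "\<dots> < 0" by (rule mult_neg_pos) (use c p in linarith)+
    finally show False by simp
  qed
qed

text \<open>A kernel vector of a diagonal block, padded by zeros, has zero quadratic form under Q
  and hence lies in the kernel of Q.\<close>

lemma psd_block_invertible:
  fixes Q :: "real^('m::finite + 'l::finite)^('m + 'l)"
  assumes sym: "transpose Q = Q" and psd: "\<And>v. v \<bullet> (Q *v v) \<ge> 0" and inv: "invertible Q"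
  shows "invertible (QXX Q)" "invertible (mZZ Q)"
proof -
  have d: "join x z \<bullet> y = (\<Sum>i\<in>UNIV. x $ i * y $ Inl i) + (\<Sum>i\<in>UNIV. z $ i * y $ Inr i)" for x :: "real^'m" and z :: "real^'l" and y
    by (simp add: inner_vec_def join_def sum_UNIV_sum)
  have j0: "x = 0 \<and> z = 0" if "join x z = 0" for x :: "real^'m" and z :: "real^'l"
  proof -
    have "join x z $ Inl i = 0" "join x z $ Inr j = 0" for i j using that by auto
    then show ?thesis by (simp add: join_def vec_eq_iff)
  qed
  have z: "join x z = 0" if "join x z \<bullet> (Q *v join x z) = 0" for x :: "real^'m" and z :: "real^'l"
    using psd_quadratic_form_zero[OF sym psd that] inv invertible_injectiveD by blast
  show "invertible (QXX Q)"
  proof (rule invertibleI_injective)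
    fix x assume x: "QXX Q *v x = 0"
    have "join x 0 \<bullet> (Q *v join x 0) = 0" unfolding d by (simp add: join_quadratic_form(1) x)
    then show "x = 0" using z[of x 0] j0[of x 0] by blast
  qed
  show "invertible (mZZ Q)"
  proof (rule invertibleI_injective)
    fix x assume x: "mZZ Q *v x = 0"
    have "join 0 x \<bullet> (Q *v join 0 x) = 0" unfolding d by (simp add: join_quadratic_form(2)[OF sym] x)
    then show "x = 0" using z[of 0 x] j0[of 0 x] by blast
  qed
qed

text \<open>In the limit every weighted moment is a multiple of the one matrix Q, and the two
  unweighted multiples are the lengths of the regimes.\<close>

locale limit_moments =
  fixes Q :: "real^('m::finite + 'l::finite)^('m + 'l)" and lam :: real
    and \<mu> :: "'k::finite option \<times> bool \<Rightarrow> real" and A :: "('m + 'l, 'k) moments"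
  assumes sym: "transpose Q = Q" and inv: "invertible Q"
    and invX: "invertible (QXX Q)" and invZ: "invertible (mZZ Q)"
    and lam: "0 < lam" "lam < 1"
    and A: "\<And>i. A $ i = \<mu> i *\<^sub>R Q"
    and \<mu>: "\<mu> (None, True) = lam" "\<mu> (None, False) = 1 - lam"
begin

abbreviation PX :: "real^'l^'m" where "PX \<equiv> mXZ Q ** matrix_inv (mZZ Q)"

lemma sZZ_limit: "sZZ A k = (\<mu> (k, True) + \<mu> (k, False)) *\<^sub>R mZZ Q"
  by (simp add: sZZ_def A mZZ_def vec_eq_iff algebra_simps)

lemma sZZ_limit_None: "sZZ A None = mZZ Q"
  by (simp add: sZZ_limit \<mu>)

lemma sXZ_limit: "sXZ A k *v z = stack (\<mu> (k, True) *\<^sub>R (mXZ Q *v z)) (\<mu> (k, False) *\<^sub>R (mXZ Q *v z))"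
  by (auto simp: sXZ_def A mXZ_def vec_eq_iff stack_def matrix_vector_mult_def sum_distrib_left mult_ac split: sum.splits)

lemma sXZ_transpose_limit:
  "transpose (sXZ A k) *v stack a b = transpose (mXZ Q) *v (\<mu> (k, True) *\<^sub>R a + \<mu> (k, False) *\<^sub>R b)"
  by (simp add: sXZ_def A mXZ_def vec_eq_iff stack_def matrix_vector_mult_def transpose_def sum_UNIV_sum
      distrib_left sum.distrib mult_ac)

lemma sXX_limit: "sXX A k *v stack a b = stack (\<mu> (k, True) *\<^sub>R (QXX Q *v a)) (\<mu> (k, False) *\<^sub>R (QXX Q *v b))"
  by (auto simp: sXX_def A QXX_def vec_eq_iff stack_def matrix_vector_mult_def sum_UNIV_sum sum_distrib_left mult_ac split: sum.splits)

lemma cD_limit: "cD A *v z = stack (lam *\<^sub>R (PX *v z)) ((1 - lam) *\<^sub>R (PX *v z))"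
  unfolding cD_def sZZ_limit_None matrix_vector_mul_assoc[symmetric] sXZ_limit \<mu> ..

lemma cD_transpose_limit: "transpose (cD A) *v stack a b = transpose PX *v (lam *\<^sub>R a + (1 - lam) *\<^sub>R b)"
  unfolding cD_def sZZ_limit_None matrix_transpose_mul matrix_vector_mul_assoc[symmetric] sXZ_transpose_limit \<mu> ..

lemma PX_mZZ: "PX *v (mZZ Q *v z) = mXZ Q *v z"
  by (simp add: matrix_vector_mul_assoc matrix_mul_assoc[symmetric] invertible_matrix_inv[OF invZ])

lemma mZZ_symmetric: "transpose (mZZ Q) = mZZ Q"
  unfolding mZZ_def transpose_def vec_eq_iff using symmetric_component[OF sym] by simp

lemma PX_symmetric: "mXZ Q *v (transpose PX *v v) = PX *v (transpose (mXZ Q) *v v)"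
  by (simp add: matrix_transpose_mul transpose_matrix_inv_symmetric[OF invZ mZZ_symmetric] matrix_vector_mul_assoc matrix_mul_assoc)

text \<open>The term with c - m d measures how the weights k depart from the unweighted case; it
  enters the two blocks with the factors lam and 1 - lam. For k = \<open>None\<close> it vanishes,
  as then c = d and m = 1.\<close>

lemma cXX_limit:
  fixes a b k
  defines "d \<equiv> lam *\<^sub>R a + (1 - lam) *\<^sub>R b" and "c \<equiv> \<mu> (k, True) *\<^sub>R a + \<mu> (k, False) *\<^sub>R b"
    and "m \<equiv> \<mu> (k, True) + \<mu> (k, False)"
  shows "cXX A k *v stack a b =
    stack (\<mu> (k, True) *\<^sub>R (QXX Q *v a - PX *v (transpose (mXZ Q) *v d)) - lam *\<^sub>R (PX *v (transpose (mXZ Q) *v (c - m *\<^sub>R d))))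
      (\<mu> (k, False) *\<^sub>R (QXX Q *v b - PX *v (transpose (mXZ Q) *v d)) - (1 - lam) *\<^sub>R (PX *v (transpose (mXZ Q) *v (c - m *\<^sub>R d))))"
proof -
  have "cXX A k *v stack a b = sXX A k *v stack a b - sXZ A k *v (transpose (cD A) *v stack a b)
      - cD A *v (transpose (sXZ A k) *v stack a b) + cD A *v (sZZ A k *v (transpose (cD A) *v stack a b))"
    by (simp add: cXX_def matrix_vector_mult_add_rdistrib matrix_vector_mult_diff_rdistrib matrix_vector_mul_assoc[symmetric])
  also have "\<dots> = stack (\<mu> (k, True) *\<^sub>R (QXX Q *v a)) (\<mu> (k, False) *\<^sub>R (QXX Q *v b))
      - stack (\<mu> (k, True) *\<^sub>R (PX *v (transpose (mXZ Q) *v d))) (\<mu> (k, False) *\<^sub>R (PX *v (transpose (mXZ Q) *v d)))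
      - stack (lam *\<^sub>R (PX *v (transpose (mXZ Q) *v c))) ((1 - lam) *\<^sub>R (PX *v (transpose (mXZ Q) *v c)))
      + stack (lam *\<^sub>R (m *\<^sub>R (PX *v (transpose (mXZ Q) *v d)))) ((1 - lam) *\<^sub>R (m *\<^sub>R (PX *v (transpose (mXZ Q) *v d))))"
    unfolding sXX_limit cD_transpose_limit sXZ_limit sXZ_transpose_limit cD_limit sZZ_limit matrix_scaleR_vector matrix_vector_scaleR
      PX_mZZ PX_symmetric d_def c_def m_def by (simp only: stack_arith scaleR_scaleR mult.commute)
  also have "\<dots> = stack (\<mu> (k, True) *\<^sub>R (QXX Q *v a - PX *v (transpose (mXZ Q) *v d)) - lam *\<^sub>R (PX *v (transpose (mXZ Q) *v (c - m *\<^sub>R d))))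
      (\<mu> (k, False) *\<^sub>R (QXX Q *v b - PX *v (transpose (mXZ Q) *v d)) - (1 - lam) *\<^sub>R (PX *v (transpose (mXZ Q) *v (c - m *\<^sub>R d))))"
    unfolding matrix_vector_mult_diff_distrib matrix_vector_scaleR stack_arith stack_eq_iff by (simp add: algebra_simps)
  finally show ?thesis .
qed

lemma cXX_limit_None:
  "cXX A None *v stack a b =
    stack (lam *\<^sub>R (QXX Q *v a - PX *v (transpose (mXZ Q) *v (lam *\<^sub>R a + (1 - lam) *\<^sub>R b))))
      ((1 - lam) *\<^sub>R (QXX Q *v b - PX *v (transpose (mXZ Q) *v (lam *\<^sub>R a + (1 - lam) *\<^sub>R b))))"
  unfolding cXX_limit \<mu> by simp

text \<open>Injectivity reduces to that of the Schur complement of the ZZ-block of Q.\<close>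
lemma cXX_limit_invertible: "invertible (cXX A None)"
proof (rule invertibleI_injective)
  fix v assume v: "cXX A None *v v = 0"
  obtain a b where ab: "v = stack a b" by (rule stack_cases)
  define d where "d = lam *\<^sub>R a + (1 - lam) *\<^sub>R b"
  define Bd where "Bd = PX *v (transpose (mXZ Q) *v d)"
  have z: "(0 :: real^('m + 'm)) = stack 0 0" by (auto simp: vec_eq_iff stack_def split: sum.splits)
  have "QXX Q *v a = Bd" "QXX Q *v b = Bd"
    using v lam unfolding ab cXX_limit_None z stack_eq_iff by (auto simp: Bd_def d_def)
  then have "QXX Q *v a - QXX Q *v b = 0" "QXX Q *v d = lam *\<^sub>R Bd + (1 - lam) *\<^sub>R Bd"
    by (simp_all add: d_def matrix_vector_right_distrib matrix_vector_scaleR)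
  then have a_b: "a - b = 0" and Xd: "QXX Q *v d = Bd"
    using invertible_injectiveD[OF invX, of "a - b"] by (auto simp: matrix_vector_mult_diff_distrib algebra_simps)
  \<comment> \<open>The Z-part for which the Z-row of Q applied to \<open>join d z\<close> vanishes;
    the X-row then reads Q_XX d - Bd, which is 0 as well.\<close>
  define z where "z = - (matrix_inv (mZZ Q) *v (transpose (mXZ Q) *v d))"
  have "mZZ Q *v z = - (transpose (mXZ Q) *v d)"
    unfolding z_def by (simp add: matrix_vector_mul_assoc matrix_mul_assoc invertible_matrix_inv[OF invZ] linear_neg[OF matrix_vector_mul_linear])
  moreover have "mXZ Q *v z = - Bd"
    unfolding z_def Bd_def by (simp add: matrix_vector_mul_assoc matrix_mul_assoc linear_neg[OF matrix_vector_mul_linear])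
  ultimately have "Q *v join d z = 0"
    unfolding vec_eq_iff
  proof (intro allI)
    fix i show "(Q *v join d z) $ i = 0 $ i"
      by (cases i) (simp_all add: join_quadratic_form(1) join_quadratic_form(2)[OF sym] Xd \<open>mZZ Q *v z = _\<close> \<open>mXZ Q *v z = _\<close>)
  qed
  then have "join d z = 0" using invertible_injectiveD[OF inv] by blast
  then have "join d z $ Inl i = 0" for i by simp
  then have "d = 0" by (simp add: join_def vec_eq_iff)
  moreover have "d = b" using a_b by (simp add: d_def algebra_simps)
  ultimately have "v = stack 0 0" using a_b ab by simp
  then show "v = 0" by (rule trans[OF _ z[symmetric]])
qed

text \<open>Both blocks of the linear system contain the same correction \<open>Bd\<close>, and the
  contrast of the rescaled blocks removes it. This is why Q_XX, and not the Schur complement,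
  appears in the limit.\<close>

lemma Rmat_cXX_inv:
  "Rmat Rc *v (matrix_inv (cXX A None) *v stack v1 v2)
    = Rc *v (matrix_inv (QXX Q) *v ((1 / lam) *\<^sub>R v1 - (1 / (1 - lam)) *\<^sub>R v2))"
proof -
  obtain a b where ab: "matrix_inv (cXX A None) *v stack v1 v2 = stack a b" by (rule stack_cases)
  define d where "d = lam *\<^sub>R a + (1 - lam) *\<^sub>R b"
  define Bd where "Bd = PX *v (transpose (mXZ Q) *v d)"
  have "cXX A None *v stack a b = stack v1 v2"
    unfolding ab[symmetric] by (simp add: matrix_vector_mul_assoc invertible_matrix_inv[OF cXX_limit_invertible])
  then have "v1 = lam *\<^sub>R (QXX Q *v a - Bd)" "v2 = (1 - lam) *\<^sub>R (QXX Q *v b - Bd)"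
    unfolding cXX_limit_None stack_eq_iff by (auto simp: Bd_def d_def)
  then have "(1 / lam) *\<^sub>R v1 - (1 / (1 - lam)) *\<^sub>R v2 = QXX Q *v (a - b)"
    using lam by (simp add: matrix_vector_mult_diff_distrib)
  then have "matrix_inv (QXX Q) *v ((1 / lam) *\<^sub>R v1 - (1 / (1 - lam)) *\<^sub>R v2) = a - b"
    by (simp add: matrix_vector_mul_assoc invertible_matrix_inv[OF invX])
  then show ?thesis unfolding ab Rmat_stack by simp
qed

lemma cXu_limit:
  "cXu A s k = stack (pX (s $ (k, True)) - lam *\<^sub>R (PX *v sZu s k)) (pX (s $ (k, False)) - (1 - lam) *\<^sub>R (PX *v sZu s k))"
  by (simp add: cXu_def sXu_def cD_limit stack_arith)

lemma Rmat_cq_limit: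
  "Rmat Rc *v cq A s = Rc *v (matrix_inv (QXX Q) *v pX ((1 / lam) *\<^sub>R s $ (None, True) - (1 / (1 - lam)) *\<^sub>R s $ (None, False)))"
  unfolding cq_def cXu_limit Rmat_cXX_inv using lam by (simp add: pX_linear scaleR_diff_right)

text \<open>Every contribution of Z enters the two blocks of \<open>cv\<close> as lam and 1 - lam
  times one common vector, so the contrast annihilates it. What survives in each regime is the
  weighted score minus the regime mean of \<phi> j times the unweighted score.\<close>

lemma Rmat_cv_limit:
  "Rmat Rc *v (matrix_inv (cXX A None) *v cv A s j) = Rc *v (matrix_inv (QXX Q) *v pX (
     (1 / lam) *\<^sub>R (s $ (Some j, True) - (\<mu> (Some j, True) / lam) *\<^sub>R s $ (None, True))
     - (1 / (1 - lam)) *\<^sub>R (s $ (Some j, False) - (\<mu> (Some j, False) / (1 - lam)) *\<^sub>R s $ (None, False))))"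
proof -
  obtain a b where ab: "cq A s = stack a b" by (rule stack_cases)
  define d where "d = lam *\<^sub>R a + (1 - lam) *\<^sub>R b"
  define Bd where "Bd = PX *v (transpose (mXZ Q) *v d)"
  define m1 where "m1 = \<mu> (Some j, True)"
  define m2 where "m2 = \<mu> (Some j, False)"
  define s1 where "s1 = pX (s $ (None, True))"
  define s2 where "s2 = pX (s $ (None, False))"
  define r1 where "r1 = pX (s $ (Some j, True))"
  define r2 where "r2 = pX (s $ (Some j, False))"
  define Ps where "Ps = PX *v sZu s None"
  define Pr where "Pr = PX *v sZu s (Some j)"
  define Bc where "Bc = PX *v (transpose (mXZ Q) *v (m1 *\<^sub>R a + m2 *\<^sub>R b - (m1 + m2) *\<^sub>R d))"
  have "cXX A None *v stack a b = cXu A s None"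
    unfolding ab[symmetric] cq_def by (simp add: matrix_vector_mul_assoc invertible_matrix_inv[OF cXX_limit_invertible])
  then have s12: "s1 - lam *\<^sub>R Ps = lam *\<^sub>R (QXX Q *v a - Bd)" "s2 - (1 - lam) *\<^sub>R Ps = (1 - lam) *\<^sub>R (QXX Q *v b - Bd)"
    unfolding cXX_limit_None cXu_limit stack_eq_iff by (auto simp: Bd_def d_def s1_def s2_def Ps_def)
  have "(1 / lam) *\<^sub>R (s1 - lam *\<^sub>R Ps) = QXX Q *v a - Bd" unfolding s12 using lam by simp
  then have qa: "QXX Q *v a - Bd = (1 / lam) *\<^sub>R s1 - Ps" using lam by (simp add: scaleR_diff_right)
  have "(1 / (1 - lam)) *\<^sub>R (s2 - (1 - lam) *\<^sub>R Ps) = QXX Q *v b - Bd" unfolding s12 using lam by simp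
  then have qb: "QXX Q *v b - Bd = (1 / (1 - lam)) *\<^sub>R s2 - Ps" using lam by (simp add: scaleR_diff_right)
  have X: "cXX A (Some j) *v cq A s = stack (m1 *\<^sub>R ((1 / lam) *\<^sub>R s1 - Ps) - lam *\<^sub>R Bc) (m2 *\<^sub>R ((1 / (1 - lam)) *\<^sub>R s2 - Ps) - (1 - lam) *\<^sub>R Bc)"
  proof -
    have "cXX A (Some j) *v stack a b = stack (m1 *\<^sub>R (QXX Q *v a - Bd) - lam *\<^sub>R Bc) (m2 *\<^sub>R (QXX Q *v b - Bd) - (1 - lam) *\<^sub>R Bc)"
      unfolding cXX_limit Bd_def Bc_def d_def m1_def m2_def ..
    then show ?thesis unfolding ab qa qb .
  qed
  have "cXZ A (Some j) *v y = sXZ A (Some j) *v y - cD A *v (sZZ A (Some j) *v y)" for y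
    by (simp add: cXZ_def matrix_vector_mult_diff_rdistrib matrix_vector_mul_assoc)
  then have Zy: "cXZ A (Some j) *v y = stack (m1 *\<^sub>R (mXZ Q *v y) - lam *\<^sub>R ((m1 + m2) *\<^sub>R (mXZ Q *v y))) (m2 *\<^sub>R (mXZ Q *v y) - (1 - lam) *\<^sub>R ((m1 + m2) *\<^sub>R (mXZ Q *v y)))" for y
    unfolding sXZ_limit cD_limit sZZ_limit matrix_scaleR_vector matrix_vector_scaleR PX_mZZ m1_def m2_def
    by (simp only: stack_arith scaleR_scaleR mult.commute)
  have Zs: "cXZ A (Some j) *v (matrix_inv (sZZ A None) *v sZu s None) = stack (m1 *\<^sub>R Ps - lam *\<^sub>R ((m1 + m2) *\<^sub>R Ps)) (m2 *\<^sub>R Ps - (1 - lam) *\<^sub>R ((m1 + m2) *\<^sub>R Ps))"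
    unfolding Zy sZZ_limit_None by (simp add: Ps_def matrix_vector_mul_assoc)
  have "cv A s j = stack (r1 - lam *\<^sub>R Pr - (m1 *\<^sub>R Ps - lam *\<^sub>R ((m1 + m2) *\<^sub>R Ps)) - (m1 *\<^sub>R ((1 / lam) *\<^sub>R s1 - Ps) - lam *\<^sub>R Bc))
      (r2 - (1 - lam) *\<^sub>R Pr - (m2 *\<^sub>R Ps - (1 - lam) *\<^sub>R ((m1 + m2) *\<^sub>R Ps)) - (m2 *\<^sub>R ((1 / (1 - lam)) *\<^sub>R s2 - Ps) - (1 - lam) *\<^sub>R Bc))"
    unfolding cv_def X Zs cXu_limit stack_arith by (simp add: r1_def r2_def Pr_def)
  also have "\<dots> = stack (r1 - (m1 / lam) *\<^sub>R s1 + lam *\<^sub>R (Bc + (m1 + m2) *\<^sub>R Ps - Pr)) (r2 - (m2 / (1 - lam)) *\<^sub>R s2 + (1 - lam) *\<^sub>R (Bc + (m1 + m2) *\<^sub>R Ps - Pr))"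
    unfolding stack_eq_iff by (simp add: algebra_simps)
  finally have cv: "cv A s j = \<dots>" .
  have "(1 / lam) *\<^sub>R (r1 - (m1 / lam) *\<^sub>R s1 + lam *\<^sub>R (Bc + (m1 + m2) *\<^sub>R Ps - Pr))
      - (1 / (1 - lam)) *\<^sub>R (r2 - (m2 / (1 - lam)) *\<^sub>R s2 + (1 - lam) *\<^sub>R (Bc + (m1 + m2) *\<^sub>R Ps - Pr))
      = (1 / lam) *\<^sub>R (r1 - (m1 / lam) *\<^sub>R s1) - (1 / (1 - lam)) *\<^sub>R (r2 - (m2 / (1 - lam)) *\<^sub>R s2)"
    using lam unfolding scaleR_add_right[of "1 / lam"] scaleR_add_right[of "1 / (1 - lam)"] by simp
  then show ?thesis unfolding cv Rmat_cXX_inv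
    by (simp add: pX_linear r1_def r2_def s1_def s2_def m1_def m2_def)
qed

end

section \<open>Linear images of Brownian motion\<close>

text \<open>By the product-to-sum formula finite sums of cosines form an algebra, and the phase b
  lets them stand in for sines, so the approximation argument stays real.\<close>

inductive trig :: "('e::euclidean_space \<Rightarrow> real) \<Rightarrow> bool" where
  trig_cos: "trig (\<lambda>x. a * cos (t \<bullet> x + b))"
| trig_add: "trig f \<Longrightarrow> trig g \<Longrightarrow> trig (\<lambda>x. f x + g x)"

lemma trig_const: "trig (\<lambda>x. c)"
  using trig_cos[of c 0 0] by simp

lemma trig_mult:
  assumes "trig f" "trig g"
  shows "trig (\<lambda>x. f x * g x)"
  using assms(1)
proof induction
  case (trig_cos a t b)
  show ?case using assms(2)
  proof induction
    case (trig_cos a' t' b')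
    have "(\<lambda>x. a * cos (t \<bullet> x + b) * (a' * cos (t' \<bullet> x + b')))
      = (\<lambda>x. (a * a' / 2) * cos ((t - t') \<bullet> x + (b - b')) + (a * a' / 2) * cos ((t + t') \<bullet> x + (b + b')))"
    proof
      fix x
      have "cos (t \<bullet> x + b) * cos (t' \<bullet> x + b') = (cos ((t \<bullet> x + b) - (t' \<bullet> x + b')) + cos ((t \<bullet> x + b) + (t' \<bullet> x + b'))) / 2"
        by (rule cos_times_cos)
      also have "\<dots> = (cos ((t - t') \<bullet> x + (b - b')) + cos ((t + t') \<bullet> x + (b + b'))) / 2"
        by (simp add: inner_diff_left inner_add_left algebra_simps)
      finally have h: "cos (t \<bullet> x + b) * cos (t' \<bullet> x + b') = (cos ((t - t') \<bullet> x + (b - b')) + cos ((t + t') \<bullet> x + (b + b'))) / 2" .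
      have "a * cos (t \<bullet> x + b) * (a' * cos (t' \<bullet> x + b')) = (a * a') * (cos (t \<bullet> x + b) * cos (t' \<bullet> x + b'))"
        by (simp only: mult_ac)
      also have "\<dots> = (a * a' / 2) * cos ((t - t') \<bullet> x + (b - b')) + (a * a' / 2) * cos ((t + t') \<bullet> x + (b + b'))"
        unfolding h by (simp only: add_divide_distrib distrib_left times_divide_eq_right times_divide_eq_left)
      finally show "a * cos (t \<bullet> x + b) * (a' * cos (t' \<bullet> x + b')) = (a * a' / 2) * cos ((t - t') \<bullet> x + (b - b')) + (a * a' / 2) * cos ((t + t') \<bullet> x + (b + b'))" .
    qed
    then show ?case by (simp only: trig_add[OF trig.trig_cos trig.trig_cos])
  next
    case (trig_add f g)
    then show ?case using trig.trig_add[OF trig_add(3,4)] by (simp add: distrib_left)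
  qed
next
  case (trig_add f h)
  then show ?case using trig.trig_add[OF trig_add(3,4)] by (simp add: distrib_right)
qed

lemma trig_continuous: "trig f \<Longrightarrow> continuous_on S f"
  by (induction rule: trig.induct) (auto intro!: continuous_intros)

lemma trig_bounded: "trig f \<Longrightarrow> \<exists>C. \<forall>x. \<bar>f x\<bar> \<le> C"
proof (induction rule: trig.induct)
  case (trig_cos a t b)
  have "\<bar>a * cos (t \<bullet> x + b)\<bar> \<le> \<bar>a\<bar> * 1" for x unfolding abs_mult by (intro mult_left_mono) auto
  then show ?case by blast
next
  case (trig_add f g)
  then obtain C D where "\<forall>x. \<bar>f x\<bar> \<le> C" "\<forall>x. \<bar>g x\<bar> \<le> D" by blast
  then have "\<forall>x. \<bar>f x + g x\<bar> \<le> C + D" by (meson abs_triangle_ineq add_mono order_trans)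
  then show ?case by blast
qed

lemma trig_polynomial:
  fixes p :: "real \<Rightarrow> real"
  assumes "real_polynomial_function p" "trig q"
  shows "trig (\<lambda>x. p (q x))"
  using assms(1)
proof (induction rule: real_polynomial_function.induct)
  case (linear f)
  have "f (q x) = f 1 * q x" for x
    using linear_scale[OF bounded_linear.linear[OF linear], of "q x" 1] by simp
  then show ?case using trig_mult[OF trig_const[of "f 1"] assms(2)] by simp
qed (auto intro: trig_const trig_mult trig.trig_add)

lemma trig_dense:
  fixes g :: "'e::euclidean_space \<Rightarrow> real"
  assumes g: "continuous_on UNIV g" and S: "compact S" and e: "e > 0"
  shows "\<exists>q. trig q \<and> (\<forall>x\<in>S. \<bar>g x - q x\<bar> < e)"
proof -
  interpret function_ring_on "Collect trig" S
  proof
    fix x y :: 'e assume xy: "x \<noteq> y"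
    define v where "v = x - y"
    have v: "v \<bullet> v \<noteq> 0" using xy by (simp add: v_def)
    \<comment> \<open>t is scaled along x - y so that its inner products with x and y differ by pi /
      2; with the phase chosen below the cosine is 0 at x and 1 at y.\<close>
    define t where "t = (pi / 2 / (v \<bullet> v)) *\<^sub>R v"
    have "t \<bullet> x - t \<bullet> y = t \<bullet> v" by (simp add: v_def inner_diff_right)
    also have "\<dots> = pi / 2" using v by (simp add: t_def)
    finally have "t \<bullet> x - t \<bullet> y = pi / 2" .
    then have "cos (t \<bullet> x - t \<bullet> y) = 0" by (simp only: cos_pi_half)
    then have "1 * cos (t \<bullet> x + (- (t \<bullet> y))) \<noteq> 1 * cos (t \<bullet> y + (- (t \<bullet> y)))" by simp
    then show "\<exists>f\<in>Collect trig. f x \<noteq> f y"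
      using trig_cos[of 1 t "- (t \<bullet> y)"] by (intro bexI[of _ "\<lambda>x. 1 * cos (t \<bullet> x + (- (t \<bullet> y)))"]) auto
  qed (auto intro: S trig_continuous trig.trig_add trig_mult trig_const)
  show ?thesis using Stone_Weierstrass_basic[OF continuous_on_subset[OF g] e] by auto
qed

text \<open>A trigonometric polynomial approximating g on a ball need not be bounded by g outside the
  ball; composing it with a polynomial close to the truncation at level C repairs this.\<close>
lemma trig_dense_bounded:
  fixes g :: "'e::euclidean_space \<Rightarrow> real"
  assumes g: "continuous_on UNIV g" "\<And>x. \<bar>g x\<bar> \<le> C" and S: "compact S" and e: "e > 0"
  shows "\<exists>q. trig q \<and> (\<forall>x\<in>S. \<bar>g x - q x\<bar> \<le> 2 * e) \<and> (\<forall>x. \<bar>q x\<bar> \<le> C + e)"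
proof -
  obtain q where q: "trig q" "\<And>x. x \<in> S \<Longrightarrow> \<bar>g x - q x\<bar> < e" using trig_dense[OF g(1) S e] by blast
  obtain K where K: "\<And>x. \<bar>q x\<bar> \<le> K" using trig_bounded[OF q(1)] by blast
  define c where "c y = max (-C) (min C y)" for y :: real
  have "continuous_on {-K..K} c" unfolding c_def by (intro continuous_intros)
  then obtain p where p: "real_polynomial_function p" "\<And>y. y \<in> {-K..K} \<Longrightarrow> \<bar>c y - p y\<bar> < e"
    using Stone_Weierstrass_real_polynomial_function[of "{-K..K}" c e] e by auto
  have C: "C \<ge> 0" using g(2)[of undefined] by linarith
  show ?thesis
  proof (intro exI[of _ "\<lambda>x. p (q x)"] conjI ballI allI)
    show "trig (\<lambda>x. p (q x))" by (rule trig_polynomial[OF p(1) q(1)])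
    have pq: "\<bar>c (q x) - p (q x)\<bar> < e" for x using K[of x] by (intro p(2)) auto
    show "\<bar>p (q x)\<bar> \<le> C + e" for x
    proof -
      have "\<bar>c (q x)\<bar> \<le> C" using C by (auto simp: c_def)
      then show ?thesis using pq[of x] by linarith
    qed
    fix x assume "x \<in> S"
    then have "\<bar>g x - c (q x)\<bar> \<le> e" using q(2)[of x] g(2)[of x] by (auto simp: c_def)
    then show "\<bar>g x - p (q x)\<bar> \<le> 2 * e" using pq[of x] by linarith
  qed
qed

lemma integral_tail_tendsto_0:
  fixes X :: "'a \<Rightarrow> 'e::euclidean_space"
  assumes M: "prob_space M" and X[measurable]: "X \<in> borel_measurable M"
  shows "(\<lambda>n::nat. \<integral>\<omega>. indicator {x. norm x > real n} (X \<omega>) \<partial>M) \<longlonglongrightarrow> (0::real)"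
proof -
  interpret prob_space M by fact
  have "(\<lambda>n::nat. \<integral>\<omega>. indicator {x. norm x > real n} (X \<omega>) \<partial>M) \<longlonglongrightarrow> (\<integral>\<omega>. (0::real) \<partial>M)"
  proof (rule integral_dominated_convergence[where w="\<lambda>_. 1"])
    show "AE \<omega> in M. (\<lambda>n::nat. indicator {x. norm x > real n} (X \<omega>) :: real) \<longlonglongrightarrow> 0"
    proof (rule AE_I2)
      fix \<omega>
      obtain N :: nat where N: "norm (X \<omega>) < real N" using reals_Archimedean2 by blast
      then have "\<forall>\<^sub>F n in sequentially. indicator {x. norm x > real n} (X \<omega>) = (0::real)"
        unfolding eventually_sequentially by (intro exI[of _ N]) auto
      then show "(\<lambda>n::nat. indicator {x. norm x > real n} (X \<omega>) :: real) \<longlonglongrightarrow> 0"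
        by (rule tendsto_eventually)
    qed
  qed (auto simp: indicator_def)
  then show ?thesis by simp
qed

lemma trig_integral_eq:
  fixes X :: "'a \<Rightarrow> 'e::euclidean_space" and Y :: "'b \<Rightarrow> 'e"
  assumes M: "prob_space M" and N: "prob_space N"
    and X: "X \<in> borel_measurable M" and Y: "Y \<in> borel_measurable N"
    and eq: "\<And>t b. (\<integral>\<omega>. cos (t \<bullet> X \<omega> + b) \<partial>M) = (\<integral>\<omega>. cos (t \<bullet> Y \<omega> + b) \<partial>N)"
    and q: "trig q"
  shows "(\<integral>\<omega>. q (X \<omega>) \<partial>M) = (\<integral>\<omega>. q (Y \<omega>) \<partial>N)"
  using q
proof induction
  case (trig_add f g)
  have i: "integrable M (\<lambda>\<omega>. h (X \<omega>))" "integrable N (\<lambda>\<omega>. h (Y \<omega>))" if "trig h" for h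
  proof -
    have t: "trig h" by fact
    obtain C where C: "\<And>x. \<bar>h x\<bar> \<le> C" using trig_bounded[OF t] by blast
    have [measurable]: "h \<in> borel_measurable borel" using trig_continuous[OF t] by (rule borel_measurable_continuous_onI)
    show "integrable M (\<lambda>\<omega>. h (X \<omega>))" "integrable N (\<lambda>\<omega>. h (Y \<omega>))"
      using X Y C by (auto intro!: prob_integrable_bounded M N)
  qed
  show ?case using trig_add i by simp
qed (simp add: eq)

text \<open>Cosines with arbitrary phases determine the means of all trigonometric polynomials. On a
  ball carrying most of the mass of both laws g is close to such a polynomial; outside, the bounds
  on g and on the polynomial limit the damage.\<close>

theorem cramer_wold_cos:
  fixes X :: "'a \<Rightarrow> 'e::euclidean_space" and Y :: "'b \<Rightarrow> 'e"
  assumes M: "prob_space M" and N: "prob_space N"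
    and X: "X \<in> borel_measurable M" and Y: "Y \<in> borel_measurable N"
    and eq: "\<And>t b. (\<integral>\<omega>. cos (t \<bullet> X \<omega> + b) \<partial>M) = (\<integral>\<omega>. cos (t \<bullet> Y \<omega> + b) \<partial>N)"
    and g: "continuous_on UNIV g" "bounded (range g)"
  shows "(\<integral>\<omega>. g (X \<omega>) \<partial>M) = (\<integral>\<omega>. g (Y \<omega>) \<partial>N :: real)"
proof -
  note [measurable] = X Y
  interpret M: prob_space M by fact
  interpret N: prob_space N by fact
  obtain C where C: "\<And>x. \<bar>g x\<bar> \<le> C" using g(2) by (auto simp: bounded_iff)
  have C0: "C \<ge> 0" using C[of undefined] by linarith
  have [measurable]: "g \<in> borel_measurable borel" using g(1) by (rule borel_measurable_continuous_onI)
  have bound: "\<bar>(\<integral>\<omega>. g (X \<omega>) \<partial>M) - (\<integral>\<omega>. g (Y \<omega>) \<partial>N)\<bar> \<le> (6 + 4 * C) * e" if e: "0 < e" "e \<le> 1" for e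
  proof -
    have "\<forall>\<^sub>F n in sequentially. (\<integral>\<omega>. indicator {x. norm x > real n} (X \<omega>) \<partial>M) < e \<and> (\<integral>\<omega>. indicator {x. norm x > real n} (Y \<omega>) \<partial>N) < e"
      using order_tendstoD(2)[OF integral_tail_tendsto_0[OF M X] e(1)] order_tendstoD(2)[OF integral_tail_tendsto_0[OF N Y] e(1)]
      by (rule eventually_conj)
    then obtain n where n: "(\<integral>\<omega>. indicator {x. norm x > real n} (X \<omega>) \<partial>M) < e" "(\<integral>\<omega>. indicator {x. norm x > real n} (Y \<omega>) \<partial>N) < e"
      using eventually_happens'[OF sequentially_bot] by blast
    obtain q where q: "trig q" "\<And>x. x \<in> cball 0 (real n) \<Longrightarrow> \<bar>g x - q x\<bar> \<le> 2 * e" "\<And>x. \<bar>q x\<bar> \<le> C + e"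
      using trig_dense_bounded[OF g(1) C compact_cball[of 0 "real n"] e(1)] by blast
    have [measurable]: "q \<in> borel_measurable borel" using trig_continuous[OF q(1)] by (rule borel_measurable_continuous_onI)
    \<comment> \<open>Outside the ball g and q differ by at most C + (C + e), and e is at most
      1.\<close>
    have pt: "\<bar>g x - q x\<bar> \<le> 2 * e + (2 * C + 1) * indicator {x. norm x > real n} x" for x
    proof (cases "norm x > real n")
      case True
      then show ?thesis using C[of x] q(3)[of x] e by auto
    next
      case False
      then show ?thesis using q(2)[of x] by auto
    qed
    have one: "\<bar>(\<integral>\<omega>. g (Z \<omega>) \<partial>L) - (\<integral>\<omega>. q (Z \<omega>) \<partial>L)\<bar> \<le> (3 + 2 * C) * e"
      if L: "prob_space L" and Z[measurable]: "Z \<in> borel_measurable L" and t: "(\<integral>\<omega>. indicator {x. norm x > real n} (Z \<omega>) \<partial>L) < e"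
      for L :: "'c measure" and Z
    proof -
      interpret L: prob_space L by fact
      have i: "integrable L (\<lambda>\<omega>. g (Z \<omega>))" "integrable L (\<lambda>\<omega>. q (Z \<omega>))" "integrable L (\<lambda>\<omega>. indicator {x. norm x > real n} (Z \<omega>) :: real)"
        using C q(3) by (auto intro!: prob_integrable_bounded[OF L] simp: indicator_def)
      have "\<bar>(\<integral>\<omega>. g (Z \<omega>) \<partial>L) - (\<integral>\<omega>. q (Z \<omega>) \<partial>L)\<bar> = \<bar>\<integral>\<omega>. g (Z \<omega>) - q (Z \<omega>) \<partial>L\<bar>" using i by simp
      also have "\<dots> \<le> (\<integral>\<omega>. 2 * e + (2 * C + 1) * indicator {x. norm x > real n} (Z \<omega>) \<partial>L)"
        by (rule abs_integral_le_integral) (use i pt in auto)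
      also have "\<dots> = 2 * e + (2 * C + 1) * (\<integral>\<omega>. indicator {x. norm x > real n} (Z \<omega>) \<partial>L)"
        using i(3) by (simp add: L.prob_space)
      also have "\<dots> \<le> 2 * e + (2 * C + 1) * e" using t C0 by (intro add_left_mono mult_left_mono) auto
      finally show ?thesis by (simp add: algebra_simps)
    qed
    have "(\<integral>\<omega>. q (X \<omega>) \<partial>M) = (\<integral>\<omega>. q (Y \<omega>) \<partial>N)" by (rule trig_integral_eq[OF M N X Y eq q(1)])
    then show ?thesis using one[OF M X n(1)] one[OF N Y n(2)] by (simp add: algebra_simps)
  qed
  have "\<bar>(\<integral>\<omega>. g (X \<omega>) \<partial>M) - (\<integral>\<omega>. g (Y \<omega>) \<partial>N)\<bar> \<le> 0"
  proof (rule field_le_epsilon)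
    fix e :: real assume e: "e > 0"
    define d where "d = min 1 (e / (6 + 4 * C))"
    have d: "0 < d" "d \<le> 1" using e C0 by (auto simp: d_def)
    have "(6 + 4 * C) * d \<le> (6 + 4 * C) * (e / (6 + 4 * C))" using C0 by (intro mult_left_mono) (auto simp: d_def)
    also have "\<dots> = e" using C0 by simp
    finally show "\<bar>(\<integral>\<omega>. g (X \<omega>) \<partial>M) - (\<integral>\<omega>. g (Y \<omega>) \<partial>N)\<bar> \<le> 0 + e" using bound[OF d] by linarith
  qed
  then show ?thesis by simp
qed

section \<open>Characteristic functions of Brownian increments\<close>

lemma (in prob_space) char_scaled_normal:
  assumes d: "distributed M lborel X (normal_density 0 \<sigma>)" and \<sigma>: "\<sigma> > 0"
  shows "char (distr M borel (\<lambda>\<omega>. c * X \<omega>)) 1 = exp (- (c\<^sup>2 * \<sigma>\<^sup>2) / 2)"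
proof -
  have X[measurable]: "X \<in> borel_measurable M" using distributed_measurable[OF d] by simp
  have "distributed M lborel (\<lambda>x. (X x - 0) / \<sigma>) std_normal_density"
    using d normal_standard_normal_convert[OF \<sigma>, of X 0] by simp
  then have "distr M lborel (\<lambda>x. X x / \<sigma>) = std_normal_distribution"
    using distributed_distr_eq_density by fastforce
  moreover have "distr M lborel (\<lambda>x. X x / \<sigma>) = distr M borel (\<lambda>x. X x / \<sigma>)"
    by (intro distr_cong) auto
  ultimately have "char (distr M borel (\<lambda>x. X x / \<sigma>)) (c * \<sigma>) = exp (- ((c * \<sigma>)\<^sup>2) / 2)"
    by (simp add: char_std_normal_distribution)
  moreover have "char (distr M borel (\<lambda>x. X x / \<sigma>)) (c * \<sigma>) = char (distr M borel (\<lambda>\<omega>. c * X \<omega>)) 1"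
    using \<sigma> by (simp add: char_def integral_distr)
  ultimately show ?thesis by (simp add: power_mult_distrib)
qed

text \<open>Turns a combination of path values into one of increments; G plays the part of the tail
  sums of the weights.\<close>

lemma inner_summation_by_parts:
  fixes G x :: "nat \<Rightarrow> 'v::real_inner"
  shows "(\<Sum>l<Suc n. (G l - G (Suc l)) \<bullet> x l) = G 0 \<bullet> x 0 + (\<Sum>k<n. G (Suc k) \<bullet> (x (Suc k) - x k)) - G (Suc n) \<bullet> x n"
  by (induction n) (simp_all add: inner_diff_left inner_diff_right)

text \<open>The components of the increments are independent normals, so the characteristic function
  of the combination, taken at 1, is a product of exponentials; the real part after a shift of phase
  is the mean of the cosine.\<close>

lemma std_BM_increments_cos:
  fixes W :: "real \<Rightarrow> 'a \<Rightarrow> real^'n"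
  assumes BM: "std_BM M W" and ts: "sorted ts" "distinct ts" "set ts \<subseteq> {0..1}" and len: "length ts = Suc n"
  shows "(\<integral>\<omega>. cos ((\<Sum>k<n. H k \<bullet> (W (ts ! Suc k) \<omega> - W (ts ! k) \<omega>)) + b) \<partial>M)
    = cos b * exp (- (\<Sum>k<n. (H k \<bullet> H k) * (ts ! Suc k - ts ! k)) / 2)"
proof -
  interpret prob_space M using BM by (simp add: std_BM_def)
  define X where "X = (\<lambda>(i, k) \<omega>. (W (ts ! Suc k) \<omega> - W (ts ! k) \<omega>) $ i)"
  have ind: "indep_vars (\<lambda>_. borel) X (UNIV \<times> {..<n})"
    using BM ts len unfolding std_BM_def X_def by auto
  have mem: "ts ! k \<in> {0..1}" if "k \<le> n" for k using ts(3) len that by (metis less_Suc_eq_le nth_mem subsetD)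
  have lt: "ts ! k < ts ! Suc k" if "k < n" for k
    using sorted_nth_mono[OF ts(1), of k "Suc k"] nth_eq_iff_index_eq[OF ts(2), of k "Suc k"] that len by (auto simp: less_le)
  have W[measurable]: "W t \<in> borel_measurable M" if "t \<in> {0..1}" for t using BM that by (auto simp: std_BM_def)
  have d: "distributed M lborel (X (i, k)) (normal_density 0 (sqrt (ts ! Suc k - ts ! k)))" if "k < n" for i k
  proof -
    have "\<forall>s t i. 0 \<le> s \<and> s < t \<and> t \<le> 1 \<longrightarrow> distributed M lborel (\<lambda>\<omega>. (W t \<omega> - W s \<omega>) $ i) (normal_density 0 (sqrt (t - s)))"
      using BM by (simp add: std_BM_def)
    then show ?thesis using lt[OF that] mem[of k] mem[of "Suc k"] that unfolding X_def by auto
  qed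
  define S where "S \<omega> = (\<Sum>p\<in>UNIV \<times> {..<n}. H (snd p) $ fst p * X p \<omega>)" for \<omega>
  have Seq: "S \<omega> = (\<Sum>k<n. H k \<bullet> (W (ts ! Suc k) \<omega> - W (ts ! k) \<omega>))" for \<omega>
    unfolding S_def inner_vec_def X_def by (subst sum.swap) (simp add: sum.cartesian_product case_prod_beta)
  have Xm[measurable]: "X p \<in> borel_measurable M" if "p \<in> UNIV \<times> {..<n}" for p
    using ind that unfolding indep_vars_def by auto
  have Sm[measurable]: "S \<in> borel_measurable M" unfolding S_def by measurable
  have "indep_vars (\<lambda>_. borel) (\<lambda>p \<omega>. H (snd p) $ fst p * X p \<omega>) (UNIV \<times> {..<n})"
    by (rule indep_vars_compose2[OF ind]) auto
  then have "char (distr M borel S) 1 = (\<Prod>p\<in>UNIV \<times> {..<n}. char (distr M borel (\<lambda>\<omega>. H (snd p) $ fst p * X p \<omega>)) 1)"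
    unfolding S_def[abs_def] by (rule char_distr_sum)
  also have "\<dots> = (\<Prod>p\<in>UNIV \<times> {..<n}. complex_of_real (exp (- ((H (snd p) $ fst p)\<^sup>2 * (ts ! Suc (snd p) - ts ! snd p)) / 2)))"
  proof (rule prod.cong[OF refl])
    fix p :: "'n \<times> nat" assume p: "p \<in> UNIV \<times> {..<n}"
    obtain i k where ik: "p = (i, k)" by (cases p)
    have k: "k < n" using p ik by auto
    show "char (distr M borel (\<lambda>\<omega>. H (snd p) $ fst p * X p \<omega>)) 1 = complex_of_real (exp (- ((H (snd p) $ fst p)\<^sup>2 * (ts ! Suc (snd p) - ts ! snd p)) / 2))"
      using char_scaled_normal[OF d[OF k, of i], of "H k $ i"] lt[OF k] by (simp add: ik)
  qed
  also have "\<dots> = complex_of_real (exp (\<Sum>p\<in>UNIV \<times> {..<n}. - ((H (snd p) $ fst p)\<^sup>2 * (ts ! Suc (snd p) - ts ! snd p)) / 2))"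
    by (simp only: exp_sum[OF finite_cartesian_product[OF finite finite_lessThan]] of_real_prod)
  also have "(\<Sum>p\<in>(UNIV::'n set) \<times> {..<n}. - ((H (snd p) $ fst p)\<^sup>2 * (ts ! Suc (snd p) - ts ! snd p)) / 2)
     = - (\<Sum>k<n. (H k \<bullet> H k) * (ts ! Suc k - ts ! k)) / 2"
  proof -
    have "(\<Sum>k<n. (H k \<bullet> H k) * (ts ! Suc k - ts ! k)) = (\<Sum>p\<in>(UNIV::'n set) \<times> {..<n}. (H (snd p) $ fst p)\<^sup>2 * (ts ! Suc (snd p) - ts ! snd p))"
      unfolding inner_vec_def sum_distrib_right by (subst sum.swap) (simp add: sum.cartesian_product case_prod_beta power2_eq_square)
    then show ?thesis by (simp only: sum_negf[symmetric] sum_divide_distrib)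
  qed
  finally have ch: "char (distr M borel S) 1 = complex_of_real (exp (- (\<Sum>k<n. (H k \<bullet> H k) * (ts ! Suc k - ts ! k)) / 2))" .
  have int: "integrable M (\<lambda>\<omega>. iexp (S \<omega>))"
    by (rule integrable_const_bound[of _ 1]) auto
  have "char (distr M borel S) 1 = (\<integral>\<omega>. iexp (S \<omega>) \<partial>M)" by (simp add: char_def integral_distr)
  then have e: "(\<integral>\<omega>. iexp (S \<omega>) \<partial>M) = complex_of_real (exp (- (\<Sum>k<n. (H k \<bullet> H k) * (ts ! Suc k - ts ! k)) / 2))" using ch by simp
  have "(\<integral>\<omega>. cos (S \<omega> + b) \<partial>M) = (\<integral>\<omega>. Re (iexp (S \<omega>) * iexp b) \<partial>M)"
    by (intro Bochner_Integration.integral_cong refl) (simp add: exp_add[symmetric] Re_exp)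
  also have "\<dots> = Re ((\<integral>\<omega>. iexp (S \<omega>) \<partial>M) * iexp b)"
    using int by (subst integral_Re) auto
  also have "\<dots> = cos b * exp (- (\<Sum>k<n. (H k \<bullet> H k) * (ts ! Suc k - ts ! k)) / 2)"
    unfolding e by (simp add: Re_exp)
  finally show ?thesis unfolding Seq .
qed

text \<open>The matrix B enters the result only through B B', which is what makes laws for different
  matrices comparable. The time 0 joins F, with weight 0 if it is new, because W 0 vanishes almost
  surely and path values thereby become sums of increments. The coefficient of an increment is the
  sum of the weights from its right end onwards.\<close>

lemma std_BM_linear_cos:
  fixes W :: "real \<Rightarrow> 'a \<Rightarrow> real^'n" and B :: "real^'n^'p" and w :: "real \<Rightarrow> real^'p"
  assumes BM: "std_BM M W" and F: "finite F" "F \<subseteq> {0..1}"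
  defines "ts \<equiv> sorted_list_of_set (insert 0 F)"
  defines "n \<equiv> length ts - 1"
  defines "G \<equiv> \<lambda>k. \<Sum>l\<in>{k..<Suc n}. (if ts ! l \<in> F then w (ts ! l) else 0)"
  shows "(\<integral>\<omega>. cos ((\<Sum>s\<in>F. w s \<bullet> (B *v W s \<omega>)) + b) \<partial>M)
    = cos b * exp (- (\<Sum>k<n. (G (Suc k) \<bullet> ((B ** transpose B) *v G (Suc k))) * (ts ! Suc k - ts ! k)) / 2)"
proof -
  have ts: "sorted ts" "distinct ts" "set ts = insert 0 F" using F(1) unfolding ts_def by (simp_all del: sorted_list_of_set_insert_remove)
  have "ts \<noteq> []" using ts(3) by auto
  then have len: "length ts = Suc n" by (simp add: n_def)
  have ts0: "ts ! 0 = 0"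
  proof -
    obtain i where i: "i < length ts" "ts ! i = 0" using ts(3) by (metis in_set_conv_nth insertI1)
    have "ts ! 0 \<le> ts ! i" using ts(1) i(1) by (intro sorted_nth_mono) auto
    moreover have "ts ! 0 \<in> insert 0 F" using ts(3) len by (metis nth_mem zero_less_Suc)
    ultimately show ?thesis using i(2) F(2) by force
  qed
  have bij: "bij_betw (\<lambda>l. ts ! l) {..<Suc n} (insert 0 F)"
    using bij_betw_nth[OF ts(2), of "{..<Suc n}" "insert 0 F"] ts(3) len by simp
  have lin: "(\<Sum>s\<in>F. w s \<bullet> (B *v x s)) = (transpose B *v G 0) \<bullet> x 0 + (\<Sum>k<n. (transpose B *v G (Suc k)) \<bullet> (x (ts ! Suc k) - x (ts ! k)))" for x :: "real \<Rightarrow> real^'n"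
  proof -
    have "(\<Sum>s\<in>F. w s \<bullet> (B *v x s)) = (\<Sum>s\<in>insert 0 F. (if s \<in> F then w s else 0) \<bullet> (B *v x s))"
      using F(1) by (intro sum.mono_neutral_cong_left) auto
    also have "\<dots> = (\<Sum>l<Suc n. (if ts ! l \<in> F then w (ts ! l) else 0) \<bullet> (B *v x (ts ! l)))"
      by (rule sum.reindex_bij_betw[OF bij, symmetric])
    also have "\<dots> = (\<Sum>l<Suc n. (transpose B *v G l - transpose B *v G (Suc l)) \<bullet> x (ts ! l))"
    proof (rule sum.cong[OF refl])
      fix l assume "l \<in> {..<Suc n}"
      then have "G l = (if ts ! l \<in> F then w (ts ! l) else 0) + G (Suc l)"
        unfolding G_def by (subst sum.atLeast_Suc_lessThan) auto
      then have "transpose B *v G l - transpose B *v G (Suc l) = transpose B *v (if ts ! l \<in> F then w (ts ! l) else 0)"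
        by (simp add: matrix_vector_mult_diff_distrib[symmetric])
      moreover have "v \<bullet> (B *v y) = (transpose B *v v) \<bullet> y" for v y
        by (metis dot_lmul_matrix transpose_matrix_vector)
      ultimately show "(if ts ! l \<in> F then w (ts ! l) else 0) \<bullet> (B *v x (ts ! l)) = (transpose B *v G l - transpose B *v G (Suc l)) \<bullet> x (ts ! l)"
        by simp
    qed
    also have "\<dots> = (transpose B *v G 0) \<bullet> x (ts ! 0) + (\<Sum>k<n. (transpose B *v G (Suc k)) \<bullet> (x (ts ! Suc k) - x (ts ! k))) - (transpose B *v G (Suc n)) \<bullet> x (ts ! n)"
      by (rule inner_summation_by_parts[where x="\<lambda>l. x (ts ! l)"])
    finally show ?thesis by (simp add: ts0 G_def)
  qed
  have sq: "(transpose B *v v) \<bullet> (transpose B *v v) = v \<bullet> ((B ** transpose B) *v v)" for v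
    by (metis dot_lmul_matrix matrix_vector_mul_assoc transpose_matrix_vector)
  have "(\<integral>\<omega>. cos ((\<Sum>s\<in>F. w s \<bullet> (B *v W s \<omega>)) + b) \<partial>M)
     = (\<integral>\<omega>. cos ((\<Sum>k<n. (transpose B *v G (Suc k)) \<bullet> (W (ts ! Suc k) \<omega> - W (ts ! k) \<omega>)) + b) \<partial>M)"
  proof (rule integral_cong_AE)
    have W: "W t \<in> borel_measurable M" if "t \<in> {0..1}" for t using BM that by (auto simp: std_BM_def)
    have mem: "ts ! k \<in> {0..1}" if "k \<le> n" for k
      using ts(3) F(2) len that by (metis atLeastAtMost_iff insert_iff less_Suc_eq_le nth_mem order_refl subsetD zero_le_one)
    show "(\<lambda>\<omega>. cos ((\<Sum>s\<in>F. w s \<bullet> (B *v W s \<omega>)) + b)) \<in> borel_measurable M"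
    proof -
      have "(\<lambda>\<omega>. \<Sum>s\<in>F. w s \<bullet> (B *v W s \<omega>)) \<in> borel_measurable M"
        using F(2) W by (intro borel_measurable_sum borel_measurable_inner borel_measurable_matrix_vector_mult borel_measurable_const) auto
      then show ?thesis by measurable
    qed
    show "(\<lambda>\<omega>. cos ((\<Sum>k<n. (transpose B *v G (Suc k)) \<bullet> (W (ts ! Suc k) \<omega> - W (ts ! k) \<omega>)) + b)) \<in> borel_measurable M"
    proof -
      have "(\<lambda>\<omega>. \<Sum>k<n. (transpose B *v G (Suc k)) \<bullet> (W (ts ! Suc k) \<omega> - W (ts ! k) \<omega>)) \<in> borel_measurable M"
        by (intro borel_measurable_sum borel_measurable_inner borel_measurable_const borel_measurable_diff W mem) auto
      then show ?thesis by measurable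
    qed
    have "AE \<omega> in M. W 0 \<omega> = 0" using BM by (simp add: std_BM_def)
    then show "AE \<omega> in M. cos ((\<Sum>s\<in>F. w s \<bullet> (B *v W s \<omega>)) + b) = cos ((\<Sum>k<n. (transpose B *v G (Suc k)) \<bullet> (W (ts ! Suc k) \<omega> - W (ts ! k) \<omega>)) + b)"
      by eventually_elim (simp add: lin[of "\<lambda>s. W s _"])
  qed
  also have "\<dots> = cos b * exp (- (\<Sum>k<n. ((transpose B *v G (Suc k)) \<bullet> (transpose B *v G (Suc k))) * (ts ! Suc k - ts ! k)) / 2)"
    by (rule std_BM_increments_cos[OF BM ts(1,2) _ len]) (use ts(3) F(2) in auto)
  finally show ?thesis unfolding sq .
qed

section \<open>Finite-dimensional functionals of a path\<close>

definition fin_lin :: "((real \<Rightarrow> real^'p) \<Rightarrow> real) \<Rightarrow> bool" where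
  "fin_lin L \<longleftrightarrow> (\<exists>F w. finite F \<and> F \<subseteq> {0..1} \<and> (\<forall>x. L x = (\<Sum>s\<in>F. w s \<bullet> x s)))"

lemma fin_lin_eval: "s \<in> {0..1} \<Longrightarrow> fin_lin (\<lambda>x. v \<bullet> x s)"
  unfolding fin_lin_def by (intro exI[of _ "{s}"] exI[of _ "\<lambda>_. v"]) auto

lemma fin_lin_add:
  assumes "fin_lin L" "fin_lin L'"
  shows "fin_lin (\<lambda>x. L x + L' x)"
proof -
  obtain F w where 1: "finite F" "F \<subseteq> {0..1}" "\<And>x. L x = (\<Sum>s\<in>F. w s \<bullet> x s)"
    using assms(1) unfolding fin_lin_def by blast
  obtain F' w' where 2: "finite F'" "F' \<subseteq> {0..1}" "\<And>x. L' x = (\<Sum>s\<in>F'. w' s \<bullet> x s)"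
    using assms(2) unfolding fin_lin_def by blast
  have "L x = (\<Sum>s\<in>F \<union> F'. (if s \<in> F then w s else 0) \<bullet> x s)" for x
    unfolding 1(3) using 1 2 by (intro sum.mono_neutral_cong_left) auto
  moreover have "L' x = (\<Sum>s\<in>F \<union> F'. (if s \<in> F' then w' s else 0) \<bullet> x s)" for x
    unfolding 2(3) using 1 2 by (intro sum.mono_neutral_cong_left) auto
  ultimately have "L x + L' x = (\<Sum>s\<in>F \<union> F'. ((if s \<in> F then w s else 0) + (if s \<in> F' then w' s else 0)) \<bullet> x s)" for x
    by (simp add: inner_add_left sum.distrib)
  then show ?thesis unfolding fin_lin_def using 1 2
    by (intro exI[of _ "F \<union> F'"] exI[of _ "\<lambda>s. (if s \<in> F then w s else 0) + (if s \<in> F' then w' s else 0)"]) auto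
qed

lemma fin_lin_sum:
  assumes "finite I" "\<And>i. i \<in> I \<Longrightarrow> fin_lin (L i)"
  shows "fin_lin (\<lambda>x. \<Sum>i\<in>I. L i x)"
  using assms
proof (induction I)
  case empty
  show ?case using fin_lin_eval[of 0 0] by simp
next
  case (insert i I)
  then show ?case using fin_lin_add[of "L i" "\<lambda>x. \<Sum>i\<in>I. L i x"] by simp
qed

lemma fin_lin_rsum: "fin_lin (\<lambda>x. v \<bullet> rsum n f x)"
proof -
  have "fin_lin (\<lambda>x. \<Sum>k<n. (f (real k / real n) *\<^sub>R v) \<bullet> x (real (Suc k) / real n) + (- f (real k / real n) *\<^sub>R v) \<bullet> x (real k / real n))"
    by (intro fin_lin_sum fin_lin_add fin_lin_eval) (auto simp: field_simps)
  moreover have "(\<lambda>x. v \<bullet> rsum n f x) = (\<lambda>x. \<Sum>k<n. (f (real k / real n) *\<^sub>R v) \<bullet> x (real (Suc k) / real n) + (- f (real k / real n) *\<^sub>R v) \<bullet> x (real k / real n))"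
    by (simp add: rsum_def inner_sum_right inner_diff_right algebra_simps)
  ultimately show ?thesis by simp
qed

text \<open>Equal covariances give equal characteristic functions for all combinations of finitely
  many path values, even when the two Brownian motions differ in dimension and in probability
  space.\<close>

lemma std_BM_law_transfer:
  fixes W :: "real \<Rightarrow> 'a \<Rightarrow> real^'n" and V :: "real \<Rightarrow> 'b \<Rightarrow> real^'q"
    and B :: "real^'n^'p" and D :: "real^'q^'p" and \<Phi> :: "(real \<Rightarrow> real^'p) \<Rightarrow> 'e::euclidean_space"
  assumes W: "std_BM M W" and V: "std_BM N V" and BD: "B ** transpose B = D ** transpose D"
    and \<Phi>: "\<And>t. fin_lin (\<lambda>x. t \<bullet> \<Phi> x)"
    and m: "(\<lambda>\<omega>. \<Phi> (\<lambda>s. B *v W s \<omega>)) \<in> borel_measurable M" "(\<lambda>\<omega>. \<Phi> (\<lambda>s. D *v V s \<omega>)) \<in> borel_measurable N"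
    and g: "continuous_on UNIV g" "bounded (range g)"
  shows "(\<integral>\<omega>. g (\<Phi> (\<lambda>s. B *v W s \<omega>)) \<partial>M) = (\<integral>\<omega>. g (\<Phi> (\<lambda>s. D *v V s \<omega>)) \<partial>N :: real)"
proof (rule cramer_wold_cos[OF _ _ m _ g])
  show "prob_space M" "prob_space N" using W V by (auto simp: std_BM_def)
  fix t b
  obtain F w where F: "finite F" "F \<subseteq> {0..1}" "\<And>x. t \<bullet> \<Phi> x = (\<Sum>s\<in>F. w s \<bullet> x s)"
    using \<Phi>[of t] unfolding fin_lin_def by blast
  show "(\<integral>\<omega>. cos (t \<bullet> \<Phi> (\<lambda>s. B *v W s \<omega>) + b) \<partial>M) = (\<integral>\<omega>. cos (t \<bullet> \<Phi> (\<lambda>s. D *v V s \<omega>) + b) \<partial>N)"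
    unfolding F(3) std_BM_linear_cos[OF W F(1,2)] std_BM_linear_cos[OF V F(1,2)] BD ..
qed

section \<open>Wiener integrals and Riemann sums\<close>

text \<open>D holds the coordinates of the rows of B in an orthonormal basis of the row space, whose
  dimension is p, so D is square and the Gram matrices agree. Then D' v and B' v have the same norm,
  and the injectivity of B' makes D invertible. In the scalar case D may be replaced by - D; a
  positive entry is wanted because the t statistic takes a square root and would otherwise pick up a
  sign.\<close>

lemma full_row_rank_factorization:
  fixes B :: "real^'n^'p"
  assumes "rank B = CARD('p)"
  obtains D :: "real^'p^'p" where "B ** transpose B = D ** transpose D" "invertible D"
    "CARD('p) = 1 \<Longrightarrow> D $ i $ i > 0"
proof -
  obtain E where E: "E \<subseteq> span (rows B)" "pairwise orthogonal E" "\<And>x. x \<in> E \<Longrightarrow> norm x = 1"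
      "independent E" "card E = dim (span (rows B))" "span E = span (rows B)"
    using orthonormal_basis_subspace[OF subspace_span[of "rows B"]] by metis
  have cE: "card E = CARD('p)" using E(5) assms by (simp add: row_rank_def)
  have fE: "finite E" using E(4) by (rule independent_imp_finite)
  obtain e where e: "bij_betw e (UNIV :: 'p set) E"
    using finite_same_card_bij[of "UNIV :: 'p set" E] fE cE by auto
  define D :: "real^'p^'p" where "D = (\<chi> i j. B $ i \<bullet> e j)"
  have row: "B $ i \<in> span E" for i unfolding E(6) by (rule span_base) (auto simp: rows_def row_def vec_nth_inverse)
  have comp: "(B ** transpose B) $ i $ k = B $ i \<bullet> B $ k" for i k
    by (simp add: matrix_matrix_mult_def transpose_def inner_vec_def)
  have BD: "B ** transpose B = D ** transpose D"
  proof (unfold vec_eq_iff, intro allI)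
    fix i k
    have "B $ i \<bullet> B $ k = (\<Sum>b\<in>E. (B $ i \<bullet> b) *\<^sub>R b) \<bullet> B $ k"
      using orthonormal_basis_expand[OF E(2) E(3) row fE, of i] by simp
    also have "\<dots> = (\<Sum>b\<in>E. (B $ i \<bullet> b) * (B $ k \<bullet> b))"
      unfolding inner_sum_left by (intro sum.cong refl) (simp add: inner_commute)
    also have "\<dots> = (\<Sum>j\<in>UNIV. (B $ i \<bullet> e j) * (B $ k \<bullet> e j))"
      by (rule sum.reindex_bij_betw[OF e, symmetric])
    also have "\<dots> = (D ** transpose D) $ i $ k"
      by (simp add: matrix_matrix_mult_def transpose_def D_def)
    finally show "(B ** transpose B) $ i $ k = (D ** transpose D) $ i $ k" by (simp add: comp)
  qed
  have sq: "(transpose C *v v) \<bullet> (transpose C *v v) = v \<bullet> ((C ** transpose C) *v v)" for C :: "real^'q^'p" and v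
    by (metis dot_lmul_matrix matrix_vector_mul_assoc transpose_matrix_vector)
  have inv: "invertible D"
  proof -
    have "invertible (transpose D)"
    proof (rule invertibleI_injective)
      fix v assume "transpose D *v v = 0"
      then have "(transpose B *v v) \<bullet> (transpose B *v v) = 0" using sq[of B v] sq[of D v] by (simp add: BD)
      then have "transpose B *v v = transpose B *v 0" by simp
      moreover have "inj ((*v) (transpose B))"
        using assms full_rank_injective[of "transpose B"] by (simp add: rank_transpose)
      ultimately show "v = 0" by (metis injD)
    qed
    then show ?thesis by (simp add: invertible_det_nz)
  qed
  show ?thesis
  proof (cases "CARD('p) = 1 \<longrightarrow> D $ i $ i > 0")
    case True
    then show ?thesis using that[OF BD inv] by blast
  next
    case False
    then have p: "CARD('p) = 1" "D $ i $ i \<le> 0" by auto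
    have m: "(- D) ** transpose (- D) = D ** transpose D"
      by (simp add: vec_eq_iff matrix_matrix_mult_def transpose_def)
    have "UNIV = {i}" using p(1) card_1_singletonE by (metis UNIV_I singletonD)
    then have all: "j = i" for j by auto
    have "D $ i $ i \<noteq> 0"
    proof
      assume "D $ i $ i = 0"
      then have "D $ a $ b = 0" for a b using all[of a] all[of b] by simp
      then have "D = 0" by (simp add: vec_eq_iff)
      then have "D *v 1 = 0" by simp
      then have "(1::real^'p) = 0" using invertible_injectiveD[OF inv] by blast
      then show False by (simp add: vec_eq_iff)
    qed
    then have "(- D) $ i $ i > 0" using p(2) by simp
    moreover have "invertible (- D)"
    proof (rule invertibleI_injective)
      fix v assume "(- D) *v v = 0"
      then have "D *v v = 0" by (simp add: matrix_vector_mult_def vec_eq_iff sum_negf)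
      then show "v = 0" by (rule invertible_injectiveD[OF inv])
    qed
    ultimately show ?thesis using that[of "- D"] BD m by simp
  qed
qed

section \<open>Regime weights, transformed functions and their Riemann sums\<close>

lemma rwgt_bv01:
  assumes "\<And>j. piecewise_mono_C1 (\<phi> j)"
  shows "bv01 (rwgt \<phi> lam i)"
proof -
  have "bv01 (wgt \<phi> k)" for k
  proof (cases k)
    case None
    then show ?thesis using bv01_step[of 0 1 1] by (simp add: wgt_def[abs_def])
  next
    case (Some j)
    then show ?thesis using bv01_piecewise_mono_C1[OF assms[of j]] by (simp add: wgt_def[abs_def])
  qed
  then show ?thesis unfolding rwgt_def[abs_def] by (intro bv01_mult bv01_step)
qed

lemma integral_rwgt:
  assumes "\<And>j. piecewise_mono_C1 (\<phi> j)" "0 < lam" "lam < 1"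
  shows "integral {0..1} (rwgt \<phi> lam (k, True)) = integral {0..lam} (wgt \<phi> k)"
    "integral {0..1} (rwgt \<phi> lam (k, False)) = integral {lam..1} (wgt \<phi> k)"
proof -
  have i: "rwgt \<phi> lam i integrable_on {0..1}" for i by (rule bv01_integrable[OF rwgt_bv01[OF assms(1)]]) auto
  have split: "integral {0..1} (rwgt \<phi> lam i) = integral {0..lam} (rwgt \<phi> lam i) + integral {lam..1} (rwgt \<phi> lam i)" for i
    using Henstock_Kurzweil_Integration.integral_combine[OF _ _ i, of lam] assms by simp
  have a: "integral {0..lam} (rwgt \<phi> lam (k, True)) = integral {0..lam} (wgt \<phi> k)"
    "integral {0..lam} (rwgt \<phi> lam (k, False)) = integral {0..lam} (\<lambda>_. 0)"
    by (rule Henstock_Kurzweil_Integration.integral_cong; simp add: rwgt_def)+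
  \<comment> \<open>The point lam belongs to the first regime; within [lam, 1] it is a null
    set.\<close>
  have b: "integral {lam..1} (rwgt \<phi> lam (k, True)) = integral {lam..1} (\<lambda>_. 0)"
    "integral {lam..1} (rwgt \<phi> lam (k, False)) = integral {lam..1} (wgt \<phi> k)"
    by (rule integral_spike[of "{lam}"]; auto simp: rwgt_def)+
  show "integral {0..1} (rwgt \<phi> lam (k, True)) = integral {0..lam} (wgt \<phi> k)"
    "integral {0..1} (rwgt \<phi> lam (k, False)) = integral {lam..1} (wgt \<phi> k)"
    unfolding split a b by simp_all
qed

lemma rsum_weight_linear:
  "rsum n (\<lambda>r. c * f r) x = c *\<^sub>R rsum n f x"
  "rsum n (\<lambda>r. f r - g r) x = rsum n f x - rsum n g x"
  by (simp_all add: rsum_def scaleR_sum_right scaleR_diff_left sum_subtractf)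

text \<open>The transformed function combines the regime weights exactly as
  \<open>Rmat_cv_limit\<close> combines the scores, so Riemann sums translate one into the
  other.\<close>

lemma phitil_rwgt:
  assumes "\<And>j. piecewise_mono_C1 (\<phi> j)" "0 < lam" "lam < 1"
  defines "\<mu> \<equiv> \<lambda>i. integral {0..1} (rwgt \<phi> lam i)"
  shows "phitil (\<phi> j) lam = (\<lambda>r. (1 / lam) * (rwgt \<phi> lam (Some j, True) r - (\<mu> (Some j, True) / lam) * rwgt \<phi> lam (None, True) r)
     - (1 / (1 - lam)) * (rwgt \<phi> lam (Some j, False) r - (\<mu> (Some j, False) / (1 - lam)) * rwgt \<phi> lam (None, False) r))"
  unfolding \<mu>_def integral_rwgt[OF assms(1-3)] by (auto simp: phitil_def rwgt_def wgt_def[abs_def])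

text \<open>The last left endpoint not exceeding lam has index floor (n lam), and its increment ends
  one grid step later; hence the successor.\<close>

lemma rsum_indicator:
  assumes "0 < lam" "lam < 1" "n > 0"
  shows "rsum n (rwgt \<phi> lam (None, True)) x = x (real (Suc (nat \<lfloor>real n * lam\<rfloor>)) / real n) - x 0"
    "rsum n (rwgt \<phi> lam (None, False)) x = x 1 - x (real (Suc (nat \<lfloor>real n * lam\<rfloor>)) / real n)"
proof -
  define m where "m = Suc (nat \<lfloor>real n * lam\<rfloor>)"
  have "real n * lam < real n * 1" using assms by (intro mult_strict_left_mono) auto
  then have mn: "m \<le> n" unfolding m_def using assms by (simp add: Suc_le_eq nat_less_iff floor_less_iff)
  have le: "real k / real n \<le> lam \<longleftrightarrow> k < m" for k
  proof -
    have "real k / real n \<le> lam \<longleftrightarrow> real k \<le> real n * lam" using assms by (simp add: field_simps)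
    also have "\<dots> \<longleftrightarrow> k < m" unfolding m_def using assms by (simp add: less_Suc_eq_le le_nat_iff le_floor_iff)
    finally show ?thesis .
  qed
  have "rsum n (rwgt \<phi> lam (None, True)) x = (\<Sum>k<n. if k < m then x (real (Suc k) / real n) - x (real k / real n) else 0)"
    unfolding rsum_def by (intro sum.cong refl) (simp add: rwgt_def le)
  also have "\<dots> = (\<Sum>k<m. x (real (Suc k) / real n) - x (real k / real n))"
    using mn by (intro sum.mono_neutral_cong_right) auto
  also have "\<dots> = x (real m / real n) - x 0" by (subst sum_lessThan_telescope[of "\<lambda>k. x (real k / real n)"]) simp
  finally show 1: "rsum n (rwgt \<phi> lam (None, True)) x = x (real (Suc (nat \<lfloor>real n * lam\<rfloor>)) / real n) - x 0"
    unfolding m_def .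
  have "rsum n (rwgt \<phi> lam (None, True)) x + rsum n (rwgt \<phi> lam (None, False)) x = (\<Sum>k<n. x (real (Suc k) / real n) - x (real k / real n))"
    unfolding rsum_def sum.distrib[symmetric] by (intro sum.cong refl) (simp add: rwgt_def)
  also have "\<dots> = x 1 - x 0" using assms by (subst sum_lessThan_telescope[of "\<lambda>k. x (real k / real n)"]) simp
  finally show "rsum n (rwgt \<phi> lam (None, False)) x = x 1 - x (real (Suc (nat \<lfloor>real n * lam\<rfloor>)) / real n)"
    using 1 by (simp add: algebra_simps)
qed

lemma rsum_indicator_tendsto:
  fixes x :: "real \<Rightarrow> 'v::real_normed_vector"
  assumes lam: "0 < lam" "lam < 1" and x: "continuous_on {0..1} x"
  shows "(\<lambda>n. rsum n (rwgt \<phi> lam (None, True)) x) \<longlonglongrightarrow> x lam - x 0"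
    "(\<lambda>n. rsum n (rwgt \<phi> lam (None, False)) x) \<longlonglongrightarrow> x 1 - x lam"
proof -
  define q where "q n = real (Suc (nat \<lfloor>real n * lam\<rfloor>)) / real n" for n
  have q: "\<bar>q n - lam\<bar> \<le> 1 / real n" "q n \<in> {0..1}" if n: "n > 0" for n
  proof -
    have f: "real (nat \<lfloor>real n * lam\<rfloor>) \<le> real n * lam" "real n * lam < real (nat \<lfloor>real n * lam\<rfloor>) + 1"
      using lam by (auto simp: of_nat_nat)
    moreover have "real n * q n = real (nat \<lfloor>real n * lam\<rfloor>) + 1" using n by (simp add: q_def)
    ultimately have "0 \<le> real n * (q n - lam)" "real n * (q n - lam) \<le> 1"
      unfolding right_diff_distrib by linarith+
    then show "\<bar>q n - lam\<bar> \<le> 1 / real n" using n by (auto simp: field_simps abs_le_iff zero_le_mult_iff)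
    have "real n * lam < real n * 1" using lam n by (intro mult_strict_left_mono) auto
    then have "Suc (nat \<lfloor>real n * lam\<rfloor>) \<le> n" using lam by (simp add: Suc_le_eq nat_less_iff floor_less_iff)
    then have "real (Suc (nat \<lfloor>real n * lam\<rfloor>)) \<le> real n" by (simp only: of_nat_le_iff)
    then show "q n \<in> {0..1}" using n unfolding q_def by (simp del: of_nat_Suc)
  qed
  have "(\<lambda>n. q n - lam) \<longlonglongrightarrow> 0"
  proof (rule Lim_null_comparison)
    show "\<forall>\<^sub>F n in sequentially. norm (q n - lam) \<le> 1 / real n"
      using eventually_gt_at_top[of 0] by eventually_elim (use q in auto)
  qed (rule lim_const_over_n)
  then have "q \<longlonglongrightarrow> lam" by (simp add: LIM_zero_iff)
  then have xq: "(\<lambda>n. x (q n)) \<longlonglongrightarrow> x lam"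
    using lam by (intro continuous_on_tendsto_compose[OF x]) (auto intro!: eventually_mono[OF eventually_gt_at_top[of 0]] dest: q(2))
  show "(\<lambda>n. rsum n (rwgt \<phi> lam (None, True)) x) \<longlonglongrightarrow> x lam - x 0"
  proof (rule Lim_transform_eventually)
    show "(\<lambda>n. x (q n) - x 0) \<longlonglongrightarrow> x lam - x 0" by (intro tendsto_intros xq)
    show "\<forall>\<^sub>F n in sequentially. x (q n) - x 0 = rsum n (rwgt \<phi> lam (None, True)) x"
      using eventually_gt_at_top[of 0] by eventually_elim (simp only: rsum_indicator[OF lam] q_def)
  qed
  show "(\<lambda>n. rsum n (rwgt \<phi> lam (None, False)) x) \<longlonglongrightarrow> x 1 - x lam"
  proof (rule Lim_transform_eventually)
    show "(\<lambda>n. x 1 - x (q n)) \<longlonglongrightarrow> x 1 - x lam" by (intro tendsto_intros xq)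
    show "\<forall>\<^sub>F n in sequentially. x 1 - x (q n) = rsum n (rwgt \<phi> lam (None, False)) x"
      using eventually_gt_at_top[of 0] by eventually_elim (simp only: rsum_indicator[OF lam] q_def)
  qed
qed

text \<open>Riemann-sum version of the pair of limits in (a) and (b). It is linear in the path and
  involves finitely many of its values, so a matrix can be moved inside and laws can be
  compared.\<close>

definition approx_limit :: "('k::finite \<Rightarrow> real \<Rightarrow> real) \<Rightarrow> real \<Rightarrow> nat \<Rightarrow> (real \<Rightarrow> real^'p) \<Rightarrow> (real^'p) \<times> (real^'p^'k)" where
  "approx_limit \<phi> lam n x =
     ((1 / lam) *\<^sub>R rsum n (rwgt \<phi> lam (None, True)) x - (1 / (1 - lam)) *\<^sub>R rsum n (rwgt \<phi> lam (None, False)) x,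
      \<chi> j. rsum n (phitil (\<phi> j) lam) x)"

lemma borel_measurable_approx_limit:
  assumes "\<And>r. r \<in> {0..1} \<Longrightarrow> (\<lambda>\<omega>. x \<omega> r) \<in> borel_measurable M"
  shows "(\<lambda>\<omega>. approx_limit \<phi> lam n (x \<omega>)) \<in> borel_measurable M"
  unfolding approx_limit_def using assms
  by (intro borel_measurable_Pair borel_measurable_diff borel_measurable_scaleR borel_measurable_const
      borel_measurable_vec_lambda borel_measurable_rsum) auto

lemma fin_lin_approx_limit: "fin_lin (\<lambda>x. t \<bullet> approx_limit \<phi> lam n x)"
proof -
  have "fin_lin (\<lambda>x. ((1 / lam) *\<^sub>R fst t) \<bullet> rsum n (rwgt \<phi> lam (None, True)) x
      + (- (1 / (1 - lam)) *\<^sub>R fst t) \<bullet> rsum n (rwgt \<phi> lam (None, False)) x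
      + (\<Sum>j\<in>UNIV. (snd t $ j) \<bullet> rsum n (phitil (\<phi> j) lam) x))"
    by (intro fin_lin_add fin_lin_sum fin_lin_rsum) auto
  moreover have "(\<lambda>x. t \<bullet> approx_limit \<phi> lam n x) = (\<lambda>x. ((1 / lam) *\<^sub>R fst t) \<bullet> rsum n (rwgt \<phi> lam (None, True)) x
      + (- (1 / (1 - lam)) *\<^sub>R fst t) \<bullet> rsum n (rwgt \<phi> lam (None, False)) x
      + (\<Sum>j\<in>UNIV. (snd t $ j) \<bullet> rsum n (phitil (\<phi> j) lam) x))"
    by (auto simp: approx_limit_def inner_prod_def inner_diff_right inner_vec_def[of "snd t"])
  ultimately show ?thesis by simp
qed

definition bm_contrast :: "(real \<Rightarrow> real^'n) \<Rightarrow> real \<Rightarrow> real^'n" where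
  "bm_contrast x lam = (1 / lam) *\<^sub>R (x lam - x 0) - (1 / (1 - lam)) *\<^sub>R (x 1 - x lam)"

text \<open>The contrast converges along almost every path by continuity, the Wiener integrals
  converge in probability by their definition; the truncated distance covers both modes at
  once.\<close>

lemma conv_distr_approx_limit:
  fixes W :: "real \<Rightarrow> 'a \<Rightarrow> real^'n" and \<phi> :: "'k::finite \<Rightarrow> real \<Rightarrow> real"
  assumes BM: "std_BM M W" and lam: "0 < lam" "lam < 1"
    and IW: "\<And>j. wiener_int M W (\<lambda>r. phitil (\<phi> j) lam r) (IW j)"
  shows "conv_distr M (\<lambda>n \<omega>. approx_limit \<phi> lam n (\<lambda>r. W r \<omega>)) M
     (\<lambda>\<omega>. (bm_contrast (\<lambda>r. W r \<omega>) lam, \<chi> j. IW j \<omega>))"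
proof -
  have M: "prob_space M" and W: "\<And>t. t \<in> {0..1} \<Longrightarrow> W t \<in> borel_measurable M"
    and cont: "AE \<omega> in M. continuous_on {0..1} (\<lambda>t. W t \<omega>)"
    using BM by (auto simp: std_BM_def)
  interpret prob_space M by fact
  have W3[measurable]: "W 0 \<in> borel_measurable M" "W 1 \<in> borel_measurable M" "W lam \<in> borel_measurable M"
    using W lam by auto
  have IWm[measurable]: "IW j \<in> borel_measurable M" for j using IW[of j] by (simp add: wiener_int_def)
  let ?v = "\<lambda>n \<omega>. fst (approx_limit \<phi> lam n (\<lambda>r. W r \<omega>))"
  have Am[measurable]: "(\<lambda>\<omega>. approx_limit \<phi> lam n (\<lambda>r. W r \<omega>)) \<in> borel_measurable M" for n
    using W by (rule borel_measurable_approx_limit)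
  have Rm[measurable]: "(\<lambda>\<omega>. rsum n f (\<lambda>r. W r \<omega>)) \<in> borel_measurable M" for n f
    using W by (rule borel_measurable_rsum)
  have bm[measurable]: "(\<lambda>\<omega>. bm_contrast (\<lambda>r. W r \<omega>) lam) \<in> borel_measurable M"
    unfolding bm_contrast_def by measurable
  have vm[measurable]: "?v n \<in> borel_measurable M" for n
    unfolding approx_limit_def fst_conv by measurable
  show ?thesis
  proof (rule conv_distr_in_prob[OF M Am])
    show "(\<lambda>\<omega>. (bm_contrast (\<lambda>r. W r \<omega>) lam, \<chi> j. IW j \<omega>)) \<in> borel_measurable M" by measurable
    have 1: "(\<lambda>n. \<integral>\<omega>. min 1 (dist (bm_contrast (\<lambda>r. W r \<omega>) lam) (?v n \<omega>)) \<partial>M) \<longlonglongrightarrow> 0"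
    proof -
      have "(\<lambda>n. \<integral>\<omega>. min 1 (dist (bm_contrast (\<lambda>r. W r \<omega>) lam) (?v n \<omega>)) \<partial>M) \<longlonglongrightarrow> (\<integral>\<omega>. 0 \<partial>M)"
      proof (rule integral_dominated_convergence[where w="\<lambda>_. 1"])
        show "AE \<omega> in M. (\<lambda>n. min 1 (dist (bm_contrast (\<lambda>r. W r \<omega>) lam) (?v n \<omega>))) \<longlonglongrightarrow> 0"
          using cont
        proof eventually_elim
          case (elim \<omega>)
          have "(\<lambda>n. ?v n \<omega>) \<longlonglongrightarrow> bm_contrast (\<lambda>r. W r \<omega>) lam"
            unfolding approx_limit_def fst_conv bm_contrast_def
            by (intro tendsto_intros rsum_indicator_tendsto[OF lam elim])
          then have "(\<lambda>n. min 1 (dist (bm_contrast (\<lambda>r. W r \<omega>) lam) (?v n \<omega>))) \<longlonglongrightarrow> min 1 (dist (bm_contrast (\<lambda>r. W r \<omega>) lam) (bm_contrast (\<lambda>r. W r \<omega>) lam))"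
            by (intro tendsto_intros)
          then show ?case by simp
        qed
      qed auto
      then show ?thesis by simp
    qed
    have 2: "(\<lambda>n. \<integral>\<omega>. min 1 (dist (IW j \<omega>) (rsum n (phitil (\<phi> j) lam) (\<lambda>r. W r \<omega>))) \<partial>M) \<longlonglongrightarrow> 0" for j
    proof (rule tendsto_prob_imp_truncated_mean[OF M])
      fix e :: real assume "e > 0"
      then show "(\<lambda>n. measure M {\<omega>\<in>space M. dist (IW j \<omega>) (rsum n (phitil (\<phi> j) lam) (\<lambda>r. W r \<omega>)) > e}) \<longlonglongrightarrow> 0"
        using IW[of j] unfolding wiener_int_def rsum_def by (simp add: dist_commute)
    qed auto
    show "(\<lambda>n. \<integral>\<omega>. min 1 (dist (bm_contrast (\<lambda>r. W r \<omega>) lam, \<chi> j. IW j \<omega>) (approx_limit \<phi> lam n (\<lambda>r. W r \<omega>))) \<partial>M) \<longlonglongrightarrow> 0"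
    proof (rule tendsto_sandwich[OF _ _ tendsto_const])
      let ?b = "\<lambda>n. (\<integral>\<omega>. min 1 (dist (bm_contrast (\<lambda>r. W r \<omega>) lam) (?v n \<omega>)) \<partial>M)
          + (\<Sum>j\<in>UNIV. \<integral>\<omega>. min 1 (dist (IW j \<omega>) (rsum n (phitil (\<phi> j) lam) (\<lambda>r. W r \<omega>))) \<partial>M)"
      have "?b \<longlonglongrightarrow> 0 + (\<Sum>j\<in>(UNIV :: 'k set). 0)" by (intro tendsto_add 1 tendsto_sum 2)
      then show "?b \<longlonglongrightarrow> 0" by simp
      show "\<forall>\<^sub>F n in sequentially. (\<integral>\<omega>. min 1 (dist (bm_contrast (\<lambda>r. W r \<omega>) lam, \<chi> j. IW j \<omega>) (approx_limit \<phi> lam n (\<lambda>r. W r \<omega>))) \<partial>M) \<le> ?b n"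
      proof (intro always_eventually allI)
        fix n
        have i0: "integrable M (\<lambda>\<omega>. min 1 (dist (bm_contrast (\<lambda>r. W r \<omega>) lam, \<chi> j. IW j \<omega>) (approx_limit \<phi> lam n (\<lambda>r. W r \<omega>))))"
          by (rule prob_integrable_bounded[OF M, where C=1]) auto
        have i1: "integrable M (\<lambda>\<omega>. min 1 (dist (bm_contrast (\<lambda>r. W r \<omega>) lam) (?v n \<omega>)))"
          by (rule prob_integrable_bounded[OF M, where C=1]) auto
        have i2: "integrable M (\<lambda>\<omega>. min 1 (dist (IW j \<omega>) (rsum n (phitil (\<phi> j) lam) (\<lambda>r. W r \<omega>))))" for j
          by (rule prob_integrable_bounded[OF M, where C=1]) auto
        have "(\<integral>\<omega>. min 1 (dist (bm_contrast (\<lambda>r. W r \<omega>) lam, \<chi> j. IW j \<omega>) (approx_limit \<phi> lam n (\<lambda>r. W r \<omega>))) \<partial>M)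
          \<le> (\<integral>\<omega>. min 1 (dist (bm_contrast (\<lambda>r. W r \<omega>) lam) (?v n \<omega>))
             + (\<Sum>j\<in>UNIV. min 1 (dist (IW j \<omega>) (rsum n (phitil (\<phi> j) lam) (\<lambda>r. W r \<omega>)))) \<partial>M)"
        proof (rule integral_mono)
          fix \<omega>
          have "min 1 (dist (\<chi> j. IW j \<omega>) (\<chi> j. rsum n (phitil (\<phi> j) lam) (\<lambda>r. W r \<omega>))) \<le> (\<Sum>j\<in>UNIV. min 1 (dist (IW j \<omega>) (rsum n (phitil (\<phi> j) lam) (\<lambda>r. W r \<omega>))))"
            by (rule order_trans[OF min_1_dist_vec_le]) simp
          then show "min 1 (dist (bm_contrast (\<lambda>r. W r \<omega>) lam, \<chi> j. IW j \<omega>) (approx_limit \<phi> lam n (\<lambda>r. W r \<omega>)))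
            \<le> min 1 (dist (bm_contrast (\<lambda>r. W r \<omega>) lam) (?v n \<omega>))
             + (\<Sum>j\<in>UNIV. min 1 (dist (IW j \<omega>) (rsum n (phitil (\<phi> j) lam) (\<lambda>r. W r \<omega>))))"
            unfolding approx_limit_def fst_conv by (rule order_trans[OF min_1_dist_Pair_le add_left_mono])
        qed (use i0 i1 i2 in auto)
        also have "\<dots> = ?b n" using i1 i2 by simp
        finally show "(\<integral>\<omega>. min 1 (dist (bm_contrast (\<lambda>r. W r \<omega>) lam, \<chi> j. IW j \<omega>) (approx_limit \<phi> lam n (\<lambda>r. W r \<omega>))) \<partial>M) \<le> ?b n" .
      qed
      show "\<forall>\<^sub>F n in sequentially. 0 \<le> (\<integral>\<omega>. min 1 (dist (bm_contrast (\<lambda>r. W r \<omega>) lam, \<chi> j. IW j \<omega>) (approx_limit \<phi> lam n (\<lambda>r. W r \<omega>))) \<partial>M)"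
        by (intro always_eventually allI Bochner_Integration.integral_nonneg) auto
    qed
  qed
qed

section \<open>Measurability and continuity of the statistics\<close>

lemma borel_measurable_case_sum [measurable (raw)]:
  assumes "\<And>i. (\<lambda>x. f x i) \<in> borel_measurable M" "\<And>j. (\<lambda>x. g x j) \<in> borel_measurable M"
  shows "(\<lambda>x. case k of Inl i \<Rightarrow> f x i | Inr j \<Rightarrow> g x j) \<in> borel_measurable M"
  using assms by (cases k) auto

lemma continuous_on_case_sum [continuous_intros]:
  assumes "\<And>i. continuous_on S (\<lambda>x. f x i)" "\<And>j. continuous_on S (\<lambda>x. g x j)"
  shows "continuous_on S (\<lambda>x. case k of Inl i \<Rightarrow> f x i | Inr j \<Rightarrow> g x j)"
  using assms by (cases k) auto

context
  fixes P :: "'a measure" and X :: "nat \<Rightarrow> 'a \<Rightarrow> real^'m" and Z :: "nat \<Rightarrow> 'a \<Rightarrow> real^'l"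
    and Y :: "nat \<Rightarrow> 'a \<Rightarrow> real"
  assumes XZY[measurable]: "\<And>t. X t \<in> borel_measurable P" "\<And>t. Z t \<in> borel_measurable P" "\<And>t. Y t \<in> borel_measurable P"
begin

lemma borel_measurable_Szz [measurable]: "(\<lambda>\<omega>. Szz T (\<lambda>t. Z t \<omega>)) \<in> borel_measurable P"
  unfolding Szz_def by measurable

lemma borel_measurable_Xtil [measurable]: "(\<lambda>\<omega>. Xtil lam T (X t \<omega>) t) \<in> borel_measurable P"
  unfolding Xtil_def by measurable

lemma borel_measurable_Xz [measurable]: "(\<lambda>\<omega>. Xz lam T (\<lambda>t. X t \<omega>) (\<lambda>t. Z t \<omega>) t) \<in> borel_measurable P"
  unfolding Xz_def by measurable

lemma borel_measurable_Yz [measurable]: "(\<lambda>\<omega>. Yz T (\<lambda>t. Z t \<omega>) (\<lambda>t. Y t \<omega>) t) \<in> borel_measurable P"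
  unfolding Yz_def by measurable

lemma borel_measurable_SXX [measurable]: "(\<lambda>\<omega>. SXX lam T (\<lambda>t. X t \<omega>) (\<lambda>t. Z t \<omega>)) \<in> borel_measurable P"
  unfolding SXX_def by measurable

lemma borel_measurable_Qhat [measurable]: "(\<lambda>\<omega>. Qhat lam T (\<lambda>t. X t \<omega>) (\<lambda>t. Z t \<omega>)) \<in> borel_measurable P"
  unfolding Qhat_def by measurable

lemma borel_measurable_bhat [measurable]: "(\<lambda>\<omega>. bhat lam T (\<lambda>t. X t \<omega>) (\<lambda>t. Z t \<omega>) (\<lambda>t. Y t \<omega>)) \<in> borel_measurable P"
  unfolding bhat_def by measurable

lemma borel_measurable_uhat [measurable]: "(\<lambda>\<omega>. uhat lam T (\<lambda>t. X t \<omega>) (\<lambda>t. Z t \<omega>) (\<lambda>t. Y t \<omega>) t) \<in> borel_measurable P"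
  unfolding uhat_def by measurable

lemma borel_measurable_vj [measurable]: "(\<lambda>\<omega>. vj lam T (\<lambda>t. X t \<omega>) (\<lambda>t. Z t \<omega>) (\<lambda>t. Y t \<omega>) f) \<in> borel_measurable P"
  unfolding vj_def by measurable

lemma borel_measurable_Omega_hat [measurable]: "(\<lambda>\<omega>. Omega_hat lam T (\<lambda>t. X t \<omega>) (\<lambda>t. Z t \<omega>) (\<lambda>t. Y t \<omega>) \<phi>) \<in> borel_measurable P"
  unfolding Omega_hat_def by measurable

lemma borel_measurable_Vhat [measurable]: "(\<lambda>\<omega>. Vhat Rc lam T (\<lambda>t. X t \<omega>) (\<lambda>t. Z t \<omega>) (\<lambda>t. Y t \<omega>) \<phi>) \<in> borel_measurable P"
  unfolding Vhat_def by measurable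

lemma borel_measurable_Fstat [measurable]: "(\<lambda>\<omega>. Fstat Rc lam T (\<lambda>t. X t \<omega>) (\<lambda>t. Z t \<omega>) (\<lambda>t. Y t \<omega>) \<phi>) \<in> borel_measurable P"
  unfolding Fstat_def by measurable

lemma borel_measurable_tstat [measurable]: "(\<lambda>\<omega>. tstat Rc lam T (\<lambda>t. X t \<omega>) (\<lambda>t. Z t \<omega>) (\<lambda>t. Y t \<omega>) \<phi> i) \<in> borel_measurable P"
  unfolding tstat_def by measurable

end

lemma borel_measurable_Ymod:
  assumes [measurable]: "\<And>t. X t \<in> borel_measurable P" "\<And>t. Z t \<in> borel_measurable P" "\<And>t. u t \<in> borel_measurable P"
  shows "(\<lambda>\<omega>. Ymod lam T b1 b2 g (\<lambda>t. X t \<omega>) (\<lambda>t. Z t \<omega>) (\<lambda>t. u t \<omega>) t) \<in> borel_measurable P"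
  unfolding Ymod_def by measurable

section \<open>The statistics as a map of moments and scores\<close>

definition good_moments :: "(('m::finite + 'l::finite, 'k::finite) moments \<times> ('m + 'l, 'k) scores) set" where
  "good_moments = {x. invertible (sZZ (fst x) None) \<and> invertible (cXX (fst x) None)}"

text \<open>Parts (a) and (b) at once, as a map that is continuous on \<open>good_moments\<close>.
  Under the null hypothesis the F and t statistics are functions of this pair, so one joint limit
  serves all parts.\<close>

definition stat_map :: "real^'m^'p \<Rightarrow> ('m::finite + 'l::finite, 'k::finite) moments \<times> ('m + 'l, 'k) scores \<Rightarrow> (real^'p) \<times> (real^'p^'k)" where
  "stat_map Rc x = (Rmat Rc *v cq (fst x) (snd x),
     \<chi> j. Rmat Rc *v (matrix_inv (cXX (fst x) None) *v cv (fst x) (snd x) j))"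

lemma continuous_on_sample_moments [continuous_intros]:
  fixes f :: "'z::topological_space \<Rightarrow> ('m::finite + 'l::finite, 'k::finite) moments"
  assumes f: "continuous_on S f"
  shows "continuous_on S (\<lambda>x. sZZ (f x) k)" "continuous_on S (\<lambda>x. sXZ (f x) k)" "continuous_on S (\<lambda>x. sXX (f x) k)"
  unfolding sZZ_def sXZ_def sXX_def mZZ_def mXZ_def QXX_def
  using f by (auto intro!: continuous_intros continuous_on_vec_lambda)

lemma continuous_on_sample_scores [continuous_intros]:
  fixes h :: "'z::topological_space \<Rightarrow> ('m::finite + 'l::finite, 'k::finite) scores"
  assumes h: "continuous_on S h"
  shows "continuous_on S (\<lambda>x. sXu (h x) k)" "continuous_on S (\<lambda>x. sZu (h x) k)"
  unfolding sXu_def sZu_def stack_def pX_def pZ_def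
  using h by (auto intro!: continuous_intros continuous_on_vec_lambda)

lemma continuous_on_partialled:
  fixes f :: "'z::topological_space \<Rightarrow> ('m::finite + 'l::finite, 'k::finite) moments"
  assumes f: "continuous_on S f" and i: "\<And>x. x \<in> S \<Longrightarrow> invertible (sZZ (f x) None)"
  shows "continuous_on S (\<lambda>x. cD (f x))" "continuous_on S (\<lambda>x. cXZ (f x) k)" "continuous_on S (\<lambda>x. cXX (f x) k)"
proof -
  show D: "continuous_on S (\<lambda>x. cD (f x))"
    unfolding cD_def by (intro continuous_intros f i)
  show "continuous_on S (\<lambda>x. cXZ (f x) k)" "continuous_on S (\<lambda>x. cXX (f x) k)"
    unfolding cXZ_def cXX_def by (intro continuous_intros f D)+
qed

lemma continuous_on_stat_map: "continuous_on good_moments (stat_map Rc)"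
proof -
  have i: "invertible (sZZ (fst x) None)" "invertible (cXX (fst x) None)" if "x \<in> good_moments" for x
    using that by (auto simp: good_moments_def)
  note f = continuous_on_partialled[OF continuous_on_fst[OF continuous_on_id] i(1)]
  have xu: "continuous_on good_moments (\<lambda>x. cXu (fst x) (snd x) k)" for k
    unfolding cXu_def by (intro continuous_intros f)
  have q: "continuous_on good_moments (\<lambda>x. cq (fst x) (snd x))"
    unfolding cq_def by (intro continuous_intros f xu i)
  show ?thesis
    unfolding stat_map_def cv_def by (intro continuous_intros continuous_on_vec_lambda f xu q i)
qed

text \<open>Two stages, because the continuity of \<open>cXX\<close> is available only where
  \<open>sZZ\<close> is invertible.\<close>

lemma open_good_moments: "open (good_moments :: (('m::finite + 'l::finite, 'k::finite) moments \<times> ('m + 'l, 'k) scores) set)"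
proof -
  define U :: "(('m + 'l, 'k) moments \<times> ('m + 'l, 'k) scores) set"
    where "U = (\<lambda>x. sZZ (fst x) None) -` {A. invertible A}"
  have U: "open U" unfolding U_def
    by (intro open_vimage open_invertible continuous_intros)
  have "open (U \<inter> (\<lambda>x. cXX (fst x) None) -` {A. invertible A})"
    by (intro continuous_open_preimage U open_invertible continuous_on_partialled continuous_intros) (auto simp: U_def)
  also have "U \<inter> (\<lambda>x. cXX (fst x) None) -` {A. invertible A} = good_moments"
    by (auto simp: U_def good_moments_def)
  finally show ?thesis .
qed

lemma borel_measurable_transpose [measurable (raw)]:
  fixes f :: "'a \<Rightarrow> real^'n^'m"
  assumes [measurable]: "f \<in> borel_measurable M"
  shows "(\<lambda>x. transpose (f x)) \<in> borel_measurable M"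
  unfolding transpose_def by measurable

lemma borel_measurable_stat_map:
  "(stat_map Rc :: ('m::finite + 'l::finite, 'k::finite) moments \<times> ('m + 'l, 'k) scores \<Rightarrow> _) \<in> borel_measurable borel"
proof -
  have [measurable]: "(\<lambda>x :: ('m + 'l, 'k) moments \<times> ('m + 'l, 'k) scores. sZZ (fst x) k) \<in> borel_measurable borel" "(\<lambda>x :: ('m + 'l, 'k) moments \<times> ('m + 'l, 'k) scores. sXZ (fst x) k) \<in> borel_measurable borel"
    "(\<lambda>x :: ('m + 'l, 'k) moments \<times> ('m + 'l, 'k) scores. sXX (fst x) k) \<in> borel_measurable borel" "(\<lambda>x :: ('m + 'l, 'k) moments \<times> ('m + 'l, 'k) scores. sXu (snd x) k) \<in> borel_measurable borel" "(\<lambda>x :: ('m + 'l, 'k) moments \<times> ('m + 'l, 'k) scores. sZu (snd x) k) \<in> borel_measurable borel"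
    for k :: "'k option"
    by (auto intro!: borel_measurable_continuous_onI continuous_intros)
  show ?thesis
    unfolding stat_map_def[abs_def] cv_def cq_def cXu_def cXX_def cXZ_def cD_def by measurable
qed

lemma truncated_mean_vec:
  fixes a :: "'e::euclidean_space^'i" and A :: "nat \<Rightarrow> 'a \<Rightarrow> 'e^'i"
  assumes P: "prob_space P" and A[measurable]: "\<And>T. A T \<in> borel_measurable P"
    and lim: "\<And>i. (\<lambda>T. \<integral>\<omega>. min 1 (dist (a $ i) (A T \<omega> $ i)) \<partial>P) \<longlonglongrightarrow> 0"
  shows "(\<lambda>T. \<integral>\<omega>. min 1 (dist a (A T \<omega>)) \<partial>P) \<longlonglongrightarrow> 0"
proof (rule tendsto_sandwich[OF _ _ tendsto_const])
  interpret prob_space P by fact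
  let ?b = "\<lambda>T. \<Sum>i\<in>UNIV. \<integral>\<omega>. min 1 (dist (a $ i) (A T \<omega> $ i)) \<partial>P"
  have "?b \<longlonglongrightarrow> (\<Sum>i\<in>(UNIV :: 'i set). 0)" by (intro tendsto_sum lim)
  then show "?b \<longlonglongrightarrow> 0" by simp
  have i0: "integrable P (\<lambda>\<omega>. min 1 (dist a (A T \<omega>)))" for T
    by (rule prob_integrable_bounded[OF P, where C=1]) auto
  have i1: "integrable P (\<lambda>\<omega>. min 1 (dist (a $ i) (A T \<omega> $ i)))" for T i
    by (rule prob_integrable_bounded[OF P, where C=1]) auto
  show "\<forall>\<^sub>F T in sequentially. (\<integral>\<omega>. min 1 (dist a (A T \<omega>)) \<partial>P) \<le> ?b T"
  proof (intro always_eventually allI)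
    fix T
    have "(\<integral>\<omega>. min 1 (dist a (A T \<omega>)) \<partial>P) \<le> (\<integral>\<omega>. (\<Sum>i\<in>UNIV. min 1 (dist (a $ i) (A T \<omega> $ i))) \<partial>P)"
      by (rule integral_mono) (use i0 i1 min_1_dist_vec_le in auto)
    also have "\<dots> = ?b T" using i1 by simp
    finally show "(\<integral>\<omega>. min 1 (dist a (A T \<omega>)) \<partial>P) \<le> ?b T" .
  qed
  show "\<forall>\<^sub>F T in sequentially. 0 \<le> (\<integral>\<omega>. min 1 (dist a (A T \<omega>)) \<partial>P)"
    by (intro always_eventually allI Bochner_Integration.integral_nonneg) auto
qed

text \<open>On the open set U the indicator is constant, so the mapping lemma for open sets applies
  to it although it may jump at the boundary.\<close>

lemma prob_open_tendsto_1:
  fixes Xs :: "nat \<Rightarrow> 'a \<Rightarrow> 'e::euclidean_space"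
  assumes P: "prob_space P" and M: "prob_space M"
    and Xs[measurable]: "\<And>T. Xs T \<in> borel_measurable P" and X: "X \<in> borel_measurable M"
    and conv: "conv_distr P Xs M X" and U: "open U" "AE \<omega> in M. X \<omega> \<in> U"
  shows "(\<lambda>T. measure P {\<omega>\<in>space P. Xs T \<omega> \<in> U}) \<longlonglongrightarrow> 1"
proof -
  interpret P: prob_space P by fact
  interpret M: prob_space M by fact
  have [measurable]: "U \<in> sets borel" using U(1) by simp
  have "conv_distr P (\<lambda>T \<omega>. indicat_real U (Xs T \<omega>)) M (\<lambda>\<omega>. indicat_real U (X \<omega>))"
  proof (rule conv_distr_continuous_on_open[OF P M Xs X conv U])
    show "continuous_on U (indicat_real U)" by (rule continuous_on_eq[OF continuous_on_const[of _ 1]]) auto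
  qed measurable
  \<comment> \<open>Clipping to [0,1] turns the identity into a bounded test function without
    changing the values of an indicator.\<close>
  then have "(\<lambda>T. \<integral>\<omega>. max 0 (min 1 (indicat_real U (Xs T \<omega>))) \<partial>P) \<longlonglongrightarrow> (\<integral>\<omega>. max 0 (min 1 (indicat_real U (X \<omega>))) \<partial>M)"
    by (rule conv_distrD[where C=1]) (auto intro!: continuous_intros)
  moreover have "max 0 (min 1 (indicat_real U x)) = indicat_real U x" for x by (auto simp: indicator_def)
  moreover have "(\<integral>\<omega>. indicat_real U (Xs T \<omega>) \<partial>P) = measure P {\<omega>\<in>space P. Xs T \<omega> \<in> U}" for T
  proof -
    have "(\<integral>\<omega>. indicat_real U (Xs T \<omega>) \<partial>P) = (\<integral>\<omega>. indicat_real {\<omega>\<in>space P. Xs T \<omega> \<in> U} \<omega> \<partial>P)"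
      by (intro Bochner_Integration.integral_cong) (auto simp: indicator_def)
    also have "\<dots> = measure P {\<omega>\<in>space P. Xs T \<omega> \<in> U}" by simp
    finally show ?thesis .
  qed
  moreover have "(\<integral>\<omega>. indicat_real U (X \<omega>) \<partial>M) = 1"
  proof -
    have "(\<integral>\<omega>. indicat_real U (X \<omega>) \<partial>M) = (\<integral>\<omega>. 1 \<partial>M)"
      using X U by (intro integral_cong_AE) (auto elim!: eventually_mono)
    then show ?thesis by (simp add: M.prob_space)
  qed
  ultimately show ?thesis by simp
qed

section \<open>Asymptotic distributions\<close>

text \<open>Sample moment matrices have both properties, and Q is a limit of realisations of them;
  the law of large numbers thus supplies the symmetry and positivity of Q.\<close>

lemma lln_limit_psd:
  fixes \<xi> :: "nat \<Rightarrow> 'a \<Rightarrow> real^'n" and Q :: "real^'n^'n"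
  assumes P: "prob_space P" and \<xi>[measurable]: "\<And>t. \<xi> t \<in> borel_measurable P"
    and lln: "\<And>e. e > 0 \<Longrightarrow> (\<lambda>T. measure P {\<omega>\<in>space P. \<exists>r\<in>{0..1}.
       norm ((1 / real T) *\<^sub>R (\<Sum>t\<in>{1..nat \<lfloor>real T * r\<rfloor>}. outer (\<xi> t \<omega>) (\<xi> t \<omega>)) - r *\<^sub>R Q) > e}) \<longlonglongrightarrow> 0"
  shows "transpose Q = Q" "v \<bullet> (Q *v v) \<ge> 0"
proof -
  have "\<exists>S::real^'n^'n. transpose S = S \<and> (\<forall>v. v \<bullet> (S *v v) \<ge> 0) \<and> norm (S - Q) \<le> 1 / real (Suc n)" for n
  proof -
    obtain T \<omega> where T: "norm ((1 / real T) *\<^sub>R (\<Sum>t\<in>{1..T}. outer (\<xi> t \<omega>) (\<xi> t \<omega>)) - Q) \<le> 1 / real (Suc n)"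
      by (rule lln_approximable[OF P _ lln, of "1 / real (Suc n)"]) auto
    let ?S = "(1 / real T) *\<^sub>R (\<Sum>t\<in>{1..T}. outer (\<xi> t \<omega>) (\<xi> t \<omega>))"
    have "transpose ?S = ?S" by (simp add: transpose_scaleR_matrix transpose_sum transpose_outer)
    moreover have "v \<bullet> (?S *v v) \<ge> 0" for v
    proof -
      have "v \<bullet> (?S *v v) = (1 / real T) * (\<Sum>t\<in>{1..T}. (\<xi> t \<omega> \<bullet> v)\<^sup>2)"
        by (simp add: matrix_scaleR_vector matrix_vector_mult_sum_left outer_mult_vec inner_sum_right power2_eq_square inner_commute)
      also have "\<dots> \<ge> 0" by (intro mult_nonneg_nonneg sum_nonneg) auto
      finally show ?thesis .
    qed
    ultimately show ?thesis using T by blast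
  qed
  then obtain S where S: "\<And>n. transpose (S n) = S n" "\<And>n v. v \<bullet> (S n *v v) \<ge> 0" "\<And>n. norm (S n - Q) \<le> 1 / real (Suc n)"
    by metis
  have "(\<lambda>n. S n - Q) \<longlonglongrightarrow> 0"
  proof (rule Lim_null_comparison)
    show "\<forall>\<^sub>F n in sequentially. norm (S n - Q) \<le> 1 / real (Suc n)" using S(3) by (intro always_eventually allI)
    show "(\<lambda>n. 1 / real (Suc n)) \<longlonglongrightarrow> 0" by (rule LIMSEQ_Suc[OF lim_const_over_n])
  qed
  then have lim: "S \<longlonglongrightarrow> Q" by (rule LIM_zero_cancel)
  have "continuous_on UNIV (\<lambda>S::real^'n^'n. transpose S)" by (intro continuous_intros)
  then have "(\<lambda>n. transpose (S n)) \<longlonglongrightarrow> transpose Q"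
    by (rule continuous_on_tendsto_compose[OF _ lim]) auto
  then show "transpose Q = Q" using lim unfolding S(1) by (rule LIMSEQ_unique)
  have "continuous_on UNIV (\<lambda>S::real^'n^'n. v \<bullet> (S *v v))" by (intro continuous_intros)
  then have "(\<lambda>n. v \<bullet> (S n *v v)) \<longlonglongrightarrow> v \<bullet> (Q *v v)"
    by (rule continuous_on_tendsto_compose[OF _ lim]) auto
  then show "v \<bullet> (Q *v v) \<ge> 0" by (rule LIMSEQ_le_const) (use S(2) in auto)
qed

section \<open>Linear images and studentisation\<close>

definition lin_pair :: "real^'n^'p \<Rightarrow> (real^'n) \<times> (real^'n^'k) \<Rightarrow> (real^'p) \<times> (real^'p^'k)" where
  "lin_pair C x = (C *v fst x, \<chi> j. C *v (snd x $ j))"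

lemma continuous_on_lin_pair: "continuous_on S (lin_pair C)"
  unfolding lin_pair_def by (intro continuous_intros continuous_on_vec_lambda)

lemma lin_pair_approx_limit:
  "lin_pair C (approx_limit \<phi> lam n x) = approx_limit \<phi> lam n (\<lambda>r. C *v x r)"
  by (simp add: lin_pair_def approx_limit_def rsum_linear_path[OF matrix_vector_mul_linear]
      matrix_vector_mult_diff_distrib matrix_vector_scaleR)

definition OmK :: "real^'p^'k \<Rightarrow> real^'p^'p" where
  "OmK c = (1 / real CARD('k)) *\<^sub>R (\<Sum>j\<in>UNIV. outer (c $ j) (c $ j))"

lemma continuous_on_OmK [continuous_intros]: "continuous_on S f \<Longrightarrow> continuous_on S (\<lambda>x. OmK (f x))"
  unfolding OmK_def by (intro continuous_intros)

lemma borel_measurable_OmK [measurable (raw)]: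
  "f \<in> borel_measurable M \<Longrightarrow> (\<lambda>x. OmK (f x)) \<in> borel_measurable M"
  by (rule continuous_borel_measurable_comp[OF continuous_on_OmK[OF continuous_on_id]])

lemma OmK_linear: "OmK (\<chi> j. C *v (c $ j)) = C ** OmK c ** transpose C"
  by (simp add: OmK_def outer_matrix_left outer_matrix_right matrix_mult_sum_left matrix_mult_sum_right
      matrix_mult_scaleR_left matrix_mult_scaleR_right matrix_mul_assoc)

text \<open>As \<open>Qhat\<close> is symmetric, the sandwich is the average of outer products of
  the very vectors whose limit (b) describes.\<close>

lemma Vhat_OmK:
  fixes \<phi> :: "'k::finite \<Rightarrow> real \<Rightarrow> real"
  assumes "invertible (Qhat lam T xs zs)"
  shows "Vhat Rc lam T xs zs ys \<phi> = OmK (\<chi> j. Rmat Rc *v (matrix_inv (Qhat lam T xs zs) *v vj lam T xs zs ys (\<phi> j)))"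
proof -
  let ?C = "Rmat Rc ** matrix_inv (Qhat lam T xs zs)"
  have "transpose (Qhat lam T xs zs) = Qhat lam T xs zs"
    by (simp add: Qhat_def SXX_def transpose_scaleR_matrix transpose_sum transpose_outer)
  then have t: "transpose ?C = matrix_inv (Qhat lam T xs zs) ** transpose (Rmat Rc)"
    by (simp add: matrix_transpose_mul transpose_matrix_inv_symmetric[OF assms])
  have "OmK (\<chi> j. ?C *v ((\<chi> j. vj lam T xs zs ys (\<phi> j)) $ j)) = ?C ** OmK (\<chi> j. vj lam T xs zs ys (\<phi> j)) ** transpose ?C"
    by (rule OmK_linear)
  then show ?thesis
    by (simp add: Vhat_def Omega_hat_def OmK_def t matrix_mul_assoc matrix_vector_mul_assoc)
qed

text \<open>If w solves D Om D' w = D V, cancelling D shows that D' w is the inverse of Om applied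
  to V. This invariance frees the studentised limit from nuisance parameters.\<close>

lemma wald_form_invariant:
  fixes D :: "real^'p^'p"
  assumes D: "invertible D" and Om: "invertible Om"
  shows "invertible (D ** Om ** transpose D)"
    "(D *v V) \<bullet> (matrix_inv (D ** Om ** transpose D) *v (D *v V)) = V \<bullet> (matrix_inv Om *v V)"
proof -
  have tD: "invertible (transpose D)" using D by (simp add: invertible_det_nz)
  show i: "invertible (D ** Om ** transpose D)" using D Om tD by (intro invertible_mult)
  define w where "w = matrix_inv (D ** Om ** transpose D) *v (D *v V)"
  have "(D ** Om ** transpose D) *v w = D *v V"
    unfolding w_def by (simp add: matrix_vector_mul_assoc[of _ "matrix_inv _"] invertible_matrix_inv[OF i])
  then have "D *v (Om *v (transpose D *v w) - V) = 0"
    by (simp add: matrix_vector_mult_diff_distrib matrix_vector_mul_assoc matrix_mul_assoc)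
  then have "Om *v (transpose D *v w) = V" using invertible_injectiveD[OF D] by fastforce
  then have "transpose D *v w = matrix_inv Om *v V"
    by (metis invertible_matrix_inv(2)[OF Om] matrix_vector_mul_assoc matrix_vector_mul_lid)
  moreover have "(D *v V) \<bullet> w = V \<bullet> (transpose D *v w)"
    by (metis dot_lmul_matrix inner_commute transpose_matrix_vector)
  ultimately show "(D *v V) \<bullet> (matrix_inv (D ** Om ** transpose D) *v (D *v V)) = V \<bullet> (matrix_inv Om *v V)"
    by (simp add: w_def)
qed

theorem theorem2:
  fixes lam :: real
    and P :: "'a measure"
    and X :: "nat \<Rightarrow> 'a \<Rightarrow> real^'m"
    and Z :: "nat \<Rightarrow> 'a \<Rightarrow> real^'l"
    and u :: "nat \<Rightarrow> 'a \<Rightarrow> real"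
    and b1 b2 :: "real^'m" and g :: "real^'l"
    and \<phi> :: "'k::finite \<Rightarrow> real \<Rightarrow> real"
    and Rc :: "real^'m^'p"
    and Q :: "real^('m + 'l)^('m + 'l)"
    and Lam :: "real^('m + 'l)^('m + 'l)"
    and M :: "'b measure" and W :: "real \<Rightarrow> 'b \<Rightarrow> real^('m + 'l)"
    and IW :: "'k \<Rightarrow> 'b \<Rightarrow> real^('m + 'l)"
    and N :: "'c measure" and Wp :: "real \<Rightarrow> 'c \<Rightarrow> real^'p"
    and IWp :: "'k \<Rightarrow> 'c \<Rightarrow> real^'p"
  assumes lam: "0 < lam" "lam < 1"
    and P: "prob_space P"
    and meas: "\<And>t. X t \<in> borel_measurable P" "\<And>t. Z t \<in> borel_measurable P"
              "\<And>t. u t \<in> borel_measurable P"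
    and A3: "\<And>j. piecewise_mono_C1 (\<phi> j)"
    and Qinv: "invertible Q"
    and B1: "\<And>e. e > 0 \<Longrightarrow> (\<lambda>T. measure P {\<omega>\<in>space P. \<exists>r\<in>{0..1}.
               norm ((1 / real T) *\<^sub>R (\<Sum>t\<in>{1..nat \<lfloor>real T * r\<rfloor>}.
                   outer (join (X t \<omega>) (Z t \<omega>)) (join (X t \<omega>) (Z t \<omega>))) - r *\<^sub>R Q) > e})
             \<longlonglongrightarrow> 0"
    and BM: "std_BM M W"
    and B2: "fconv_distr P
               (\<lambda>T \<omega> r. (1 / sqrt (real T)) *\<^sub>R
                   (\<Sum>t\<in>{1..nat \<lfloor>real T * r\<rfloor>}. u t \<omega> *\<^sub>R join (X t \<omega>) (Z t \<omega>)))
               M (\<lambda>\<omega> r. Lam *v W r \<omega>)"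
    and IW: "\<And>j. wiener_int M W (\<lambda>r. phitil (\<phi> j) lam r) (IW j)"
    and BMp: "std_BM N Wp"
    and IWp: "\<And>j. wiener_int N Wp (\<lambda>r. phitil (\<phi> j) lam r) (IWp j)"
  shows
    "conv_distr P
       (\<lambda>T \<omega>. Rmat Rc *v (sqrt (real T) *\<^sub>R
          (bhat lam T (\<lambda>t. X t \<omega>) (\<lambda>t. Z t \<omega>)
             (Ymod lam T b1 b2 g (\<lambda>t. X t \<omega>) (\<lambda>t. Z t \<omega>) (\<lambda>t. u t \<omega>)) - stack b1 b2)))
       M (\<lambda>\<omega>. (Rc ** matrix_inv (QXX Q) ** LamX Lam) *v
          ((1 / lam) *\<^sub>R (W lam \<omega> - W 0 \<omega>) - (1 / (1 - lam)) *\<^sub>R (W 1 \<omega> - W lam \<omega>)))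
   \<and> conv_distr P
       (\<lambda>T \<omega>. (\<chi> j. Rmat Rc *v (matrix_inv (Qhat lam T (\<lambda>t. X t \<omega>) (\<lambda>t. Z t \<omega>)) *v
          vj lam T (\<lambda>t. X t \<omega>) (\<lambda>t. Z t \<omega>)
             (Ymod lam T b1 b2 g (\<lambda>t. X t \<omega>) (\<lambda>t. Z t \<omega>) (\<lambda>t. u t \<omega>)) (\<phi> j))) :: real^'p^'k)
       M (\<lambda>\<omega>. (\<chi> j. (Rc ** matrix_inv (QXX Q) ** LamX Lam) *v IW j \<omega>) :: real^'p^'k)
   \<and> ((Rc *v (b1 - b2) = 0
       \<and> rank (Rc ** matrix_inv (QXX Q) ** LamX Lam) = CARD('p)
       \<and> (AE \<omega> in N. invertible ((1 / real CARD('k)) *\<^sub>R (\<Sum>j\<in>UNIV. outer (IWp j \<omega>) (IWp j \<omega>)))))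
      \<longrightarrow>
       conv_distr P
         (\<lambda>T \<omega>. Fstat Rc lam T (\<lambda>t. X t \<omega>) (\<lambda>t. Z t \<omega>)
             (Ymod lam T b1 b2 g (\<lambda>t. X t \<omega>) (\<lambda>t. Z t \<omega>) (\<lambda>t. u t \<omega>)) \<phi>)
         N (\<lambda>\<omega>. let V = (1 / lam) *\<^sub>R (Wp lam \<omega> - Wp 0 \<omega>) - (1 / (1 - lam)) *\<^sub>R (Wp 1 \<omega> - Wp lam \<omega>);
                    Om = (1 / real CARD('k)) *\<^sub>R (\<Sum>j\<in>UNIV. outer (IWp j \<omega>) (IWp j \<omega>))
                in V \<bullet> (matrix_inv Om *v V))
       \<and> (CARD('p) = 1 \<longrightarrow> (\<forall>i::'p.
          conv_distr P
            (\<lambda>T \<omega>. tstat Rc lam T (\<lambda>t. X t \<omega>) (\<lambda>t. Z t \<omega>)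
               (Ymod lam T b1 b2 g (\<lambda>t. X t \<omega>) (\<lambda>t. Z t \<omega>) (\<lambda>t. u t \<omega>)) \<phi> i)
            N (\<lambda>\<omega>. let V = (1 / lam) *\<^sub>R (Wp lam \<omega> - Wp 0 \<omega>) - (1 / (1 - lam)) *\<^sub>R (Wp 1 \<omega> - Wp lam \<omega>);
                       Om = (1 / real CARD('k)) *\<^sub>R (\<Sum>j\<in>UNIV. outer (IWp j \<omega>) (IWp j \<omega>))
                   in V $ i / sqrt (Om $ i $ i)))))"
proof -
  note [measurable] = meas
  have M: "prob_space M" and Wm: "\<And>t. t \<in> {0..1} \<Longrightarrow> W t \<in> borel_measurable M"
    and Wc: "AE \<omega> in M. continuous_on {0..1} (\<lambda>t. W t \<omega>)"
    using BM by (auto simp: std_BM_def)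
  have N: "prob_space N" and Wpm: "\<And>t. t \<in> {0..1} \<Longrightarrow> Wp t \<in> borel_measurable N"
    using BMp by (auto simp: std_BM_def)
  define \<xi> where "\<xi> t \<omega> = join (X t \<omega>) (Z t \<omega>)" for t \<omega>
  have \<xi>m[measurable]: "\<xi> t \<in> borel_measurable P" for t unfolding \<xi>_def[abs_def] join_def by measurable
  \<comment> \<open>Partial sums with an integer index: the process in \<open>B2\<close> at r is the
    value at floor (T r), and the summands reappear as increments, as
    \<open>conv_distr_weighted_sums\<close> expects.\<close>
  define y where "y T \<omega> t = (1 / sqrt (real T)) *\<^sub>R (\<Sum>s\<in>{1..t}. u s \<omega> *\<^sub>R \<xi> s \<omega>)" for T \<omega> t
  define A :: "nat \<Rightarrow> 'a \<Rightarrow> ('m + 'l, 'k) moments" where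
    "A T \<omega> = (\<chi> i. (1 / real T) *\<^sub>R (\<Sum>t\<in>{1..T}. rwgt \<phi> lam i (real t / real T) *\<^sub>R outer (\<xi> t \<omega>) (\<xi> t \<omega>)))" for T \<omega>
  define s :: "nat \<Rightarrow> 'a \<Rightarrow> ('m + 'l, 'k) scores" where
    "s T \<omega> = (\<chi> i. \<Sum>t\<in>{1..T}. rwgt \<phi> lam i (real t / real T) *\<^sub>R (y T \<omega> t - y T \<omega> (t - 1)))" for T \<omega>
  define \<mu> where "\<mu> i = integral {0..1} (rwgt \<phi> lam i)" for i
  define Ainf :: "('m + 'l, 'k) moments" where "Ainf = (\<chi> i. \<mu> i *\<^sub>R Q)"
  \<comment> \<open>Pathwise integrals against the limit of the partial sums; for almost every path
    the \<open>lim\<close> is a true limit, since the weights have bounded variation.\<close>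
  define J :: "'b \<Rightarrow> ('m + 'l, 'k) scores" where
    "J \<omega> = (\<chi> i. lim (\<lambda>n. rsum n (rwgt \<phi> lam i) (\<lambda>r. Lam *v W r \<omega>)))" for \<omega>
  define B where "B = Rc ** matrix_inv (QXX Q) ** LamX Lam"
  let ?ys = "\<lambda>T \<omega>. Ymod lam T b1 b2 g (\<lambda>t. X t \<omega>) (\<lambda>t. Z t \<omega>) (\<lambda>t. u t \<omega>)"
  define stat where "stat T \<omega> = (Rmat Rc *v (sqrt (real T) *\<^sub>R
          (bhat lam T (\<lambda>t. X t \<omega>) (\<lambda>t. Z t \<omega>) (?ys T \<omega>) - stack b1 b2)),
       (\<chi> j. Rmat Rc *v (matrix_inv (Qhat lam T (\<lambda>t. X t \<omega>) (\<lambda>t. Z t \<omega>)) *v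
          vj lam T (\<lambda>t. X t \<omega>) (\<lambda>t. Z t \<omega>) (?ys T \<omega>) (\<phi> j))) :: real^'p^'k)" for T \<omega>
  have ym[measurable]: "(\<lambda>\<omega>. y T \<omega> t) \<in> borel_measurable P" for T t unfolding y_def by measurable
  have Am[measurable]: "A T \<in> borel_measurable P" for T unfolding A_def[abs_def] by measurable
  have sm[measurable]: "s T \<in> borel_measurable P" for T unfolding s_def[abs_def] by measurable
  have LWm: "(\<lambda>\<omega>. Lam *v W r \<omega>) \<in> borel_measurable M" if "r \<in> {0..1}" for r using Wm[OF that] by measurable
  have Jm: "J \<in> borel_measurable M" unfolding J_def[abs_def]
    using LWm by (intro borel_measurable_vec_lambda borel_measurable_lim_metric borel_measurable_rsum) auto
  have Ym: "(\<lambda>\<omega>. ?ys T \<omega> t) \<in> borel_measurable P" for T t by (rule borel_measurable_Ymod[OF meas])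
  note stat_meas = borel_measurable_bhat[OF meas(1,2) Ym] borel_measurable_Qhat[OF meas(1,2) Ym] borel_measurable_vj[OF meas(1,2) Ym]
  have statm: "stat T \<in> borel_measurable P" for T
    unfolding stat_def[abs_def] using stat_meas by measurable
  note bv = rwgt_bv01[OF A3]
  have B1': "\<And>e. e > 0 \<Longrightarrow> (\<lambda>T. measure P {\<omega>\<in>space P. \<exists>r\<in>{0..1}.
       norm ((1 / real T) *\<^sub>R (\<Sum>t\<in>{1..nat \<lfloor>real T * r\<rfloor>}. outer (\<xi> t \<omega>) (\<xi> t \<omega>)) - r *\<^sub>R Q) > e}) \<longlonglongrightarrow> 0"
    unfolding \<xi>_def by (rule B1)
  have lln: "(\<lambda>T. \<integral>\<omega>. min 1 (dist Ainf (A T \<omega>)) \<partial>P) \<longlonglongrightarrow> 0"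
  proof (rule truncated_mean_vec[OF P Am])
    show "(\<lambda>T. \<integral>\<omega>. min 1 (dist (Ainf $ i) (A T \<omega> $ i)) \<partial>P) \<longlonglongrightarrow> 0" for i
      unfolding Ainf_def A_def \<mu>_def vec_lambda_beta
      by (rule weighted_lln[OF P _ B1' bv]) measurable
  qed
  have conv1: "conv_distr P (\<lambda>T \<omega>. (A T \<omega>, s T \<omega>)) M (\<lambda>\<omega>. (Ainf, J \<omega>))"
    unfolding s_def J_def
  proof (rule conv_distr_weighted_sums[OF P M LWm _ ym _ B2 bv Am lln])
    show "AE \<omega> in M. continuous_on {0..1} (\<lambda>r. Lam *v W r \<omega>)"
      using Wc by eventually_elim (intro continuous_intros)
  qed (auto simp: y_def \<xi>_def)
  have sym: "transpose Q = Q" and psd: "\<And>v. v \<bullet> (Q *v v) \<ge> 0"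
    using lln_limit_psd[OF P \<xi>m B1'] by auto
  have \<mu>N: "\<mu> (None, True) = lam" "\<mu> (None, False) = 1 - lam"
    unfolding \<mu>_def integral_rwgt[OF A3 lam] using lam by (simp_all add: wgt_def[abs_def])
  \<comment> \<open>The diagonal blocks of Q are invertible because Q is symmetric, positive
    semidefinite and invertible.\<close>
  interpret L: limit_moments Q lam \<mu> Ainf
    using sym psd_block_invertible[OF sym psd Qinv] Qinv lam \<mu>N by unfold_locales (auto simp: Ainf_def)
  have good: "(Ainf, v) \<in> good_moments" for v
    unfolding good_moments_def using L.invZ L.cXX_limit_invertible by (simp add: L.sZZ_limit_None)
  have AJm: "(\<lambda>\<omega>. (Ainf, J \<omega>)) \<in> borel_measurable M" using Jm by measurable
  have Asm: "(\<lambda>\<omega>. (A T \<omega>, s T \<omega>)) \<in> borel_measurable P" for T by measurable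
  have conv2: "conv_distr P (\<lambda>T \<omega>. stat_map Rc (A T \<omega>, s T \<omega>)) M (\<lambda>\<omega>. stat_map Rc (Ainf, J \<omega>))"
    by (rule conv_distr_continuous_on_open[OF P M Asm AJm conv1 open_good_moments _ continuous_on_stat_map borel_measurable_stat_map])
      (simp add: good)
  \<comment> \<open>The events on which the finite-sample identities hold. Their probability tends
    to 1 because the limit of the moments lies in the open set \<open>good_moments\<close>.\<close>
  define E where "E T = {\<omega>\<in>space P. (A T \<omega>, s T \<omega>) \<in> good_moments}" for T
  have E1: "(\<lambda>T. measure P (E T)) \<longlonglongrightarrow> 1"
    unfolding E_def by (rule prob_open_tendsto_1[OF P M Asm AJm conv1 open_good_moments]) (simp add: good)
  have Es: "E T \<in> sets P" for T
  proof -
    have [measurable]: "good_moments \<in> sets (borel :: (('m + 'l, 'k) moments \<times> ('m + 'l, 'k) scores) measure)"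
      by (rule borel_open[OF open_good_moments])
    show ?thesis unfolding E_def using Asm[of T] by measurable
  qed
  have onE: "sample lam T (\<lambda>t. X t \<omega>) (\<lambda>t. Z t \<omega>) (\<lambda>t. u t \<omega>) \<phi> (A T \<omega>) (s T \<omega>)" if T: "T > 0" for T \<omega>
  proof
    show "T > 0" "0 < lam" by fact+
    show "A T \<omega> $ i = (1 / real T) *\<^sub>R (\<Sum>t\<in>{1..T}. rwgt \<phi> lam i (real t / real T) *\<^sub>R outer (join (X t \<omega>) (Z t \<omega>)) (join (X t \<omega>) (Z t \<omega>)))" for i
      by (simp add: A_def \<xi>_def)
    have yd: "y T \<omega> t - y T \<omega> (t - 1) = (1 / sqrt (real T)) *\<^sub>R (u t \<omega> *\<^sub>R \<xi> t \<omega>)" if t: "t \<in> {1..T}" for t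
    proof -
      obtain r where r: "t = Suc r" using t by (cases t) auto
      show ?thesis unfolding r y_def by (simp add: algebra_simps)
    qed
    have "s T \<omega> $ i = (\<Sum>t\<in>{1..T}. rwgt \<phi> lam i (real t / real T) *\<^sub>R ((1 / sqrt (real T)) *\<^sub>R (u t \<omega> *\<^sub>R \<xi> t \<omega>)))" for i
      unfolding s_def vec_lambda_beta by (rule sum.cong[OF refl]) (simp only: yd)
    then show "s T \<omega> $ i = (1 / sqrt (real T)) *\<^sub>R (\<Sum>t\<in>{1..T}. (rwgt \<phi> lam i (real t / real T) * u t \<omega>) *\<^sub>R join (X t \<omega>) (Z t \<omega>))" for i
      by (simp add: scaleR_sum_right \<xi>_def mult_ac)
  qed
  have inv12: "invertible (sZZ (A T \<omega>) None)" "invertible (cXX (A T \<omega>) None)" if "\<omega> \<in> E T" for T \<omega>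
    using that by (auto simp: E_def good_moments_def)
  have statE: "stat T \<omega> = stat_map Rc (A T \<omega>, s T \<omega>)" and QhatE: "invertible (Qhat lam T (\<lambda>t. X t \<omega>) (\<lambda>t. Z t \<omega>))"
    if T: "T > 0" and w: "\<omega> \<in> E T" for T \<omega>
  proof -
    interpret S: sample lam T "\<lambda>t. X t \<omega>" "\<lambda>t. Z t \<omega>" "\<lambda>t. u t \<omega>" b1 b2 g \<phi> "A T \<omega>" "s T \<omega>"
      by (rule onE[OF T])
    note i = inv12[OF w]
    show "stat T \<omega> = stat_map Rc (A T \<omega>, s T \<omega>)"
      unfolding stat_def stat_map_def S.bhat_sample[OF i] S.vj_sample[OF i] S.SXX_sample(2)[OF i(1)] by simp
    show "invertible (Qhat lam T (\<lambda>t. X t \<omega>) (\<lambda>t. Z t \<omega>))" using S.SXX_sample(2)[OF i(1)] i(2) by simp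
  qed
  have smm: "(\<lambda>\<omega>. stat_map Rc (A T \<omega>, s T \<omega>)) \<in> borel_measurable P" for T
    using measurable_compose[OF Asm borel_measurable_stat_map] .
  have conv3: "conv_distr P stat M (\<lambda>\<omega>. stat_map Rc (Ainf, J \<omega>))"
    by (rule conv_distr_eventually_equal[OF P statm smm conv2 Es E1 statE])
  have smv: "stat_map Rc (Ainf, v) = (Rc *v (matrix_inv (QXX Q) *v pX ((1 / lam) *\<^sub>R v $ (None, True) - (1 / (1 - lam)) *\<^sub>R v $ (None, False))),
      \<chi> j. Rc *v (matrix_inv (QXX Q) *v pX ((1 / lam) *\<^sub>R (v $ (Some j, True) - (\<mu> (Some j, True) / lam) *\<^sub>R v $ (None, True))
     - (1 / (1 - lam)) *\<^sub>R (v $ (Some j, False) - (\<mu> (Some j, False) / (1 - lam)) *\<^sub>R v $ (None, False)))))" for v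
    unfolding stat_map_def fst_conv snd_conv L.Rmat_cq_limit L.Rmat_cv_limit ..
  \<comment> \<open>With Riemann sums in place of the scores the limiting map is exactly a linear
    image of \<open>approx_limit\<close>: the weights recombine to the transformed functions, and
    Lam passes through the sums.\<close>
  have Zn: "stat_map Rc (Ainf, \<chi> i. rsum n (rwgt \<phi> lam i) (\<lambda>r. Lam *v x r)) = lin_pair B (approx_limit \<phi> lam n x)" for n x
  proof -
    have ph: "rsum n (phitil (\<phi> j) lam) x' = (1 / lam) *\<^sub>R (rsum n (rwgt \<phi> lam (Some j, True)) x' - (\<mu> (Some j, True) / lam) *\<^sub>R rsum n (rwgt \<phi> lam (None, True)) x')
      - (1 / (1 - lam)) *\<^sub>R (rsum n (rwgt \<phi> lam (Some j, False)) x' - (\<mu> (Some j, False) / (1 - lam)) *\<^sub>R rsum n (rwgt \<phi> lam (None, False)) x')"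
      for j and x' :: "real \<Rightarrow> real^('m + 'l)"
      by (simp only: phitil_rwgt[where \<phi>=\<phi> and j=j, OF A3 lam] rsum_weight_linear \<mu>_def)
    have pXr: "Rc *v (matrix_inv (QXX Q) *v pX (Lam *v z)) = B *v z" for z
      by (simp add: pX_matrix_vector B_def matrix_vector_mul_assoc matrix_mul_assoc)
    have lin: "(1 / lam) *\<^sub>R rsum n f (\<lambda>r. Lam *v x r) - (1 / (1 - lam)) *\<^sub>R rsum n h (\<lambda>r. Lam *v x r)
       = Lam *v ((1 / lam) *\<^sub>R rsum n f x - (1 / (1 - lam)) *\<^sub>R rsum n h x)" for f h
      by (simp add: rsum_linear_path[OF matrix_vector_mul_linear] matrix_vector_mult_diff_distrib matrix_vector_scaleR)
    show ?thesis
      unfolding smv vec_lambda_beta ph[symmetric] lin pXr lin_pair_def approx_limit_def fst_conv snd_conv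
      by (simp add: rsum_linear_path[OF matrix_vector_mul_linear] pXr)
  qed
  \<comment> \<open>This and the next convergence concern the same sequence. One limit is built from
    pathwise integrals, the other from the given Wiener integrals; uniqueness of weak limits
    identifies their laws.\<close>
  have conv4: "conv_distr M (\<lambda>n \<omega>. lin_pair B (approx_limit \<phi> lam n (\<lambda>r. W r \<omega>))) M (\<lambda>\<omega>. stat_map Rc (Ainf, J \<omega>))"
  proof -
    have c: "continuous_on UNIV (\<lambda>v. stat_map Rc (Ainf, v))"
      by (rule continuous_on_compose2[OF continuous_on_stat_map]) (auto intro!: continuous_intros simp: good)
    have "conv_distr M (\<lambda>n \<omega>. (\<chi> i. rsum n (rwgt \<phi> lam i) (\<lambda>r. Lam *v W r \<omega>)) :: ('m + 'l, 'k) scores) M J"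
    proof (rule conv_distr_AE[OF M _ Jm])
      show "(\<lambda>\<omega>. (\<chi> i. rsum n (rwgt \<phi> lam i) (\<lambda>r. Lam *v W r \<omega>)) :: ('m + 'l, 'k) scores) \<in> borel_measurable M" for n
        using LWm by (intro borel_measurable_vec_lambda borel_measurable_rsum) auto
      show "AE \<omega> in M. (\<lambda>n. (\<chi> i. rsum n (rwgt \<phi> lam i) (\<lambda>r. Lam *v W r \<omega>)) :: ('m + 'l, 'k) scores) \<longlonglongrightarrow> J \<omega>"
        using Wc
      proof eventually_elim
        case (elim \<omega>)
        have "continuous_on {0..1} (\<lambda>r. Lam *v W r \<omega>)" using elim by (intro continuous_intros)
        then show ?case unfolding J_def
          using rsum_convergent[OF bv] by (intro tendsto_vec_lambda) (simp add: convergent_LIMSEQ_iff)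
      qed
    qed
    from conv_distr_continuous[OF this c] show ?thesis unfolding Zn .
  qed
  have conv5: "conv_distr M (\<lambda>n \<omega>. lin_pair B (approx_limit \<phi> lam n (\<lambda>r. W r \<omega>))) M
      (\<lambda>\<omega>. lin_pair B (bm_contrast (\<lambda>r. W r \<omega>) lam, \<chi> j. IW j \<omega>))"
    by (rule conv_distr_continuous[OF conv_distr_approx_limit[OF BM lam IW] continuous_on_lin_pair])
  have conv6: "conv_distr P stat M (\<lambda>\<omega>. lin_pair B (bm_contrast (\<lambda>r. W r \<omega>) lam, \<chi> j. IW j \<omega>))"
    by (rule conv_distr_transfer[OF conv3 conv_distr_limit_unique[OF conv4 conv5]])
  have a: "conv_distr P (\<lambda>T \<omega>. fst (stat T \<omega>)) M (\<lambda>\<omega>. B *v bm_contrast (\<lambda>r. W r \<omega>) lam)"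
    using conv_distr_continuous[OF conv6 continuous_on_fst[OF continuous_on_id]] by (simp add: lin_pair_def)
  have b: "conv_distr P (\<lambda>T \<omega>. snd (stat T \<omega>)) M (\<lambda>\<omega>. \<chi> j. B *v IW j \<omega>)"
    using conv_distr_continuous[OF conv6 continuous_on_snd[OF continuous_on_id]] by (simp add: lin_pair_def)
  have c: "conv_distr P (\<lambda>T \<omega>. Fstat Rc lam T (\<lambda>t. X t \<omega>) (\<lambda>t. Z t \<omega>) (?ys T \<omega>) \<phi>)
         N (\<lambda>\<omega>. bm_contrast (\<lambda>r. Wp r \<omega>) lam \<bullet> (matrix_inv (OmK (\<chi> j. IWp j \<omega>)) *v bm_contrast (\<lambda>r. Wp r \<omega>) lam))" (is ?F)
    and d: "CARD('p) = 1 \<longrightarrow> conv_distr P (\<lambda>T \<omega>. tstat Rc lam T (\<lambda>t. X t \<omega>) (\<lambda>t. Z t \<omega>) (?ys T \<omega>) \<phi> i)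
         N (\<lambda>\<omega>. bm_contrast (\<lambda>r. Wp r \<omega>) lam $ i / sqrt (OmK (\<chi> j. IWp j \<omega>) $ i $ i))" (is "_ \<longrightarrow> ?T")
    if H0: "Rc *v (b1 - b2) = 0" and rank: "rank B = CARD('p)" and Om: "AE \<omega> in N. invertible (OmK (\<chi> j. IWp j \<omega>))"
    for i :: 'p
  proof -
    \<comment> \<open>D is a square substitute for B with the same covariance, acting on the
      p-dimensional \<open>Wp\<close>.\<close>
    obtain D :: "real^'p^'p" where D: "B ** transpose B = D ** transpose D" "invertible D" "CARD('p) = 1 \<Longrightarrow> D $ i $ i > 0"
      using full_row_rank_factorization[OF rank, of i] by blast
    define Y where "Y \<omega> = (bm_contrast (\<lambda>r. Wp r \<omega>) lam, (\<chi> j. IWp j \<omega>) :: real^'p^'k)" for \<omega>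
    have IWpm[measurable]: "IWp j \<in> borel_measurable N" for j using IWp[of j] by (simp add: wiener_int_def)
    have [measurable]: "Wp 0 \<in> borel_measurable N" "Wp 1 \<in> borel_measurable N" "Wp lam \<in> borel_measurable N"
      using Wpm lam by auto
    have Vm[measurable]: "(\<lambda>\<omega>. bm_contrast (\<lambda>r. Wp r \<omega>) lam) \<in> borel_measurable N"
      unfolding bm_contrast_def by measurable
    have Ym[measurable]: "Y \<in> borel_measurable N" unfolding Y_def[abs_def] by measurable
    have DYm[measurable]: "(\<lambda>\<omega>. lin_pair D (Y \<omega>)) \<in> borel_measurable N"
      by (rule continuous_borel_measurable_comp[OF continuous_on_lin_pair Ym])
    have convN: "conv_distr N (\<lambda>n \<omega>. lin_pair D (approx_limit \<phi> lam n (\<lambda>r. Wp r \<omega>))) N (\<lambda>\<omega>. lin_pair D (Y \<omega>))"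
      unfolding Y_def by (rule conv_distr_continuous[OF conv_distr_approx_limit[OF BMp lam IWp] continuous_on_lin_pair])
    \<comment> \<open>The law is carried from W to \<open>Wp\<close> for each n, where only finitely
      many path values enter; n tends to infinity afterwards on both sides.\<close>
    have conv7: "conv_distr P stat N (\<lambda>\<omega>. lin_pair D (Y \<omega>))"
    proof (rule conv_distr_transfer[OF conv6])
      fix h :: "(real^'p) \<times> (real^'p^'k) \<Rightarrow> real" assume h: "continuous_on UNIV h" "bounded (range h)"
      have eq: "(\<integral>\<omega>. h (lin_pair B (approx_limit \<phi> lam n (\<lambda>r. W r \<omega>))) \<partial>M) = (\<integral>\<omega>. h (lin_pair D (approx_limit \<phi> lam n (\<lambda>r. Wp r \<omega>))) \<partial>N)" for n
        unfolding lin_pair_approx_limit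
      proof (rule std_BM_law_transfer[OF BM BMp D(1) fin_lin_approx_limit _ _ h])
        show "(\<lambda>\<omega>. approx_limit \<phi> lam n (\<lambda>r. B *v W r \<omega>)) \<in> borel_measurable M"
          using Wm by (intro borel_measurable_approx_limit borel_measurable_matrix_vector_mult) auto
        show "(\<lambda>\<omega>. approx_limit \<phi> lam n (\<lambda>r. D *v Wp r \<omega>)) \<in> borel_measurable N"
          using Wpm by (intro borel_measurable_approx_limit borel_measurable_matrix_vector_mult) auto
      qed
      have "(\<lambda>n. \<integral>\<omega>. h (lin_pair B (approx_limit \<phi> lam n (\<lambda>r. W r \<omega>))) \<partial>M)
          \<longlonglongrightarrow> (\<integral>\<omega>. h (lin_pair B (bm_contrast (\<lambda>r. W r \<omega>) lam, \<chi> j. IW j \<omega>)) \<partial>M)"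
        using conv5 h unfolding conv_distr_def by blast
      moreover have "(\<lambda>n. \<integral>\<omega>. h (lin_pair D (approx_limit \<phi> lam n (\<lambda>r. Wp r \<omega>))) \<partial>N) \<longlonglongrightarrow> (\<integral>\<omega>. h (lin_pair D (Y \<omega>)) \<partial>N)"
        using convN h unfolding conv_distr_def by blast
      ultimately show "(\<integral>\<omega>. h (lin_pair B (bm_contrast (\<lambda>r. W r \<omega>) lam, \<chi> j. IW j \<omega>)) \<partial>M) = (\<integral>\<omega>. h (lin_pair D (Y \<omega>)) \<partial>N)"
        unfolding eq by (rule LIMSEQ_unique)
    qed
    have OmD: "OmK (snd (lin_pair D (Y \<omega>))) = D ** OmK (\<chi> j. IWp j \<omega>) ** transpose D" for \<omega>
      by (simp only: lin_pair_def snd_conv OmK_linear Y_def)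
    have VD: "fst (lin_pair D (Y \<omega>)) = D *v bm_contrast (\<lambda>r. Wp r \<omega>) lam" for \<omega>
      by (simp add: lin_pair_def Y_def)
    \<comment> \<open>Under the null hypothesis centring at the true coefficients has no effect
      after multiplication by R.\<close>
    have R0: "Rmat Rc *v stack b1 b2 = 0" by (simp only: Rmat_stack H0)
    have fst_stat: "fst (stat T \<omega>) = sqrt (real T) *\<^sub>R (Rmat Rc *v bhat lam T (\<lambda>t. X t \<omega>) (\<lambda>t. Z t \<omega>) (?ys T \<omega>))" for T \<omega>
      by (simp add: stat_def matrix_vector_scaleR matrix_vector_mult_diff_distrib R0)
    have snd_stat: "OmK (snd (stat T \<omega>)) = Vhat Rc lam T (\<lambda>t. X t \<omega>) (\<lambda>t. Z t \<omega>) (?ys T \<omega>) \<phi>" if "T > 0" "\<omega> \<in> E T" for T \<omega>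
      unfolding Vhat_OmK[OF QhatE[OF that]] by (simp add: stat_def)
    let ?hF = "\<lambda>x :: (real^'p) \<times> (real^'p^'k). fst x \<bullet> (matrix_inv (OmK (snd x)) *v fst x)"
    let ?hT = "\<lambda>x :: (real^'p) \<times> (real^'p^'k). fst x $ i / sqrt (OmK (snd x) $ i $ i)"
    have f: "(fst :: (real^'p) \<times> (real^'p^'k) \<Rightarrow> _) \<in> borel_measurable borel"
      and sn: "(snd :: (real^'p) \<times> (real^'p^'k) \<Rightarrow> _) \<in> borel_measurable borel"
      by (intro borel_measurable_continuous_onI continuous_intros)+
    have hF: "?hF \<in> borel_measurable borel"
      by (intro borel_measurable_inner borel_measurable_matrix_vector_mult borel_measurable_matrix_inv borel_measurable_OmK f sn)
    have [measurable]: "(\<lambda>x :: (real^'p) \<times> (real^'p^'k). OmK (snd x) $ i $ i) \<in> borel_measurable borel"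
      by (intro borel_measurable_vec_component borel_measurable_OmK sn)
    have hT: "?hT \<in> borel_measurable borel"
      by (rule borel_measurable_divide[OF borel_measurable_vec_component[OF f]]) measurable
    note hFm = measurable_compose[OF statm hF] and hTm = measurable_compose[OF statm hT]
    have convF: "conv_distr P (\<lambda>T \<omega>. ?hF (stat T \<omega>)) N (\<lambda>\<omega>. ?hF (lin_pair D (Y \<omega>)))"
    proof (rule conv_distr_continuous_on_open[OF P N statm DYm conv7, where U="(\<lambda>x. OmK (snd x)) -` {A. invertible A}"])
      show "open ((\<lambda>x. OmK (snd x)) -` {A. invertible A} :: ((real^'p) \<times> (real^'p^'k)) set)"
        by (intro open_vimage open_invertible continuous_intros)
      show "AE \<omega> in N. lin_pair D (Y \<omega>) \<in> (\<lambda>x. OmK (snd x)) -` {A. invertible A}"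
        using Om by eventually_elim (simp add: OmD wald_form_invariant(1)[OF D(2)])
      show "continuous_on ((\<lambda>x. OmK (snd x)) -` {A. invertible A}) ?hF"
        by (intro continuous_intros) auto
    qed (rule hF)
    show ?F
    proof (rule conv_distr_eventually_equal[OF P _ hFm _ Es E1])
      show "(\<lambda>\<omega>. Fstat Rc lam T (\<lambda>t. X t \<omega>) (\<lambda>t. Z t \<omega>) (?ys T \<omega>) \<phi>) \<in> borel_measurable P" for T
        by (rule borel_measurable_Fstat[OF meas(1,2) borel_measurable_Ymod[OF meas]])
      show "conv_distr P (\<lambda>T \<omega>. ?hF (stat T \<omega>)) N (\<lambda>\<omega>. bm_contrast (\<lambda>r. Wp r \<omega>) lam \<bullet> (matrix_inv (OmK (\<chi> j. IWp j \<omega>)) *v bm_contrast (\<lambda>r. Wp r \<omega>) lam))"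
      proof (rule conv_distr_transfer[OF convF])
        fix h :: "real \<Rightarrow> real" assume h: "continuous_on UNIV h"
        have [measurable]: "h \<in> borel_measurable borel" using h by (rule borel_measurable_continuous_onI)
        have [measurable]: "(\<lambda>\<omega>. ?hF (lin_pair D (Y \<omega>))) \<in> borel_measurable N" by (rule measurable_compose[OF DYm hF])
        show "(\<integral>\<omega>. h (?hF (lin_pair D (Y \<omega>))) \<partial>N) = (\<integral>\<omega>. h (bm_contrast (\<lambda>r. Wp r \<omega>) lam \<bullet> (matrix_inv (OmK (\<chi> j. IWp j \<omega>)) *v bm_contrast (\<lambda>r. Wp r \<omega>) lam)) \<partial>N)"
        proof (rule integral_cong_AE)
          show "AE \<omega> in N. h (?hF (lin_pair D (Y \<omega>))) = h (bm_contrast (\<lambda>r. Wp r \<omega>) lam \<bullet> (matrix_inv (OmK (\<chi> j. IWp j \<omega>)) *v bm_contrast (\<lambda>r. Wp r \<omega>) lam))"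
            using Om by eventually_elim (simp only: OmD VD wald_form_invariant(2)[OF D(2)])
        qed measurable
      qed
      show "Fstat Rc lam T (\<lambda>t. X t \<omega>) (\<lambda>t. Z t \<omega>) (?ys T \<omega>) \<phi> = ?hF (stat T \<omega>)" if "T > 0" "\<omega> \<in> E T" for T \<omega>
        unfolding fst_stat snd_stat[OF that] Fstat_def by (simp add: matrix_vector_scaleR)
    qed
    show "CARD('p) = 1 \<longrightarrow> ?T"
    proof
      assume p1: "CARD('p) = 1"
      then have "UNIV = {i}" by (metis UNIV_I card_1_singletonE singletonD)
      have Dv: "(D *v v) $ i = D $ i $ i * v $ i" for v
        by (simp add: matrix_vector_mult_def \<open>UNIV = {i}\<close>)
      have DOm: "(D ** G ** transpose D) $ i $ i = (D $ i $ i)\<^sup>2 * G $ i $ i" for G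
        by (simp add: matrix_matrix_mult_def transpose_def \<open>UNIV = {i}\<close> power2_eq_square)
      note Dpos = D(3)[OF p1]
      \<comment> \<open>The entry of D cancels against the square root of its square because it was
        chosen positive.\<close>
      have lim: "?hT (lin_pair D (Y \<omega>)) = bm_contrast (\<lambda>r. Wp r \<omega>) lam $ i / sqrt (OmK (\<chi> j. IWp j \<omega>) $ i $ i)" for \<omega>
        unfolding OmD VD Dv DOm using Dpos by (simp add: real_sqrt_mult)
      \<comment> \<open>For a single restriction, invertibility keeps the one entry away from 0,
        which is where the t statistic is continuous.\<close>
      have Gi: "G $ i $ i \<noteq> 0" if "invertible G" for G :: "real^'p^'p"
      proof
        assume "G $ i $ i = 0"
        then have "G *v axis i 1 = 0" by (simp add: vec_eq_iff matrix_vector_mult_def \<open>UNIV = {i}\<close>) (metis UNIV_I \<open>UNIV = {i}\<close> singletonD)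
        then have "axis i (1::real) = 0" using invertible_injectiveD[OF that] by blast
        then show False by (simp add: axis_eq_0_iff)
      qed
      have convT: "conv_distr P (\<lambda>T \<omega>. ?hT (stat T \<omega>)) N (\<lambda>\<omega>. ?hT (lin_pair D (Y \<omega>)))"
      proof (rule conv_distr_continuous_on_open[OF P N statm DYm conv7, where U="{x. OmK (snd x) $ i $ i \<noteq> 0}"])
        show "open {x :: (real^'p) \<times> (real^'p^'k). OmK (snd x) $ i $ i \<noteq> 0}"
          by (intro open_Collect_neq continuous_intros)
        show "AE \<omega> in N. lin_pair D (Y \<omega>) \<in> {x. OmK (snd x) $ i $ i \<noteq> 0}"
          using Om by eventually_elim (use Gi Dpos in \<open>simp add: OmD DOm\<close>)
        show "continuous_on {x. OmK (snd x) $ i $ i \<noteq> 0} ?hT"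
          by (intro continuous_intros) auto
      qed (rule hT)
      show ?T
      proof (rule conv_distr_eventually_equal[OF P _ hTm convT[unfolded lim] Es E1])
        show "(\<lambda>\<omega>. tstat Rc lam T (\<lambda>t. X t \<omega>) (\<lambda>t. Z t \<omega>) (?ys T \<omega>) \<phi> i) \<in> borel_measurable P" for T
          by (rule borel_measurable_tstat[OF meas(1,2) borel_measurable_Ymod[OF meas]])
        show "tstat Rc lam T (\<lambda>t. X t \<omega>) (\<lambda>t. Z t \<omega>) (?ys T \<omega>) \<phi> i = ?hT (stat T \<omega>)" if "T > 0" "\<omega> \<in> E T" for T \<omega>
          unfolding fst_stat snd_stat[OF that] tstat_def by simp
      qed
    qed
  qed
  have OmKI: "(1 / real CARD('k)) *\<^sub>R (\<Sum>j\<in>UNIV. outer (IWp j \<omega>) (IWp j \<omega>)) = OmK (\<chi> j. IWp j \<omega>)" for \<omega>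
    by (simp add: OmK_def)
  show ?thesis
    unfolding Let_def OmKI bm_contrast_def[symmetric, where x="\<lambda>r. W r _"] bm_contrast_def[symmetric, where x="\<lambda>r. Wp r _"] B_def[symmetric]
    using a b c d unfolding stat_def fst_conv snd_conv by blast
qed

end
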